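(* Let $(J,\rho)\in\mathcal J_G^{wc}$. We have the following isomorphisms of $\mathbb C$-algebras $$\mathcal Z(\mathcal H(G,\rho))=\mathcal Z(\mathcal H(\mathcal I_G(\rho),\rho))=\mathcal H({}^\dagger J,\rho)\simeq\mathbb C[{}^\dagger J/J].$$ The first two are canonical, while the last is not.
   Context: Setting: $F$ is a non-archimedean local field, $\mathbf G$ a connected reductive $F$-group with center $\mathbf Z$, $G=\mathbf G(F)$, $Z=\mathbf Z(F)$. Representations are smooth and complex; $\mathrm{ind}$ is compact induction. For a group $H$, $X(H)=\mathrm{Hom}(H,\mathbb C^\times)$; for a normal subgroup $H'$, $X(H/H')$ is identified with the characters of $H$ trivial on $H'$. For $g\in G$: $H^g=gHg^{-1}$ and $\sigma^g(x)=\sigma(g^{-1}xg)$. ${}^0G$ is the intersection of the kernels of all unramified characters $g\mapsto|\chi(g)|_F^s$ of $G$ ($\chi$ an $F$-rational character of $\mathbf G$, $s\in\mathbb C$). Fix an open normal subgroup ${}^\flat G$ of $G$, contained in ${}^0G$ with finite index and containing the commutator subgroup of $G$. $\Omega(G)$ is the set of open compact subgroups of $G$; $\Omega(G/Z)$ the set of open subgroups of $G$ containing $Z$ and compact modulo $Z$. For a representation $\sigma$ of $H\subset G$, $\mathcal I_G(\sigma)=\{g\in G:\mathrm{Hom}_{H\cap H^g}(\sigma,\sigma^g)\neq0\}$. $\mathcal J_G$ is the set of pairs $(J,\rho)$, $J\in\Omega(G)$, $\rho\in\mathrm{Irr}(J)$, such that there exist $\tilde J\in\Omega(G/Z)$ with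 $J=\tilde J\cap{}^\flat G$ and $\tilde\rho\in\mathrm{Irr}(\tilde J)$ containing $\rho$ with $\mathcal I_G(\tilde\rho)=\tilde J$ (equivalently $\pi:=\mathrm{ind}_{\tilde J}^G\tilde\rho$ is irreducible, hence supercuspidal). For each $(J,\rho)\in\mathcal J_G$ such a $(\tilde J,\tilde\rho)$ is fixed. $\mathcal J_G^{wc}\subset\mathcal J_G$ is the subset of pairs with $\mathcal I_G(\rho)\subset\tilde J$ (then $\mathcal I_G(\rho)$ is the group of $g\in\tilde J$ with $\rho^g\simeq\rho$). ${}^\dagger J=\bigcap_{\chi}\ker\chi$, the intersection over all $\chi\in X(\tilde J/J)$ with $\tilde\rho\otimes\chi\simeq\tilde\rho$; one has $J\subset{}^\dagger J\subset\mathcal I_G(\rho)$. For a subgroup $H\supset J$ of $G$, $\mathcal H(H,\rho)=\mathrm{End}_H(\mathrm{ind}_J^H\rho)$; for $J\subset H\subset H'$ the functor $\mathrm{ind}_H^{H'}$ (equivalently, extension of functions by zero) gives an injective algebra homomorphism $\mathcal H(H,\rho)\to\mathcal H(H',\rho)$ by which these are compared. $\mathcal Z(\cdot)$ is the center of an algebra. *)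

theory Defs
  imports "HOL-Analysis.Analysis" "HOL-Algebra.Algebra" "HOL-Algebra.Algebraic_Closure_Type"
begin

section \<open>Non-archimedean local fields\<close>

text \<open>The absolute value of the field is \<open>dist x 0\<close>.  It is normalised: a uniformiser has absolute
  value \<open>1/q\<close>, where \<open>q\<close> is the number of elements of the residue field.\<close>

definition fabs :: "'f::{field,metric_space} \<Rightarrow> real" where
  "fabs x = dist x 0"

definition residue_classes :: "'f::{field,metric_space} set set" where
  "residue_classes = (\<lambda>x. {y. fabs (x - y) < 1}) ` {x. fabs x \<le> 1}"

definition nonarch_local_field :: "'f::{field,metric_space} itself \<Rightarrow> bool" where
  "nonarch_local_field _ \<longleftrightarrow>
     (\<forall>x y::'f. dist x y = fabs (x - y)) \<and>
     (\<forall>x y::'f. fabs (x * y) = fabs x * fabs y) \<and>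
     (\<forall>x y::'f. fabs (x + y) \<le> max (fabs x) (fabs y)) \<and>
     complete (UNIV :: 'f set) \<and>
     finite (residue_classes :: 'f set set) \<and>
     (\<exists>u::'f. fabs u = 1 / real (card (residue_classes :: 'f set set)) \<and>
        (\<forall>x::'f. x \<noteq> 0 \<longrightarrow> (\<exists>k::int. fabs x = fabs u powi k)))"

section \<open>Connected reductive groups over a field\<close>

text \<open>An affine algebraic group over \<open>'f\<close> is given by its points over the algebraic closure, as a
  Zariski closed subgroup of \<open>GL\<^sub>n\<close> defined over \<open>'f\<close> (reductive groups are smooth).
  As the algebraic closure is infinite, polynomials in the matrix entries may be identified with
  polynomial functions.\<close>

definition mult_group :: "'k::field monoid" where
  "mult_group = \<lparr>carrier = UNIV - {0}, mult = (*), one = 1\<rparr>"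

definition GL :: "('k::field^'n^'n::finite) monoid" where
  "GL = \<lparr>carrier = {A. det A \<noteq> 0}, mult = (**), one = mat 1\<rparr>"

inductive_set poly_funs :: "'k::field set \<Rightarrow> ('k^'n^'n::finite \<Rightarrow> 'k) set" for C where
  const: "c \<in> C \<Longrightarrow> (\<lambda>A. c) \<in> poly_funs C"
| entry: "(\<lambda>A. A $ i $ j) \<in> poly_funs C"
| add: "f \<in> poly_funs C \<Longrightarrow> g \<in> poly_funs C \<Longrightarrow> (\<lambda>A. f A + g A) \<in> poly_funs C"
| mult: "f \<in> poly_funs C \<Longrightarrow> g \<in> poly_funs C \<Longrightarrow> (\<lambda>A. f A * g A) \<in> poly_funs C"

definition zariski_closed :: "('k::field^'n^'n::finite) set \<Rightarrow> bool" where
  "zariski_closed V \<longleftrightarrow>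
     (\<exists>S\<subseteq>poly_funs UNIV. V = {A. det A \<noteq> 0 \<and> (\<forall>f\<in>S. f A = 0)})"

definition zariski_connected :: "('k::field^'n^'n::finite) set \<Rightarrow> bool" where
  "zariski_connected V \<longleftrightarrow>
     \<not> (\<exists>V1 V2. zariski_closed V1 \<and> zariski_closed V2 \<and> V \<subseteq> V1 \<union> V2 \<and>
          V \<inter> V1 \<inter> V2 = {} \<and> V \<inter> V1 \<noteq> {} \<and> V \<inter> V2 \<noteq> {})"

text \<open>The ideal of \<open>V\<close> is spanned over the algebraic closure by its elements with coefficients
  in \<open>'f\<close>; over imperfect fields this is stronger than being cut out by equations over \<open>'f\<close>.\<close>

definition defined_over_base :: "('f::field alg_closure^'n^'n::finite) set \<Rightarrow> bool" where
  "defined_over_base V \<longleftrightarrow>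
     (\<forall>f\<in>poly_funs UNIV. (\<forall>A\<in>V. f A = 0) \<longrightarrow>
        (\<exists>(m::nat) c g. (\<forall>i<m. g i \<in> poly_funs (range to_ac) \<and> (\<forall>A\<in>V. g i A = 0)) \<and>
            f = (\<lambda>A. \<Sum>i<m. c i * g i A)))"

text \<open>The power of a matrix is written as an iterate because \<open>^\<close> on the vector type is componentwise.\<close>

definition unipotent_matrix :: "'k::field^'n^'n::finite \<Rightarrow> bool" where
  "unipotent_matrix A \<longleftrightarrow> (\<exists>k. (((**) (A - mat 1)) ^^ k) (mat 1) = 0)"

definition connected_reductive_group :: "('f::field alg_closure^'n^'n::finite) set \<Rightarrow> bool" where
  "connected_reductive_group GG \<longleftrightarrow>
     subgroup GG GL \<and> zariski_closed GG \<and> defined_over_base GG \<and> zariski_connected GG \<and>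
     (\<forall>U. U \<lhd> GL\<lparr>carrier := GG\<rparr> \<and> zariski_closed U \<and> zariski_connected U \<and>
          (\<forall>u\<in>U. unipotent_matrix u) \<longrightarrow> U = {mat 1})"

definition rational_points :: "('f::field alg_closure^'n^'n::finite) set \<Rightarrow> ('f^'n^'n) monoid" where
  "rational_points GG = GL\<lparr>carrier := {A. map_matrix to_ac A \<in> GG}\<rparr>"

definition center_points :: "('f::field alg_closure^'n^'n::finite) set \<Rightarrow> ('f^'n^'n) set" where
  "center_points GG = {A \<in> carrier (rational_points GG).
     \<forall>B\<in>GG. map_matrix to_ac A ** B = B ** map_matrix to_ac A}"

definition rational_characters ::
    "('f::field alg_closure^'n^'n::finite) set \<Rightarrow> ('f alg_closure^'n^'n \<Rightarrow> 'f alg_closure) set" where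
  "rational_characters GG = {\<omega> \<in> hom (GL\<lparr>carrier := GG\<rparr>) mult_group.
     \<exists>p\<in>poly_funs (range to_ac). \<exists>m::nat. \<forall>A\<in>GG. \<omega> A = p A / det A ^ m}"

definition unramified_characters ::
    "('f::{field,metric_space} alg_closure^'n^'n::finite) set \<Rightarrow> ('f^'n^'n \<Rightarrow> complex) set" where
  "unramified_characters GG =
     {\<lambda>A. complex_of_real (fabs (of_ac (\<omega> (map_matrix to_ac A)))) powr s | \<omega> s.
        \<omega> \<in> rational_characters GG}"

text \<open>The group \<open>\<^sup>0G\<close>.\<close>

definition zero_group :: "('f::{field,metric_space} alg_closure^'n^'n::finite) set \<Rightarrow> ('f^'n^'n) set" where
  "zero_group GG = {A \<in> carrier (rational_points GG). \<forall>\<psi>\<in>unramified_characters GG. \<psi> A = 1}"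

section \<open>Smooth representations\<close>

text \<open>Throughout, \<open>G\<close> is a group whose elements form a subspace of a topological space, and
  \<open>H\<close>, \<open>J\<close> are subgroups of \<open>G\<close>.  A representation of \<open>H\<close> consists of the scalar
  multiplication \<open>s\<close> of a complex vector space and the action \<open>\<sigma>\<close>; the values of \<open>\<sigma>\<close>
  outside \<open>H\<close> are irrelevant.\<close>

definition smooth_rep ::
    "('g::topological_space, 'm) monoid_scheme \<Rightarrow> 'g set \<Rightarrow>
     (complex \<Rightarrow> 'v::ab_group_add \<Rightarrow> 'v) \<Rightarrow> ('g \<Rightarrow> 'v \<Rightarrow> 'v) \<Rightarrow> bool" where
  "smooth_rep G H s \<sigma> \<longleftrightarrow>
     vector_space s \<and>
     (\<forall>x\<in>H. Vector_Spaces.linear s s (\<sigma> x)) \<and>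
     \<sigma> \<one>\<^bsub>G\<^esub> = id \<and>
     (\<forall>x\<in>H. \<forall>y\<in>H. \<sigma> (x \<otimes>\<^bsub>G\<^esub> y) = \<sigma> x \<circ> \<sigma> y) \<and>
     (\<forall>v. openin (top_of_set H) {x \<in> H. \<sigma> x v = v})"

definition irreducible_rep ::
    "('g::topological_space, 'm) monoid_scheme \<Rightarrow> 'g set \<Rightarrow>
     (complex \<Rightarrow> 'v::ab_group_add \<Rightarrow> 'v) \<Rightarrow> ('g \<Rightarrow> 'v \<Rightarrow> 'v) \<Rightarrow> bool" where
  "irreducible_rep G H s \<sigma> \<longleftrightarrow>
     smooth_rep G H s \<sigma> \<and> (\<exists>v::'v. v \<noteq> 0) \<and>
     (\<forall>W. module.subspace s W \<and> (\<forall>x\<in>H. \<forall>w\<in>W. \<sigma> x w \<in> W) \<longrightarrow> W = {0} \<or> W = UNIV)"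

definition rep_homs ::
    "'g set \<Rightarrow> (complex \<Rightarrow> 'v::ab_group_add \<Rightarrow> 'v) \<Rightarrow> ('g \<Rightarrow> 'v \<Rightarrow> 'v) \<Rightarrow>
     (complex \<Rightarrow> 'w::ab_group_add \<Rightarrow> 'w) \<Rightarrow> ('g \<Rightarrow> 'w \<Rightarrow> 'w) \<Rightarrow> ('v \<Rightarrow> 'w) set" where
  "rep_homs H s \<sigma> t \<tau> =
     {\<phi>. Vector_Spaces.linear s t \<phi> \<and> (\<forall>x\<in>H. \<forall>v. \<phi> (\<sigma> x v) = \<tau> x (\<phi> v))}"

definition conj_set :: "('g, 'm) monoid_scheme \<Rightarrow> 'g set \<Rightarrow> 'g \<Rightarrow> 'g set" where
  "conj_set G H g = (\<lambda>x. g \<otimes>\<^bsub>G\<^esub> x \<otimes>\<^bsub>G\<^esub> inv\<^bsub>G\<^esub> g) ` H"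

definition conj_rep :: "('g, 'm) monoid_scheme \<Rightarrow> ('g \<Rightarrow> 'v \<Rightarrow> 'v) \<Rightarrow> 'g \<Rightarrow> 'g \<Rightarrow> 'v \<Rightarrow> 'v" where
  "conj_rep G \<sigma> g x = \<sigma> (inv\<^bsub>G\<^esub> g \<otimes>\<^bsub>G\<^esub> x \<otimes>\<^bsub>G\<^esub> g)"

definition intertwining ::
    "('g, 'm) monoid_scheme \<Rightarrow> 'g set \<Rightarrow>
     (complex \<Rightarrow> 'v::ab_group_add \<Rightarrow> 'v) \<Rightarrow> ('g \<Rightarrow> 'v \<Rightarrow> 'v) \<Rightarrow> 'g set" where
  "intertwining G H s \<sigma> =
     {g \<in> carrier G. \<exists>\<phi>\<in>rep_homs (H \<inter> conj_set G H g) s \<sigma> s (conj_rep G \<sigma> g). \<phi> \<noteq> (\<lambda>v. 0)}"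

section \<open>Compactness modulo a subgroup\<close>

text \<open>The space of cosets \<open>Jx\<close> in \<open>H\<close>, with the quotient topology.\<close>

definition coset_space ::
    "('g::topological_space, 'm) monoid_scheme \<Rightarrow> 'g set \<Rightarrow> 'g set \<Rightarrow> 'g set topology" where
  "coset_space G H J = topology (\<lambda>U. U \<subseteq> rcosets\<^bsub>G\<lparr>carrier := H\<rparr>\<^esub> J \<and>
     openin (top_of_set H) (\<Union>U))"

lemma openin_coset_space:
  assumes "group (G\<lparr>carrier := H\<rparr>)" "subgroup J (G\<lparr>carrier := H\<rparr>)"
  shows "openin (coset_space G H J) U \<longleftrightarrow>
    U \<subseteq> rcosets\<^bsub>G\<lparr>carrier := H\<rparr>\<^esub> J \<and> openin (top_of_set H) (\<Union>U)"
proof -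
  let ?R = "rcosets\<^bsub>G\<lparr>carrier := H\<rparr>\<^esub> J"
  have disj: "A = B" if "A \<in> ?R" "B \<in> ?R" "x \<in> A" "x \<in> B" for A B x
    using group.rcos_disjoint[OF assms] that unfolding pairwise_def disjnt_def by blast
  have inter: "\<Union>(S \<inter> T) = \<Union>S \<inter> \<Union>T" if "S \<subseteq> ?R" "T \<subseteq> ?R" for S T
    using that disj by blast
  have union: "openin (top_of_set H) (\<Union>(\<Union>\<K>))"
    if "\<forall>K\<in>\<K>. K \<subseteq> ?R \<and> openin (top_of_set H) (\<Union>K)" for \<K>
  proof -
    have "openin (top_of_set H) (\<Union>(Union ` \<K>))"
      using that by (intro openin_Union) blast
    moreover have "\<Union>(Union ` \<K>) = \<Union>(\<Union>\<K>)"
      by blast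
    ultimately show ?thesis
      by simp
  qed
  have "istopology (\<lambda>U. U \<subseteq> ?R \<and> openin (top_of_set H) (\<Union>U))"
    unfolding istopology_def
  proof (intro conjI allI impI)
    fix S T
    assume "S \<subseteq> ?R \<and> openin (top_of_set H) (\<Union>S)" "T \<subseteq> ?R \<and> openin (top_of_set H) (\<Union>T)"
    then show "S \<inter> T \<subseteq> ?R" "openin (top_of_set H) (\<Union>(S \<inter> T))"
      by (auto simp only: inter intro: openin_Int)
  next
    fix \<K>
    assume "\<forall>K\<in>\<K>. K \<subseteq> ?R \<and> openin (top_of_set H) (\<Union>K)"
    then show "\<Union>\<K> \<subseteq> ?R" "openin (top_of_set H) (\<Union>(\<Union>\<K>))"
      using union by blast+
  qed
  then show ?thesis
    unfolding coset_space_def by (simp add: topology_inverse')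
qed

definition compact_mod ::
    "('g::topological_space, 'm) monoid_scheme \<Rightarrow> 'g set \<Rightarrow> 'g set \<Rightarrow> 'g set \<Rightarrow> bool" where
  "compact_mod G H J S \<longleftrightarrow> compactin (coset_space G H J) ((\<lambda>x. J #>\<^bsub>G\<^esub> x) ` S)"

definition open_compact_subgroup ::
    "('g::topological_space, 'm) monoid_scheme \<Rightarrow> 'g set \<Rightarrow> bool" where
  "open_compact_subgroup G H \<longleftrightarrow>
     subgroup H G \<and> openin (top_of_set (carrier G)) H \<and> compact H"

definition open_compact_mod_subgroup ::
    "('g::topological_space, 'm) monoid_scheme \<Rightarrow> 'g set \<Rightarrow> 'g set \<Rightarrow> bool" where
  "open_compact_mod_subgroup G Z H \<longleftrightarrow>
     subgroup H G \<and> openin (top_of_set (carrier G)) H \<and> Z \<subseteq> H \<and> compact_mod G (carrier G) Z H"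

section \<open>Compact induction and Hecke algebras\<close>

text \<open>Functions on \<open>H\<close> are extended by zero to the whole type.\<close>

definition compact_ind ::
    "('g::topological_space, 'm) monoid_scheme \<Rightarrow> 'g set \<Rightarrow> 'g set \<Rightarrow>
     ('g \<Rightarrow> 'v::ab_group_add \<Rightarrow> 'v) \<Rightarrow> ('g \<Rightarrow> 'v) set" where
  "compact_ind G H J \<rho> =
     {f. (\<forall>x. x \<notin> H \<longrightarrow> f x = 0) \<and>
         (\<forall>j\<in>J. \<forall>x\<in>H. f (j \<otimes>\<^bsub>G\<^esub> x) = \<rho> j (f x)) \<and>
         (\<exists>K. subgroup K (G\<lparr>carrier := H\<rparr>) \<and> openin (top_of_set H) K \<and>
            (\<forall>x\<in>H. \<forall>k\<in>K. f (x \<otimes>\<^bsub>G\<^esub> k) = f x)) \<and>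
         compact_mod G H J {x \<in> H. f x \<noteq> 0}}"

definition right_translate ::
    "('g, 'm) monoid_scheme \<Rightarrow> 'g set \<Rightarrow> 'g \<Rightarrow> ('g \<Rightarrow> 'v::zero) \<Rightarrow> 'g \<Rightarrow> 'v" where
  "right_translate G H y f = (\<lambda>x. if x \<in> H then f (x \<otimes>\<^bsub>G\<^esub> y) else 0)"

definition hecke_algebra ::
    "('g::topological_space, 'm) monoid_scheme \<Rightarrow> 'g set \<Rightarrow> 'g set \<Rightarrow>
     (complex \<Rightarrow> 'v::ab_group_add \<Rightarrow> 'v) \<Rightarrow> ('g \<Rightarrow> 'v \<Rightarrow> 'v) \<Rightarrow>
     (complex, ('g \<Rightarrow> 'v) \<Rightarrow> 'g \<Rightarrow> 'v) module" where
  "hecke_algebra G H J s \<rho> = (let V = compact_ind G H J \<rho> in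
     \<lparr>carrier = {T \<in> V \<rightarrow>\<^sub>E V.
          (\<forall>f\<in>V. \<forall>g\<in>V. T (\<lambda>x. f x + g x) = (\<lambda>x. T f x + T g x)) \<and>
          (\<forall>c. \<forall>f\<in>V. T (\<lambda>x. s c (f x)) = (\<lambda>x. s c (T f x))) \<and>
          (\<forall>y\<in>H. \<forall>f\<in>V. T (right_translate G H y f) = right_translate G H y (T f))},
      mult = (\<lambda>S T. compose V S T),
      one = (\<lambda>f\<in>V. f),
      ring.zero = (\<lambda>f\<in>V. (\<lambda>x. 0)),
      ring.add = (\<lambda>S T. \<lambda>f\<in>V. (\<lambda>x. S f x + T f x)),
      smult = (\<lambda>c T. \<lambda>f\<in>V. (\<lambda>x. s c (T f x)))\<rparr>)"

text \<open>The map from \<open>End\<^sub>H(ind\<^sub>J\<^sup>H \<rho>)\<close> to \<open>End\<^sub>H\<^sub>'(ind\<^sub>J\<^sup>H\<^sup>' \<rho>)\<close> given by the functor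
  \<open>ind\<^sub>H\<^sup>H\<^sup>'\<close>.  An element \<open>f\<close> of \<open>ind\<^sub>J\<^sup>H\<^sup>' \<rho>\<close> corresponds to the function
  \<open>x \<mapsto> (h \<mapsto> f (hx))\<close> in \<open>ind\<^sub>H\<^sup>H\<^sup>'(ind\<^sub>J\<^sup>H \<rho>)\<close>, to which \<open>T\<close> is applied
  pointwise; evaluation at \<open>h = 1\<close> is the inverse of this correspondence.\<close>

definition hecke_map ::
    "('g::topological_space, 'm) monoid_scheme \<Rightarrow> 'g set \<Rightarrow> 'g set \<Rightarrow> 'g set \<Rightarrow>
     ('g \<Rightarrow> 'v::ab_group_add \<Rightarrow> 'v) \<Rightarrow>
     (('g \<Rightarrow> 'v) \<Rightarrow> 'g \<Rightarrow> 'v) \<Rightarrow> ('g \<Rightarrow> 'v) \<Rightarrow> 'g \<Rightarrow> 'v" where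
  "hecke_map G H H' J \<rho> T =
     (\<lambda>f\<in>compact_ind G H' J \<rho>.
        \<lambda>x. if x \<in> H' then T (\<lambda>h. if h \<in> H then f (h \<otimes>\<^bsub>G\<^esub> x) else 0) \<one>\<^bsub>G\<^esub> else 0)"

text \<open>Algebras over the complex numbers, not necessarily commutative, are represented by the
  record \<open>module\<close>.\<close>

definition alg_center :: "('c, 'a, 'm) module_scheme \<Rightarrow> ('c, 'a, 'm) module_scheme" where
  "alg_center A = A\<lparr>carrier := {z \<in> carrier A. \<forall>x\<in>carrier A. z \<otimes>\<^bsub>A\<^esub> x = x \<otimes>\<^bsub>A\<^esub> z}\<rparr>"

definition alg_iso :: "('c, 'a, 'm) module_scheme \<Rightarrow> ('c, 'b, 'l) module_scheme \<Rightarrow> ('a \<Rightarrow> 'b) set" where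
  "alg_iso A B =
     {h \<in> ring_iso A B. \<forall>c. \<forall>x\<in>carrier A. h (c \<odot>\<^bsub>A\<^esub> x) = c \<odot>\<^bsub>B\<^esub> h x}"

definition group_algebra :: "('q, 'm) monoid_scheme \<Rightarrow> (complex, 'q \<Rightarrow> complex) module" where
  "group_algebra Q =
     \<lparr>carrier = {a. finite {x. a x \<noteq> 0} \<and> {x. a x \<noteq> 0} \<subseteq> carrier Q},
      mult = (\<lambda>a b x. \<Sum>(y, z) | a y \<noteq> 0 \<and> b z \<noteq> 0 \<and> y \<otimes>\<^bsub>Q\<^esub> z = x. a y * b z),
      one = (\<lambda>x. if x = \<one>\<^bsub>Q\<^esub> then 1 else 0),
      ring.zero = (\<lambda>x. 0),
      ring.add = (\<lambda>a b x. a x + b x),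
      smult = (\<lambda>c a x. c * a x)\<rparr>"

section \<open>The pairs \<open>(J, \<rho>)\<close>\<close>

text \<open>\<open>(J, \<rho>) \<in> \<J>\<^sub>G\<close>, with \<open>(Jt, \<rho>t)\<close> as the fixed choice of \<open>(J\<^sup>~, \<rho>\<^sup>~)\<close>;
  \<open>Gb\<close> is \<open>\<^sup>\<flat>G\<close>.\<close>

definition JG_pair ::
    "('g::topological_space, 'm) monoid_scheme \<Rightarrow> 'g set \<Rightarrow> 'g set \<Rightarrow>
     'g set \<Rightarrow> (complex \<Rightarrow> 'v::ab_group_add \<Rightarrow> 'v) \<Rightarrow> ('g \<Rightarrow> 'v \<Rightarrow> 'v) \<Rightarrow>
     'g set \<Rightarrow> (complex \<Rightarrow> 'w::ab_group_add \<Rightarrow> 'w) \<Rightarrow> ('g \<Rightarrow> 'w \<Rightarrow> 'w) \<Rightarrow> bool" where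
  "JG_pair G Z Gb J s \<rho> Jt st \<rho>t \<longleftrightarrow>
     open_compact_subgroup G J \<and> irreducible_rep G J s \<rho> \<and>
     open_compact_mod_subgroup G Z Jt \<and> J = Jt \<inter> Gb \<and>
     irreducible_rep G Jt st \<rho>t \<and>
     (\<exists>\<phi>\<in>rep_homs J s \<rho> st \<rho>t. inj \<phi>) \<and>
     intertwining G Jt st \<rho>t = Jt"

definition JG_pair_wc ::
    "('g::topological_space, 'm) monoid_scheme \<Rightarrow> 'g set \<Rightarrow> 'g set \<Rightarrow>
     'g set \<Rightarrow> (complex \<Rightarrow> 'v::ab_group_add \<Rightarrow> 'v) \<Rightarrow> ('g \<Rightarrow> 'v \<Rightarrow> 'v) \<Rightarrow>
     'g set \<Rightarrow> (complex \<Rightarrow> 'w::ab_group_add \<Rightarrow> 'w) \<Rightarrow> ('g \<Rightarrow> 'w \<Rightarrow> 'w) \<Rightarrow> bool" where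
  "JG_pair_wc G Z Gb J s \<rho> Jt st \<rho>t \<longleftrightarrow>
     JG_pair G Z Gb J s \<rho> Jt st \<rho>t \<and> intertwining G J s \<rho> \<subseteq> Jt"

definition quotient_characters ::
    "('g, 'm) monoid_scheme \<Rightarrow> 'g set \<Rightarrow> 'g set \<Rightarrow> ('g \<Rightarrow> complex) set" where
  "quotient_characters G H J =
     {\<omega> \<in> hom (G\<lparr>carrier := H\<rparr>) mult_group. \<forall>x\<in>J. \<omega> x = 1}"

definition dagger_group ::
    "('g, 'm) monoid_scheme \<Rightarrow> 'g set \<Rightarrow> 'g set \<Rightarrow>
     (complex \<Rightarrow> 'w::ab_group_add \<Rightarrow> 'w) \<Rightarrow> ('g \<Rightarrow> 'w \<Rightarrow> 'w) \<Rightarrow> 'g set" where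
  "dagger_group G J Jt st \<rho>t =
     {x \<in> Jt. \<forall>\<omega>\<in>quotient_characters G Jt J.
        (\<exists>\<phi>\<in>rep_homs Jt st (\<lambda>y w. st (\<omega> y) (\<rho>t y w)) st \<rho>t. bij \<phi>) \<longrightarrow> \<omega> x = 1}"

end

theory Submission
  imports Defs
begin

text \<open>
  Write \<open>V\<close> for the space of \<open>\<rho>\<close> and \<open>I\<close> for its intertwining group.  By Frobenius reciprocity an
  operator \<open>T\<close> in a Hecke algebra is the same as the family of maps \<open>kern T x\<close> from \<open>V\<close> to \<open>V\<close>
  that sends \<open>v\<close> to \<open>T (delta \<one> v) x\<close>.  Each of them intertwines \<open>\<rho>\<close> with a conjugate of \<open>\<rho>\<close>, so it
  vanishes for \<open>x\<close> outside \<open>I\<close> (\<open>kern_support\<close>).  Extension by zero from \<open>I\<close> to \<open>G\<close> is therefore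
  an isomorphism of the full Hecke algebras (\<open>ext_alg_iso\<close>), and a fortiori of their centers.

  Commutators of \<open>G\<close> lie in the flat subgroup, so \<open>Jt/J\<close> is abelian.  For \<open>g\<close> in \<open>I\<close> there is an
  invertible \<open>U\<^sub>g\<close> that carries \<open>\<rho>\<close> to its conjugate, unique up to a scalar by Schur's lemma.  The
  operators \<open>U\<^sub>g U\<^sub>h\<close> and \<open>\<rho> (g h g\<^sup>-\<^sup>1 h\<^sup>-\<^sup>1) U\<^sub>h U\<^sub>g\<close> intertwine along the same element and thus
  differ by a scalar \<open>\<beta> g h\<close>; this is a bicharacter of \<open>I\<close>, trivial on \<open>J\<close>.  The Hecke algebra of
  \<open>I\<close> is spanned by operators supported on single cosets, and these commute up to \<open>\<beta>\<close>.  Its center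
  consists of the operators supported on the radical of \<open>\<beta>\<close> (\<open>center_iff\<close>), that is, it is the
  Hecke algebra of the radical.

  The main point is that the radical is the dagger group (\<open>dagger_eq_rad\<close>).  Let \<open>h\<close> be in \<open>I\<close> and
  let \<open>\<omega>\<close> be a character of \<open>Jt\<close> that restricts to \<open>\<beta> (-) h\<close> on \<open>I\<close>.  On a copy \<open>f\<close> of \<open>\<rho>\<close> in
  \<open>\<rho>t\<close>, the rule that takes \<open>f v\<close> to \<open>\<rho>t (h\<^sup>-\<^sup>1) (f (U\<^sub>h v))\<close> is compatible with the action of \<open>I\<close>
  twisted by \<open>\<omega>\<close>, and it extends to an isomorphism from the twist of \<open>\<rho>t\<close> by \<open>\<omega>\<close> to \<open>\<rho>t\<close>
  (\<open>twist_iso\<close>).  The difficulty is that the extension is well defined; all linear relations between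
  translates of copies of \<open>\<rho>\<close> come from homomorphisms between conjugates of \<open>\<rho>\<close>
  (\<open>relation_transfer\<close>), and for these \<open>\<omega>\<close> and \<open>\<beta>\<close> cancel.  As the group of nonzero complex numbers is
  divisible, \<open>\<beta> (-) h\<close> does extend from \<open>I\<close> to \<open>Jt\<close>, and the characters that are trivial on \<open>I\<close>,
  where \<open>h = \<one>\<close>, separate \<open>I\<close> from the other elements of \<open>Jt\<close>.  Hence the dagger group lies in the
  radical.  Conversely, for \<open>h\<close> in the radical the choice \<open>\<omega> = 1\<close> gives an endomorphism of \<open>\<rho>t\<close>,
  which is a scalar.  So \<open>h\<close> acts on all copies of \<open>\<rho>\<close> in \<open>\<rho>t\<close> through one and the same operator
  (\<open>rad_acts\<close>), and no character \<open>\<omega>\<close> with \<open>\<omega> h \<noteq> 1\<close> can preserve \<open>\<rho>t\<close>.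

  The same fact extends \<open>\<rho>\<close> to a representation of the radical on \<open>V\<close>.  Dividing each \<open>kern T x\<close> by
  the value of this extension at \<open>x\<close> turns operators into functions on the quotient by \<open>J\<close> and
  composition into convolution (\<open>symbol_alg_iso\<close>).

  Schur's lemma is needed for \<open>\<rho>t\<close>, which is not known beforehand to be finite-dimensional.  The
  group \<open>G\<close> is second countable because the local field is separable, so an irreducible smooth
  representation of a subgroup has countable dimension, and this is enough over the uncountable
  field of complex numbers (\<open>schur\<close>).
\<close>

section \<open>Irreducible actions of countable dimension\<close>

text \<open>The vector \<open>p(A) w\<close>.\<close>

definition poly_op :: "(complex \<Rightarrow> 'v::ab_group_add \<Rightarrow> 'v) \<Rightarrow> ('v \<Rightarrow> 'v) \<Rightarrow> complex poly \<Rightarrow> 'v \<Rightarrow> 'v" where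
  "poly_op s A p w = (\<Sum>i\<le>Polynomial.degree p. s (Polynomial.coeff p i) ((A ^^ i) w))"

context
  fixes s :: "complex \<Rightarrow> 'v::ab_group_add \<Rightarrow> 'v" and A :: "'v \<Rightarrow> 'v"
  assumes vs: "vector_space s" and A: "Vector_Spaces.linear s s A"
begin

interpretation vector_space s by (rule vs)
interpretation A: Vector_Spaces.linear s s A by (rule A)

lemma poly_op_upto:
  assumes "Polynomial.degree p \<le> n" shows "poly_op s A p w = (\<Sum>i\<le>n. s (Polynomial.coeff p i) ((A ^^ i) w))"
  unfolding poly_op_def using assms
  by (intro sum.mono_neutral_left) (auto simp: Polynomial.coeff_eq_0)

lemma poly_op_0: "poly_op s A 0 w = 0"
  by (simp add: poly_op_def)

lemma poly_op_add: "poly_op s A (p + q) w = poly_op s A p w + poly_op s A q w"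
proof -
  let ?n = "max (Polynomial.degree p) (Polynomial.degree q)"
  have "Polynomial.degree (p + q) \<le> ?n" by (rule degree_add_le_max)
  then show ?thesis
    by (simp add: poly_op_upto[of _ ?n] scale_left_distrib sum.distrib)
qed

lemma poly_op_smult: "poly_op s A (Polynomial.smult c p) w = s c (poly_op s A p w)"
  by (simp add: poly_op_upto[of "Polynomial.smult c p" "Polynomial.degree p"] poly_op_def scale_sum_right degree_smult_le)

lemma poly_op_sum: "poly_op s A (\<Sum>x\<in>F. f x) w = (\<Sum>x\<in>F. poly_op s A (f x) w)"
  by (induction F rule: infinite_finite_induct) (auto simp: poly_op_0 poly_op_add)

lemma poly_op_pCons: "poly_op s A (pCons a p) w = s a w + poly_op s A p (A w)"
proof -
  have "poly_op s A (pCons a p) w = (\<Sum>i\<le>Suc (Polynomial.degree p). s (Polynomial.coeff (pCons a p) i) ((A ^^ i) w))"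
    by (rule poly_op_upto) (rule degree_pCons_le)
  also have "\<dots> = s a w + (\<Sum>i\<le>Polynomial.degree p. s (Polynomial.coeff p i) ((A ^^ Suc i) w))"
    by (subst sum.atMost_Suc_shift) simp
  finally show ?thesis
    by (simp add: poly_op_def funpow_swap1)
qed

lemma linear_funpow: "Vector_Spaces.linear s s (A ^^ i)"
proof (induction i)
  case 0
  then show ?case using linear_id by (simp add: id_def)
next
  case (Suc i)
  then show ?case using Vector_Spaces.linear_compose[of s s "A ^^ i" s A] A
    by (simp add: comp_def)
qed

lemma poly_op_linear: "Vector_Spaces.linear s s (poly_op s A p)"
proof -
  interpret p: Vector_Spaces.linear s s "A ^^ i" for i by (rule linear_funpow)
  show ?thesis
    by unfold_locales
      (simp_all add: poly_op_def p.add p.scale scale_right_distrib sum.distrib scale_sum_right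
        mult.commute)
qed

lemma poly_op_root: "poly_op s A ([:-c, 1:] * q) w = poly_op s A q (A w - s c w)"
proof -
  interpret q: Vector_Spaces.linear s s "poly_op s A q" by (rule poly_op_linear)
  show ?thesis
    using poly_op_add[of "pCons 0 q" "Polynomial.smult (-c) q" w]
    by (simp add: poly_op_smult poly_op_pCons q.diff q.scale del: Polynomial.smult_minus_left)
      (simp add: smult_minus_left)
qed

text \<open>Over the complex numbers a polynomial in \<open>A\<close> is a product of operators \<open>A - c\<close>.\<close>

lemma poly_op_nonzero:
  assumes "\<And>c w. A w = s c w \<Longrightarrow> w = 0" "p \<noteq> 0" "w \<noteq> 0"
  shows "poly_op s A p w \<noteq> 0"
  using assms(2,3)
proof (induction "Polynomial.degree p" arbitrary: p w)
  case 0
  then obtain a where "p = [:a:]" "a \<noteq> 0"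
    by (metis degree_eq_zeroE pCons_0_0)
  then show ?case
    using 0 by (simp add: poly_op_def)
next
  case (Suc n)
  then have "\<not> constant (poly p)"
    by (simp add: constant_degree)
  then obtain c where "poly p c = 0"
    using fundamental_theorem_of_algebra by blast
  then obtain q where q: "p = [:-c, 1:] * q"
    by (metis poly_eq_0_iff_dvd dvdE)
  then have "q \<noteq> 0" "Polynomial.degree q = n"
    using Suc degree_mult_eq[of "[:-c, 1:]" q] by (auto simp del: mult_pCons_left)
  moreover have "A w - s c w \<noteq> 0"
    using assms(1) Suc.prems(2) by auto
  ultimately show ?case
    using Suc.hyps(1)[of q "A w - s c w"] by (simp only: q poly_op_root) simp
qed

text \<open>If every \<open>A - c\<close> is bijective, the vectors \<open>r c = (A - c)\<^sup>-\<^sup>1 v\<close> are linearly independent: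
  applying the product of the \<open>A - c\<close> to a relation between them gives \<open>p(A) v = 0\<close> for a
  polynomial \<open>p\<close>, hence \<open>p = 0\<close>, and evaluating \<open>p\<close> at one of the \<open>c\<close> isolates one
  coefficient.  There are uncountably many \<open>c\<close>.\<close>

lemma uncountable_dimension:
  assumes inj: "\<And>c w. A w = s c w \<Longrightarrow> w = 0" and surj: "\<And>c. surj (\<lambda>w. A w - s c w)"
    and v: "(v::'v) \<noteq> 0" and B: "countable B" "span B = UNIV"
  shows False
proof -
  have "\<exists>r. A r - s c r = v" for c
    using surjD[OF surj[of c], of v] by (auto simp: eq_commute)
  then obtain r where r: "A (r c) - s c (r c) = v" for c
    using choice[of "\<lambda>c r. A r - s c r = v"] by auto
  have coeffs_0: "a m = 0"
    if "finite F" "(\<Sum>c\<in>F. s (a c) (r c)) = 0" "m \<in> F" for F a m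
  proof -
    let ?Q = "\<lambda>F. \<Prod>c\<in>F. [:-c, 1:]"
    interpret Q: Vector_Spaces.linear s s "poly_op s A (?Q F)" by (rule poly_op_linear)
    have Qr: "poly_op s A (?Q F) (r c) = poly_op s A (?Q (F - {c})) v" if "c \<in> F" for c
      using poly_op_root[of c "?Q (F - {c})" "r c"] prod.remove[OF \<open>finite F\<close> that, of "\<lambda>c. [:-c, 1:]"]
      by (simp add: r)
    have "0 = poly_op s A (?Q F) (\<Sum>c\<in>F. s (a c) (r c))"
      using that by simp
    also have "\<dots> = poly_op s A (\<Sum>c\<in>F. Polynomial.smult (a c) (?Q (F - {c}))) v"
      by (simp add: Q.sum Q.scale Qr poly_op_sum poly_op_smult cong: sum.cong)
    finally have P_v: "poly_op s A (\<Sum>c\<in>F. Polynomial.smult (a c) (?Q (F - {c}))) v = 0"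
      by (rule sym)
    have "(\<Sum>c\<in>F. Polynomial.smult (a c) (?Q (F - {c}))) = 0"
    proof (rule ccontr)
      assume "(\<Sum>c\<in>F. Polynomial.smult (a c) (?Q (F - {c}))) \<noteq> 0"
      moreover have "\<And>c w. A w = s c w \<Longrightarrow> w = 0" by (rule inj)
      ultimately show False using poly_op_nonzero[OF _ _ v] P_v by blast
    qed
    then have "0 = poly (\<Sum>c\<in>F. Polynomial.smult (a c) (?Q (F - {c}))) m"
      by simp
    also have "\<dots> = (\<Sum>c\<in>F. a c * (\<Prod>c\<in>F - {c}. m - c))"
      by (simp add: poly_sum poly_prod)
    also have "\<dots> = (\<Sum>c\<in>{m}. a c * (\<Prod>c\<in>F - {c}. m - c))"
      using that by (intro sum.mono_neutral_right) auto
    finally show ?thesis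
      using that by simp
  qed
  have "inj r"
  proof (rule injI, rule ccontr)
    fix c d assume "r c = r d" "c \<noteq> d"
    then show False
      using coeffs_0[of "{c, d}" "\<lambda>x. if x = c then 1 else -1" c] by simp
  qed
  have "independent (range r)"
  proof
    assume "dependent (range r)"
    then obtain S u w where S: "finite S" "S \<subseteq> range r" "(\<Sum>v\<in>S. s (u v) v) = 0" "w \<in> S" "u w \<noteq> 0"
      unfolding dependent_explicit by auto
    have bij: "inj_on r (r -` S)" "r ` (r -` S) = S"
      using S(2) \<open>inj r\<close> by (auto intro: inj_on_subset)
    have "finite (r -` S)"
      using S(1) \<open>inj r\<close> by (simp add: finite_vimageI)
    moreover have "(\<Sum>c\<in>r -` S. s (u (r c)) (r c)) = 0"
      using S(3) sum.reindex[OF bij(1), of "\<lambda>v. s (u v) v"] bij(2) by simp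
    moreover obtain m where "w = r m"
      using S by auto
    ultimately show False
      using coeffs_0[of "r -` S" "\<lambda>c. u (r c)" m] S by simp
  qed
  then obtain C where C: "range r \<subseteq> C" "independent C" "UNIV \<subseteq> span C"
    using maximal_independent_subset_extend[of "range r" UNIV] by auto
  obtain B' where B': "B' \<subseteq> B" "independent B'" "B \<subseteq> span B'"
    using maximal_independent_subset[of B] by auto
  have "span B' = UNIV"
    using B B' span_mono[of B "span B'"] by (auto simp: span_span)
  then obtain f where "bij_betw f B' C"
    using bij_if_span_eq_span_bases[of B' C] B' C by auto
  moreover have "countable B'"
    using B B' countable_subset by blast
  ultimately have "countable C"
    using countable_image[of B' f] by (simp add: bij_betw_def)
  then have "countable (range r)"
    using C countable_subset by blast
  then show False
    using \<open>inj r\<close> uncountable_UNIV_complex countable_image_inj_eq by blast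
qed

end

text \<open>Irreducibility without the topology, in a form that applies at once to the conjugates of a
  representation and to its twists by characters.\<close>

definition simple_action :: "'g set \<Rightarrow> (complex \<Rightarrow> 'v::ab_group_add \<Rightarrow> 'v) \<Rightarrow> ('g \<Rightarrow> 'v \<Rightarrow> 'v) \<Rightarrow> bool" where
  "simple_action H s \<sigma> \<longleftrightarrow>
     (\<forall>W. module.subspace s W \<and> (\<forall>x\<in>H. \<forall>w\<in>W. \<sigma> x w \<in> W) \<longrightarrow> W = {0} \<or> W = UNIV)"

lemma simple_actionD:
  assumes "simple_action H s \<sigma>" "module.subspace s W" "\<And>x w. x \<in> H \<Longrightarrow> w \<in> W \<Longrightarrow> \<sigma> x w \<in> W"
  shows "W = {0} \<or> W = UNIV"
  using assms unfolding simple_action_def by blast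

lemma simple_hom_inj:
  assumes simple: "simple_action H s \<sigma>" and \<phi>: "\<phi> \<in> rep_homs H s \<sigma> t \<tau>" and v: "\<phi> v \<noteq> 0"
    and zero: "\<And>x. x \<in> H \<Longrightarrow> \<tau> x 0 = 0"
  shows "inj \<phi>"
proof -
  interpret \<phi>: Vector_Spaces.linear s t \<phi> using \<phi> by (simp add: rep_homs_def)
  have "{w. \<phi> w = 0} = {0} \<or> {w. \<phi> w = 0} = UNIV"
  proof (rule simple_actionD[OF simple])
    show "\<phi>.vs1.subspace {w. \<phi> w = 0}" by (rule \<phi>.subspace_kernel)
    fix x w assume "x \<in> H" "w \<in> {w. \<phi> w = 0}"
    then show "\<sigma> x w \<in> {w. \<phi> w = 0}" using \<phi> zero by (simp add: rep_homs_def)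
  qed
  then have "{w. \<phi> w = 0} = {0}" using v by auto
  then show ?thesis by (subst \<phi>.inj_iff_eq_0) auto
qed

lemma simple_hom_surj:
  assumes simple: "simple_action H t \<tau>" and \<phi>: "\<phi> \<in> rep_homs H s \<sigma> t \<tau>" and v: "\<phi> v \<noteq> 0"
  shows "surj \<phi>"
proof -
  interpret \<phi>: Vector_Spaces.linear s t \<phi> using \<phi> by (simp add: rep_homs_def)
  have "range \<phi> = {0} \<or> range \<phi> = UNIV"
  proof (rule simple_actionD[OF simple])
    show "\<phi>.vs2.subspace (range \<phi>)" by (rule \<phi>.subspace_image) simp
    fix x w assume x: "x \<in> H" and "w \<in> range \<phi>"
    then obtain u where "w = \<phi> u" by auto
    then have "\<tau> x w = \<phi> (\<sigma> x u)" using \<phi> x by (simp add: rep_homs_def)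
    then show "\<tau> x w \<in> range \<phi>" by simp
  qed
  then show ?thesis using v by auto
qed

section \<open>Schur's lemma for second countable groups\<close>

locale second_countable_group = group G for G :: "('g::topological_space, 'm) monoid_scheme" (structure) +
  assumes continuous_left: "a \<in> carrier G \<Longrightarrow> continuous_on (carrier G) (\<lambda>x. a \<otimes> x)"
    and continuous_right: "a \<in> carrier G \<Longrightarrow> continuous_on (carrier G) (\<lambda>x. x \<otimes> a)"
    and second_countable_carrier: "second_countable (top_of_set (carrier G))"
begin

lemma openin_left:
  assumes "subgroup H G" "openin (top_of_set H) K" "a \<in> H"
  shows "openin (top_of_set H) {x \<in> H. a \<otimes> x \<in> K}"
proof -
  have "H \<subseteq> carrier G" by (rule subgroup.subset[OF assms(1)])
  then have "continuous_on H (\<lambda>x. a \<otimes> x)"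
    using continuous_left[of a] assms(3) by (auto intro: continuous_on_subset)
  then have "openin (top_of_set H) (H \<inter> (\<lambda>x. a \<otimes> x) -` K)"
    by (rule continuous_openin_preimage[OF _ _ assms(2)])
      (use assms(1,3) in \<open>auto intro: subgroup.m_closed\<close>)
  then show ?thesis by (simp add: vimage_def Collect_conj_eq)
qed

lemma openin_right:
  assumes "subgroup H G" "openin (top_of_set H) K" "a \<in> H"
  shows "openin (top_of_set H) {x \<in> H. x \<otimes> a \<in> K}"
proof -
  have "H \<subseteq> carrier G" by (rule subgroup.subset[OF assms(1)])
  then have "continuous_on H (\<lambda>x. x \<otimes> a)"
    using continuous_right[of a] assms(3) by (auto intro: continuous_on_subset)
  then have "openin (top_of_set H) (H \<inter> (\<lambda>x. x \<otimes> a) -` K)"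
    by (rule continuous_openin_preimage[OF _ _ assms(2)])
      (use assms(1,3) in \<open>auto intro: subgroup.m_closed\<close>)
  then show ?thesis by (simp add: vimage_def Collect_conj_eq)
qed

text \<open>Stabilisers are open, so each point of the orbit is named by a basic open set on which
  \<open>x \<mapsto> \<sigma> x v\<close> is constant.\<close>

lemma countable_orbit:
  assumes H: "subgroup H G" and \<sigma>: "smooth_rep G H s \<sigma>"
  shows "countable ((\<lambda>x. \<sigma> x v) ` H)"
proof -
  have HG: "H \<subseteq> carrier G" by (rule subgroup.subset[OF H])
  have "second_countable (subtopology (top_of_set (carrier G)) H)"
    by (rule second_countable_subtopology) (rule second_countable_carrier)
  then have "second_countable (top_of_set H)"
    by (simp add: subtopology_subtopology inf.absorb2[OF HG])
  then obtain \<B> where \<B>: "countable \<B>"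
    and base: "\<And>U x. openin (top_of_set H) U \<Longrightarrow> x \<in> U \<Longrightarrow> \<exists>V\<in>\<B>. x \<in> V \<and> V \<subseteq> U"
    unfolding second_countable_def by auto
  have "(\<lambda>x. \<sigma> x v) ` H \<subseteq> (\<lambda>V. \<sigma> (SOME x. x \<in> V) v) ` \<B>"
  proof clarify
    fix a assume a: "a \<in> H"
    let ?S = "{x \<in> H. \<sigma> x v = v}"
    let ?U = "{x \<in> H. inv a \<otimes> x \<in> ?S}"
    have "openin (top_of_set H) ?S"
      using \<sigma> unfolding smooth_rep_def by (elim conjE allE)
    then have "openin (top_of_set H) ?U"
      by (rule openin_left[OF H]) (use H a in \<open>rule subgroup.m_inv_closed\<close>)
    moreover have "a \<in> ?U"
      using a HG \<sigma> subgroup.one_closed[OF H] by (auto simp: smooth_rep_def)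
    ultimately obtain V where V: "V \<in> \<B>" "a \<in> V" "V \<subseteq> ?U"
      using base[of ?U a] by auto
    define x where "x = (SOME x. x \<in> V)"
    have "x \<in> V" unfolding x_def using V(2) by (rule someI)
    then have x: "x \<in> H" "\<sigma> (inv a \<otimes> x) v = v" "inv a \<otimes> x \<in> H" using V(3) by auto
    have "\<sigma> (a \<otimes> (inv a \<otimes> x)) = \<sigma> a \<circ> \<sigma> (inv a \<otimes> x)"
      using \<sigma> a x(3) by (simp add: smooth_rep_def)
    moreover have "a \<otimes> (inv a \<otimes> x) = x"
      using a x(1) HG by (simp add: subset_iff flip: m_assoc)
    ultimately have "\<sigma> x v = \<sigma> a v" using x by simp
    then show "\<sigma> a v \<in> (\<lambda>V. \<sigma> (SOME x. x \<in> V) v) ` \<B>"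
      using imageI[OF V(1), of "\<lambda>V. \<sigma> (SOME x. x \<in> V) v"] unfolding x_def by simp
  qed
  then show ?thesis
    by (rule countable_subset) (rule countable_image[OF \<B>])
qed

text \<open>Schur's lemma in the form of Dixmier.  The orbit of one vector spans the space, so the dimension
  is countable.  If \<open>A\<close> were not a scalar, every \<open>A - c\<close> would be a nonzero endomorphism,
  hence bijective, against the preceding count of dimensions.\<close>

lemma schur:
  fixes s :: "complex \<Rightarrow> 'v::ab_group_add \<Rightarrow> 'v"
  assumes H: "subgroup H G" and \<sigma>: "irreducible_rep G H s \<sigma>" and A: "A \<in> rep_homs H s \<sigma> s \<sigma>"
  shows "\<exists>c. \<forall>w. A w = s c w"
proof (rule ccontr)
  assume no_scalar: "\<nexists>c. \<forall>w. A w = s c w"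
  have smooth: "smooth_rep G H s \<sigma>" and "\<exists>v::'v. v \<noteq> 0" and simple: "simple_action H s \<sigma>"
    using \<sigma> unfolding irreducible_rep_def simple_action_def by blast+
  then obtain v :: 'v where v: "v \<noteq> 0" by blast
  have lin: "Vector_Spaces.linear s s (\<sigma> x)" if "x \<in> H" for x
    using smooth that by (simp add: smooth_rep_def)
  interpret A: Vector_Spaces.linear s s A using A by (simp add: rep_homs_def)
  have shift: "(\<lambda>w. A w - s c w) \<in> rep_homs H s \<sigma> s \<sigma>" for c
  proof -
    have "Vector_Spaces.linear s s (\<lambda>w. A w - s c w)"
      by unfold_locales (simp_all add: A.add A.scale A.vs1.scale_right_distrib A.vs1.scale_right_diff_distrib
         mult.commute)
    moreover have "\<sigma> x (A w - s c w) = \<sigma> x (A w) - s c (\<sigma> x w)" if "x \<in> H" for x w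
      using lin[OF that] by (simp add: linear_diff linear_scale Vector_Spaces.linear.axioms
          module_hom.diff module_hom.scale linear_iff_module_hom)
    ultimately show ?thesis using A by (simp add: rep_homs_def)
  qed
  have zero: "\<sigma> x 0 = 0" if "x \<in> H" for x
    using lin[OF that] by (simp add: module_hom.zero linear_iff_module_hom)
  have nz: "\<exists>w. A w - s c w \<noteq> 0" for c
    using no_scalar by auto
  have inj: "inj (\<lambda>w. A w - s c w)" for c
    using nz[of c] simple_hom_inj[OF simple shift[of c]] zero by blast
  have surj: "surj (\<lambda>w. A w - s c w)" for c
    using nz[of c] simple_hom_surj[OF simple shift[of c]] by blast
  let ?B = "(\<lambda>x. \<sigma> x v) ` H"
  have "A.vs1.span ?B = {0} \<or> A.vs1.span ?B = UNIV"
  proof (rule simple_actionD[OF simple])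
    show "A.vs1.subspace (A.vs1.span ?B)" by simp
    fix x w assume x: "x \<in> H" and w: "w \<in> A.vs1.span ?B"
    interpret x: Vector_Spaces.linear s s "\<sigma> x" by (rule lin[OF x])
    have "\<sigma> x ` ?B \<subseteq> ?B"
    proof clarify
      fix y assume y: "y \<in> H"
      have "\<sigma> x (\<sigma> y v) = \<sigma> (x \<otimes> y) v"
        using smooth x y by (simp add: smooth_rep_def)
      then show "\<sigma> x (\<sigma> y v) \<in> ?B"
        using subgroup.m_closed[OF H x y] by auto
    qed
    then have "\<sigma> x ` A.vs1.span ?B \<subseteq> A.vs1.span ?B"
      by (simp add: A.vs1.span_mono flip: x.span_image)
    then show "\<sigma> x w \<in> A.vs1.span ?B" using w by blast
  qed
  moreover have "v \<in> A.vs1.span ?B"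
  proof -
    have "v = \<sigma> \<one> v" using smooth by (simp add: smooth_rep_def)
    then show ?thesis using subgroup.one_closed[OF H] by (metis A.vs1.span_base image_eqI)
  qed
  ultimately have "A.vs1.span ?B = UNIV" using v by auto
  moreover have inj0: "A w = s c w \<Longrightarrow> w = 0" for c w
    using injD[OF inj[of c], of w 0] by simp
  ultimately show False
    by (intro uncountable_dimension[OF A.vs1.vector_space_axioms A.linear_axioms inj0 surj v
          countable_orbit[OF H smooth]])
qed

end

section \<open>Extension of characters\<close>

lemma complex_root_neq_1:
  assumes "c \<noteq> 0" "n \<ge> 2"
  shows "\<exists>z::complex. z ^ n = c \<and> z \<noteq> 1"
proof -
  have n: "n > 0" using assms by simp
  have "card {z. z ^ n = c} = n" by (rule card_nth_roots[OF assms(1) n])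
  then have "\<not> {z. z ^ n = c} \<subseteq> {1}"
    using assms(2) card_mono[of "{1::complex}" "{z. z ^ n = c}"] by auto
  then show ?thesis by auto
qed

text \<open>A character of a subgroup is encoded by its graph, so that inclusion is the order to which Zorn's
  lemma applies.  The graph contains every commutator of \<open>G\<close> with the value \<open>1\<close>; the domain is
  then normal and the character is invariant under conjugation, which replaces the passage to an
  abelian quotient of \<open>G\<close>.\<close>

definition char_relation :: "('a, 'm) monoid_scheme \<Rightarrow> ('a \<times> complex) set \<Rightarrow> bool" where
  "char_relation G R \<longleftrightarrow> R \<subseteq> carrier G \<times> - {0} \<and>
     (\<forall>a c b d. (a, c) \<in> R \<longrightarrow> (b, d) \<in> R \<longrightarrow> (a \<otimes>\<^bsub>G\<^esub> b, c * d) \<in> R) \<and>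
     (\<forall>a c. (a, c) \<in> R \<longrightarrow> (inv\<^bsub>G\<^esub> a, inverse c) \<in> R) \<and>
     (\<forall>c. (\<one>\<^bsub>G\<^esub>, c) \<in> R \<longrightarrow> c = 1) \<and>
     (\<forall>x\<in>carrier G. \<forall>y\<in>carrier G. (x \<otimes>\<^bsub>G\<^esub> y \<otimes>\<^bsub>G\<^esub> inv\<^bsub>G\<^esub> x \<otimes>\<^bsub>G\<^esub> inv\<^bsub>G\<^esub> y, 1) \<in> R)"

context group
begin

lemma inv_cancel_left [simp]:
  assumes "x \<in> carrier G" "y \<in> carrier G"
  shows "x \<otimes> (inv x \<otimes> y) = y" "inv x \<otimes> (x \<otimes> y) = y"
  using assms by (simp_all flip: m_assoc)

lemma char_relation_unique:
  assumes R: "char_relation G R" and "(a, c) \<in> R" "(a, d) \<in> R"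
  shows "c = d"
proof -
  have a: "a \<in> carrier G" and "d \<noteq> 0" using assms by (auto simp: char_relation_def)
  have "(inv a, inverse d) \<in> R" using assms by (auto simp: char_relation_def)
  then have "(a \<otimes> inv a, c * inverse d) \<in> R" using assms unfolding char_relation_def by blast
  then have "c * inverse d = 1" using a R by (simp add: char_relation_def)
  then show ?thesis using \<open>d \<noteq> 0\<close> by (simp add: field_simps)
qed

lemma char_relation_conj:
  assumes R: "char_relation G R" and "(a, c) \<in> R" "x \<in> carrier G"
  shows "(x \<otimes> a \<otimes> inv x, c) \<in> R"
proof -
  have a: "a \<in> carrier G" using assms by (auto simp: char_relation_def)
  have "(x \<otimes> a \<otimes> inv x \<otimes> inv a, 1) \<in> R" using assms a by (auto simp: char_relation_def)
  then have "(x \<otimes> a \<otimes> inv x \<otimes> inv a \<otimes> a, 1 * c) \<in> R" using assms unfolding char_relation_def by blast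
  then show ?thesis using a assms(3) by (simp add: m_assoc)
qed

lemma char_relation_pow:
  assumes R: "char_relation G R" and "(a, c) \<in> R"
  shows "(a [^] (k::int), c powi k) \<in> R"
proof -
  have a: "a \<in> carrier G" using assms by (auto simp: char_relation_def)
  have "(a \<otimes> inv a, c * inverse c) \<in> R"
    using assms unfolding char_relation_def by blast
  then have one: "(\<one>, 1) \<in> R" using assms a by (auto simp: char_relation_def)
  have nat: "(a [^] n, c ^ n) \<in> R" for n :: nat
  proof (induction n)
    case (Suc n)
    then have "(a [^] n \<otimes> a, c ^ n * c) \<in> R" using assms unfolding char_relation_def by blast
    then show ?case by (simp add: mult.commute)
  qed (simp add: one)
  show ?thesis
  proof (cases k rule: int_cases2)
    case (nonneg n)
    then show ?thesis using nat[of n] by (simp add: int_pow_int)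
  next
    case (nonpos n)
    then have "(inv (a [^] n), inverse (c ^ n)) \<in> R"
      using nat[of n] R unfolding char_relation_def by blast
    then show ?thesis using nonpos a by (simp add: int_pow_neg int_pow_int power_int_minus)
  qed
qed

text \<open>The nonzero complex numbers form a divisible group.  If \<open>n\<close> is the least positive exponent with
  \<open>x [^] n\<close> in the domain, the value at \<open>x\<close> has to be an \<open>n\<close>-th root of the value at
  \<open>x [^] n\<close>; as \<open>n \<ge> 2\<close>, there is a root other than \<open>1\<close>.  If there is no such \<open>n\<close>, every
  nonzero value is possible.\<close>

lemma char_value_exists:
  assumes R: "char_relation G R" and x: "x \<in> carrier G" "x \<notin> fst ` R"
  shows "\<exists>z::complex. z \<noteq> 0 \<and> z \<noteq> 1 \<and> (\<forall>k::int. \<forall>c. (x [^] k, c) \<in> R \<longrightarrow> c = z powi k)"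
proof (cases "\<exists>n::nat. n > 0 \<and> x [^] n \<in> fst ` R")
  case True
  define n where "n = (LEAST n::nat. n > 0 \<and> x [^] n \<in> fst ` R)"
  have n: "n > 0" "x [^] n \<in> fst ` R" and least: "\<And>m. m > 0 \<Longrightarrow> x [^] m \<in> fst ` R \<Longrightarrow> n \<le> m"
    using LeastI_ex[OF True] unfolding n_def by (auto intro: Least_le)
  then obtain c where c: "(x [^] n, c) \<in> R" by auto
  then have c0: "c \<noteq> 0" using R by (auto simp: char_relation_def)
  have "n \<noteq> 1"
  proof
    assume "n = 1"
    then show False using n(2) x by simp
  qed
  then have "n \<ge> 2" using n(1) by linarith
  then obtain z where z: "z ^ n = c" "z \<noteq> 1" using complex_root_neq_1[OF c0] by blast
  have z0: "z \<noteq> 0" using z(1) c0 n(1) by auto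
  have "d = z powi k" if d: "(x [^] k, d) \<in> R" for k :: int and d
  proof -
    have nq: "(x [^] (int n * q), c powi q) \<in> R" for q
      using char_relation_pow[OF R c, of q] x(1) by (simp add: int_pow_pow int_pow_int[symmetric])
    \<comment> \<open>The exponents \<open>k\<close> with \<open>x [^] k\<close> in the domain form a subgroup of the integers, and \<open>n\<close> generates it.\<close>
    have "k mod int n = 0"
    proof (rule ccontr)
      assume "k mod int n \<noteq> 0"
      moreover have kn: "0 \<le> k mod int n" "k mod int n < int n" using n(1) by auto
      ultimately have pos: "nat (k mod int n) > 0" by simp
      have "(x [^] k \<otimes> x [^] (int n * - (k div int n)), d * c powi - (k div int n)) \<in> R"
        using d nq R unfolding char_relation_def by blast
      moreover have "x [^] k \<otimes> x [^] (int n * - (k div int n)) = x [^] (k mod int n)"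
        using x(1) by (simp add: minus_mult_div_eq_mod flip: int_pow_mult)
      moreover have "x [^] (k mod int n) = x [^] nat (k mod int n)"
        using kn by (simp flip: int_pow_int)
      ultimately have "x [^] nat (k mod int n) \<in> fst ` R" by (auto intro: rev_image_eqI)
      then show False using least[OF pos] kn by linarith
    qed
    then have k: "k = int n * (k div int n)" by (metis add.right_neutral mult_div_mod_eq)
    then have "(x [^] k, c powi (k div int n)) \<in> R" using nq[of "k div int n"] by metis
    then have "d = c powi (k div int n)" using char_relation_unique[OF R d] by simp
    also have "\<dots> = z powi (int n * (k div int n))"
      by (simp add: power_int_mult z(1))
    finally show ?thesis using k by simp
  qed
  then show ?thesis using z z0 by blast
next
  case False
  have "c = 2 powi k" if c: "(x [^] k, c) \<in> R" for k :: int and c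
  proof -
    have "k = 0"
    proof (rule ccontr)
      assume "k \<noteq> 0"
      have "(x [^] \<bar>k\<bar>) \<in> fst ` R"
      proof (cases "k \<ge> 0")
        case True
        then show ?thesis using rev_image_eqI[OF c, of "x [^] k" fst] by simp
      next
        case False
        have "(inv (x [^] k), inverse c) \<in> R" using c R unfolding char_relation_def by blast
        then have "inv (x [^] k) \<in> fst ` R" by (rule rev_image_eqI) simp
        moreover have "\<bar>k\<bar> = - k" using False by simp
        ultimately show ?thesis using x(1) by (simp only: int_pow_neg)
      qed
      moreover have "x [^] \<bar>k\<bar> = x [^] nat \<bar>k\<bar>"
        using int_pow_int[of G x "nat \<bar>k\<bar>"] by simp
      moreover have "nat \<bar>k\<bar> > 0" using \<open>k \<noteq> 0\<close> by simp
      ultimately show False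
        using False by metis
    qed
    then have "(\<one>, c) \<in> R" using c by simp
    then show ?thesis using \<open>k = 0\<close> R by (simp add: char_relation_def)
  qed
  then show ?thesis by (intro exI[of _ 2]) auto
qed

lemma char_relation_adjoin:
  assumes R: "char_relation G R" and x: "x \<in> carrier G" "x \<notin> fst ` R"
  shows "\<exists>R' z. char_relation G R' \<and> R \<subseteq> R' \<and> (x, z) \<in> R' \<and> z \<noteq> 1"
proof -
  obtain z where z: "z \<noteq> 0" "z \<noteq> 1" and comp: "\<And>(k::int) c. (x [^] k, c) \<in> R \<Longrightarrow> c = z powi k"
    using char_value_exists[OF assms] by blast
  define R' where "R' = {(a \<otimes> x [^] (k::int), c * z powi k) | a c k. (a, c) \<in> R}"
  have RG: "a \<in> carrier G" "c \<noteq> 0" if "(a, c) \<in> R" for a c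
    using that R by (auto simp: char_relation_def)
  have one: "(\<one>, 1) \<in> R"
    using R bspec[of "carrier G" "\<lambda>x. \<forall>y\<in>carrier G. (x \<otimes> y \<otimes> inv x \<otimes> inv y, 1) \<in> R" \<one>]
    by (force simp: char_relation_def)
  have R'I: "(a \<otimes> x [^] k, c * z powi k) \<in> R'" if "(a, c) \<in> R" for a c and k :: int
    using that by (auto simp: R'_def)
  have sub: "R \<subseteq> R'"
    using R'I[of _ _ 0] RG by auto
  have "char_relation G R'"
    unfolding char_relation_def
  proof (intro conjI allI impI ballI)
    show "R' \<subseteq> carrier G \<times> - {0}" using RG x z by (auto simp: R'_def)
  next
    fix a c b d assume "(a, c) \<in> R'" "(b, d) \<in> R'"
    then obtain a' c' k b' d' l where
      a: "a = a' \<otimes> x [^] (k::int)" "c = c' * z powi k" "(a', c') \<in> R" and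
      b: "b = b' \<otimes> x [^] (l::int)" "d = d' * z powi l" "(b', d') \<in> R"
      unfolding R'_def by blast
    have "(x [^] k \<otimes> b' \<otimes> inv (x [^] k), d') \<in> R"
      using char_relation_conj[OF R b(3)] x by simp
    then have "(a' \<otimes> (x [^] k \<otimes> b' \<otimes> inv (x [^] k)), c' * d') \<in> R"
      using a(3) R unfolding char_relation_def by blast
    from R'I[OF this, of "k + l"] show "(a \<otimes> b, c * d) \<in> R'"
      using RG[OF a(3)] RG[OF b(3)] x(1) z
      by (simp add: a b m_assoc int_pow_mult power_int_add mult_ac)
  next
    fix a c assume "(a, c) \<in> R'"
    then obtain a' c' k where a: "a = a' \<otimes> x [^] (k::int)" "c = c' * z powi k" "(a', c') \<in> R"
      unfolding R'_def by blast
    have "(inv a', inverse c') \<in> R" using a(3) R unfolding char_relation_def by blast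
    then have "(x [^] (-k) \<otimes> inv a' \<otimes> inv (x [^] (-k)), inverse c') \<in> R"
      using char_relation_conj[OF R] x by simp
    from R'I[OF this, of "-k"] show "(inv a, inverse c) \<in> R'"
      using RG[OF a(3)] x(1) by (simp add: a m_assoc inv_mult_group int_pow_neg power_int_minus)
  next
    fix c assume "(\<one>, c) \<in> R'"
    then obtain a' c' k where a: "\<one> = a' \<otimes> x [^] (k::int)" "c = c' * z powi k" "(a', c') \<in> R"
      unfolding R'_def by blast
    then have "inv a' = x [^] k" using RG[OF a(3)] x(1) by (metis inv_equality inv_inv int_pow_closed)
    moreover have "(inv a', inverse c') \<in> R" using a(3) R unfolding char_relation_def by blast
    ultimately have "inverse c' = z powi k" using comp by simp
    then show "c = 1" using a(2) RG[OF a(3)] by (metis right_inverse)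
  next
    fix y w assume "y \<in> carrier G" "w \<in> carrier G"
    then show "(y \<otimes> w \<otimes> inv y \<otimes> inv w, 1) \<in> R'"
      using R sub unfolding char_relation_def by blast
  qed
  moreover have "(x, z) \<in> R'" using R'I[OF one, of 1] x by simp
  ultimately show ?thesis using sub z by blast
qed

lemma char_relation_total:
  assumes R: "char_relation G R"
  shows "\<exists>\<omega>\<in>hom G mult_group. \<forall>a c. (a, c) \<in> R \<longrightarrow> \<omega> a = c"
proof -
  let ?\<A> = "{R'. char_relation G R' \<and> R \<subseteq> R'}"
  have "\<exists>M\<in>?\<A>. \<forall>S\<in>?\<A>. M \<subseteq> S \<longrightarrow> S = M"
  proof (rule subset_Zorn_nonempty)
    show "?\<A> \<noteq> {}" using R by auto
  next
    fix \<C> assume ne: "\<C> \<noteq> {}" and ch: "subset.chain ?\<A> \<C>"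
    have \<C>: "\<And>S. S \<in> \<C> \<Longrightarrow> char_relation G S \<and> R \<subseteq> S"
      and chain: "\<And>S T. S \<in> \<C> \<Longrightarrow> T \<in> \<C> \<Longrightarrow> S \<subseteq> T \<or> T \<subseteq> S"
      using ch by (auto simp: subset_chain_def)
    obtain S0 where S0: "S0 \<in> \<C>" using ne by blast
    have "char_relation G (\<Union>\<C>)"
      unfolding char_relation_def
    proof (intro conjI allI impI ballI)
      show "\<Union>\<C> \<subseteq> carrier G \<times> - {0}"
        using \<C> by (fastforce simp: char_relation_def)
    next
      fix a c b d assume "(a, c) \<in> \<Union>\<C>" "(b, d) \<in> \<Union>\<C>"
      then obtain S T where ST: "S \<in> \<C>" "(a, c) \<in> S" "T \<in> \<C>" "(b, d) \<in> T" by blast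
      then obtain U where "U \<in> \<C>" "(a, c) \<in> U" "(b, d) \<in> U" using chain[of S T] by blast
      then show "(a \<otimes> b, c * d) \<in> \<Union>\<C>" using \<C>[of U] unfolding char_relation_def by blast
    next
      fix a c assume "(a, c) \<in> \<Union>\<C>"
      then obtain S where "S \<in> \<C>" "(a, c) \<in> S" by blast
      then show "(inv a, inverse c) \<in> \<Union>\<C>" using \<C>[of S] unfolding char_relation_def by blast
    next
      fix c assume "(\<one>, c) \<in> \<Union>\<C>"
      then obtain S where "S \<in> \<C>" "(\<one>, c) \<in> S" by blast
      then show "c = 1" using \<C>[of S] unfolding char_relation_def by blast
    next
      fix y w assume "y \<in> carrier G" "w \<in> carrier G"
      then have "(y \<otimes> w \<otimes> inv y \<otimes> inv w, 1) \<in> S0"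
        using \<C>[OF S0] by (simp add: char_relation_def)
      then show "(y \<otimes> w \<otimes> inv y \<otimes> inv w, 1) \<in> \<Union>\<C>"
        using S0 by blast
    qed
    moreover have "R \<subseteq> \<Union>\<C>" using \<C>[OF S0] S0 by blast
    ultimately show "\<Union>\<C> \<in> ?\<A>" by simp
  qed
  then obtain M where M: "char_relation G M" "R \<subseteq> M"
    and max: "\<And>S. char_relation G S \<Longrightarrow> R \<subseteq> S \<Longrightarrow> M \<subseteq> S \<Longrightarrow> S = M" by auto
  have "\<exists>c. (a, c) \<in> M" if a: "a \<in> carrier G" for a
  proof (rule ccontr)
    assume "\<nexists>c. (a, c) \<in> M"
    then have "a \<notin> fst ` M" by auto
    from char_relation_adjoin[OF M(1) a this]
    obtain S z where "char_relation G S" "M \<subseteq> S" "(a, z) \<in> S" by blast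
    then show False using max[of S] M(2) \<open>\<nexists>c. (a, c) \<in> M\<close> by auto
  qed
  then obtain \<omega> where \<omega>: "\<And>a. a \<in> carrier G \<Longrightarrow> (a, \<omega> a) \<in> M" by metis
  have "\<omega> \<in> hom G mult_group"
  proof (rule homI)
    fix a assume "a \<in> carrier G"
    then show "\<omega> a \<in> carrier mult_group" using \<omega> M(1) by (auto simp: char_relation_def mult_group_def)
  next
    fix a b assume ab: "a \<in> carrier G" "b \<in> carrier G"
    then have "(a \<otimes> b, \<omega> a * \<omega> b) \<in> M" using \<omega> M(1) unfolding char_relation_def by blast
    then show "\<omega> (a \<otimes> b) = \<omega> a \<otimes>\<^bsub>mult_group\<^esub> \<omega> b"
      using char_relation_unique[OF M(1) \<omega>[of "a \<otimes> b"]] ab by (simp add: mult_group_def)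
  qed
  moreover have "\<omega> a = c" if "(a, c) \<in> R" for a c
  proof -
    have "a \<in> carrier G" using that R by (auto simp: char_relation_def)
    then show ?thesis using char_relation_unique[OF M(1) \<omega>] that M(2) by blast
  qed
  ultimately show ?thesis by blast
qed

lemma char_relation_graph:
  assumes K: "subgroup K G" and \<omega>: "\<omega> \<in> hom (G\<lparr>carrier := K\<rparr>) mult_group"
    and comm: "\<And>x y. x \<in> carrier G \<Longrightarrow> y \<in> carrier G \<Longrightarrow>
      x \<otimes> y \<otimes> inv x \<otimes> inv y \<in> K \<and> \<omega> (x \<otimes> y \<otimes> inv x \<otimes> inv y) = 1"
  shows "char_relation G {(a, \<omega> a) | a. a \<in> K}"
proof -
  have mult: "\<omega> (a \<otimes> b) = \<omega> a * \<omega> b" and nz: "\<omega> a \<noteq> 0" if "a \<in> K" "b \<in> K" for a b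
    using \<omega> that by (auto simp: hom_def mult_group_def)
  have KG: "K \<subseteq> carrier G" by (rule subgroup.subset[OF K])
  have one: "\<omega> \<one> = 1" using mult[of \<one> \<one>] nz[of \<one> \<one>] subgroup.one_closed[OF K] by simp
  have inv: "\<omega> (inv a) = inverse (\<omega> a)" if a: "a \<in> K" for a
  proof -
    have "\<omega> a * \<omega> (inv a) = 1"
      using mult[OF a subgroup.m_inv_closed[OF K a]] one a KG by auto
    then show ?thesis by (rule inverse_unique[symmetric])
  qed
  show ?thesis
    unfolding char_relation_def
    using KG mult nz one inv comm subgroup.m_closed[OF K] subgroup.m_inv_closed[OF K]
    by auto
qed

lemma extend_character:
  fixes \<omega> :: "'a \<Rightarrow> complex"
  assumes K: "subgroup K G" and \<omega>: "\<omega> \<in> hom (G\<lparr>carrier := K\<rparr>) mult_group"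
    and comm: "\<And>x y. x \<in> carrier G \<Longrightarrow> y \<in> carrier G \<Longrightarrow>
      x \<otimes> y \<otimes> inv x \<otimes> inv y \<in> K \<and> \<omega> (x \<otimes> y \<otimes> inv x \<otimes> inv y) = 1"
  shows "\<exists>\<omega>'\<in>hom G mult_group. \<forall>a\<in>K. \<omega>' a = \<omega> a"
  using char_relation_total[OF char_relation_graph[OF assms]] by auto

text \<open>The trivial character of \<open>K\<close> is extended first to \<open>x\<close>, with a value other than \<open>1\<close>, and then to
  the whole group.\<close>

lemma separating_character:
  assumes K: "subgroup K G"
    and comm: "\<And>x y. x \<in> carrier G \<Longrightarrow> y \<in> carrier G \<Longrightarrow> x \<otimes> y \<otimes> inv x \<otimes> inv y \<in> K"
    and x: "x \<in> carrier G" "x \<notin> K"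
  shows "\<exists>\<omega>\<in>hom G (mult_group :: complex monoid). (\<forall>a\<in>K. \<omega> a = 1) \<and> \<omega> x \<noteq> 1"
proof -
  have "(\<lambda>_. 1) \<in> hom (G\<lparr>carrier := K\<rparr>) mult_group"
    by (simp add: hom_def mult_group_def)
  then have graph: "char_relation G {(a, 1) | a. a \<in> K}"
    using char_relation_graph[OF K, of "\<lambda>_. 1"] comm by simp
  have notin: "x \<notin> fst ` {(a, 1::complex) | a. a \<in> K}" using x(2) by auto
  obtain R z where R: "char_relation G R" "{(a, 1) | a. a \<in> K} \<subseteq> R" "(x, z) \<in> R" "z \<noteq> 1"
    using char_relation_adjoin[OF graph x(1) notin] by (elim exE conjE)
  from char_relation_total[OF R(1)] show ?thesis
  proof (rule bexE)
    fix \<omega> assume \<omega>: "\<omega> \<in> hom G mult_group" "\<forall>a c. (a, c) \<in> R \<longrightarrow> \<omega> a = c"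
    have "\<forall>a\<in>K. \<omega> a = 1"
    proof
      fix a assume "a \<in> K"
      then have "(a, 1) \<in> R" using R(2) by auto
      then show "\<omega> a = 1" using \<omega>(2) by simp
    qed
    moreover have "\<omega> x \<noteq> 1" using \<omega>(2) R(3,4) by simp
    ultimately have "(\<forall>a\<in>K. \<omega> a = 1) \<and> \<omega> x \<noteq> 1" ..
    then show ?thesis using \<omega>(1) by blast
  qed
qed

end

section \<open>Topology of matrices over a local field\<close>

lemma dense_vec:
  assumes "\<exists>D::'a::metric_space set. countable D \<and> (\<forall>x e. 0 < e \<longrightarrow> (\<exists>d\<in>D. dist x d < e))"
  shows "\<exists>D::('a^'n::finite) set. countable D \<and> (\<forall>x e. 0 < e \<longrightarrow> (\<exists>d\<in>D. dist x d < e))"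
proof -
  obtain D :: "'a set" where D: "countable D" and dense: "\<And>x e. 0 < e \<Longrightarrow> \<exists>d\<in>D. dist x d < e"
    using assms by blast
  let ?D = "vec_lambda ` (PiE (UNIV::'n set) (\<lambda>_. D))"
  have "countable ?D"
    using countable_PiE[of "UNIV::'n set" "\<lambda>_. D"] D by (intro countable_image) simp
  moreover have "\<exists>d\<in>?D. dist x d < e" if "0 < e" for x :: "'a^'n" and e
  proof -
    define e' where "e' = e / real CARD('n)"
    have "e' > 0" using that by (simp add: e'_def)
    then have "\<exists>d. \<forall>i. d i \<in> D \<and> dist (x $ i) (d i) < e'"
      using dense by (intro choice) blast
    then obtain d where d: "\<And>i. d i \<in> D" "\<And>i. dist (x $ i) (d i) < e'" by blast
    have "dist x (vec_lambda d) \<le> (\<Sum>i\<in>UNIV. dist (x $ i) (d i))"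
      unfolding dist_vec_def by (rule order_trans[OF L2_set_le_sum]) auto
    also have "\<dots> < (\<Sum>i\<in>(UNIV::'n set). e')"
      using d(2) by (intro sum_strict_mono) auto
    also have "\<dots> = e" by (simp add: e'_def)
    finally have "dist x (vec_lambda d) < e" .
    moreover have "vec_lambda d \<in> ?D" using d(1) by (intro imageI) auto
    ultimately show ?thesis by blast
  qed
  ultimately show ?thesis by blast
qed

lemma second_countable_if_dense:
  fixes D :: "'a::metric_space set"
  assumes D: "countable D" and dense: "\<And>x e. 0 < e \<Longrightarrow> \<exists>d\<in>D. dist x d < e"
  shows "second_countable (euclidean :: 'a topology)"
proof -
  let ?\<B> = "(\<lambda>(d, q). ball d (real_of_rat q)) ` (D \<times> UNIV)"
  have DQ: "countable (D \<times> (UNIV :: rat set))" using D by simp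
  have "countable ?\<B>" by (rule countable_image) (rule DQ)
  moreover have "\<exists>V\<in>?\<B>. x \<in> V \<and> V \<subseteq> U" if U: "open U" "x \<in> U" for U and x :: 'a
  proof -
    obtain e where e: "e > 0" "ball x e \<subseteq> U" using U open_contains_ball by blast
    obtain q where q: "0 < real_of_rat q" "real_of_rat q < e / 2"
      using of_rat_dense[of 0 "e / 2"] e(1) by auto
    obtain d where d: "d \<in> D" "dist x d < real_of_rat q" using dense[OF q(1)] by blast
    have "ball d (real_of_rat q) \<subseteq> ball x e"
    proof
      fix y assume "y \<in> ball d (real_of_rat q)"
      then have "dist d y < real_of_rat q" by (simp only: mem_ball)
      then have "dist x y < e" using dist_triangle[of x y d] d(2) q(2) by linarith
      then show "y \<in> ball x e" by (simp only: mem_ball)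
    qed
    then have "ball d (real_of_rat q) \<subseteq> U" using e(2) by (rule subset_trans)
    moreover have "x \<in> ball d (real_of_rat q)" using d(2) by (simp only: mem_ball dist_commute)
    moreover have "ball d (real_of_rat q) \<in> ?\<B>"
      by (rule image_eqI[of _ _ "(d, q)"]) (simp_all add: d(1))
    ultimately show ?thesis by (intro bexI[of _ "ball d (real_of_rat q)"] conjI)
  qed
  moreover have "\<forall>V\<in>?\<B>. openin euclidean V" by (simp add: split_beta)
  ultimately have "countable ?\<B> \<and> (\<forall>V\<in>?\<B>. openin euclidean V) \<and>
      (\<forall>U x. openin euclidean U \<and> x \<in> U \<longrightarrow> (\<exists>V\<in>?\<B>. x \<in> V \<and> V \<subseteq> U))"
    by (intro conjI allI impI) (simp_all only: open_openin[symmetric])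
  then show ?thesis
    unfolding second_countable_def by (rule exI)
qed

text \<open>Truncated \<open>u\<close>-adic expansions.  With \<open>u\<close> a uniformiser and \<open>R\<close> a finite set of representatives of the
  residue field, they approximate every element of absolute value at most \<open>1\<close>.\<close>

primrec expansions :: "'f::field set \<Rightarrow> 'f \<Rightarrow> nat \<Rightarrow> 'f set" where
  "expansions R u 0 = {0}"
| "expansions R u (Suc n) = (\<lambda>(r, d). r + u * d) ` (R \<times> expansions R u n)"

lemma finite_expansions: "finite R \<Longrightarrow> finite (expansions R u n)"
  by (induction n) auto

context
  assumes local_field: "nonarch_local_field TYPE('f::{field,metric_space})"
begin

lemma dist_fabs: "dist x y = fabs (x - y :: 'f)"
  and fabs_mult: "fabs (x * y :: 'f) = fabs x * fabs y"
  and fabs_add: "fabs (x + y :: 'f) \<le> max (fabs x) (fabs y)"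
  using local_field unfolding nonarch_local_field_def by blast+

lemma fabs_0_iff: "fabs (x::'f) = 0 \<longleftrightarrow> x = 0"
  by (simp add: fabs_def)

lemma fabs_nonneg: "0 \<le> fabs (x::'f)"
  by (simp add: fabs_def)

lemma fabs_1: "fabs (1::'f) = 1"
  using fabs_mult[of 1 1] fabs_0_iff[of 1] by simp

lemma fabs_power: "fabs (x ^ n :: 'f) = fabs x ^ n"
  by (induction n) (simp_all add: fabs_1 fabs_mult)

lemma fabs_minus: "fabs (- x :: 'f) = fabs x"
  using dist_fabs[of 0 x] dist_fabs[of x 0] by (simp add: dist_commute)

lemma continuous_on_field_add:
  fixes f g :: "'a::topological_space \<Rightarrow> 'f"
  assumes "continuous_on S f" "continuous_on S g"
  shows "continuous_on S (\<lambda>x. f x + g x)"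
  unfolding continuous_on_def tendsto_iff
proof (intro ballI allI impI)
  fix x e assume x: "x \<in> S" and e: "(0::real) < e"
  have "eventually (\<lambda>y. dist (f y) (f x) < e) (at x within S)"
    and "eventually (\<lambda>y. dist (g y) (g x) < e) (at x within S)"
    using assms x e unfolding continuous_on_def tendsto_iff by blast+
  then show "eventually (\<lambda>y. dist (f y + g y) (f x + g x) < e) (at x within S)"
  proof eventually_elim
    case (elim y)
    have "f y + g y - (f x + g x) = (f y - f x) + (g y - g x)" by simp
    then have "dist (f y + g y) (f x + g x) \<le> max (dist (f y) (f x)) (dist (g y) (g x))"
      using fabs_add[of "f y - f x" "g y - g x"] by (simp add: dist_fabs algebra_simps)
    then show ?case using elim by linarith
  qed
qed

lemma continuous_on_field_mult_const:
  fixes f :: "'a::topological_space \<Rightarrow> 'f"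
  assumes "continuous_on S f"
  shows "continuous_on S (\<lambda>x. c * f x)"
  unfolding continuous_on_def tendsto_iff
proof (intro ballI allI impI)
  fix x e assume x: "x \<in> S" and e: "(0::real) < e"
  have pos: "fabs c + 1 > 0" using fabs_nonneg[of c] by simp
  then have "eventually (\<lambda>y. dist (f y) (f x) < e / (fabs c + 1)) (at x within S)"
    using assms x e unfolding continuous_on_def tendsto_iff by (meson divide_pos_pos)
  then show "eventually (\<lambda>y. dist (c * f y) (c * f x) < e) (at x within S)"
  proof eventually_elim
    case (elim y)
    have "dist (c * f y) (c * f x) = fabs c * dist (f y) (f x)"
      by (simp add: dist_fabs flip: right_diff_distrib fabs_mult)
    also have "\<dots> \<le> (fabs c + 1) * dist (f y) (f x)" by (intro mult_right_mono) auto
    also have "\<dots> < e" using elim pos by (simp add: field_simps)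
    finally show ?case .
  qed
qed

lemma continuous_on_field_sum:
  fixes f :: "'i \<Rightarrow> 'a::topological_space \<Rightarrow> 'f"
  assumes "\<And>i. i \<in> I \<Longrightarrow> continuous_on S (f i)"
  shows "continuous_on S (\<lambda>x. \<Sum>i\<in>I. f i x)"
  using assms by (induction I rule: infinite_finite_induct) (auto intro: continuous_on_field_add)

lemma continuous_on_entry:
  "continuous_on S (\<lambda>x::'f^'n::finite^'m::finite. x $ i $ j)"
  by (intro continuous_intros)

lemma continuous_on_matrix_mult_left:
  "continuous_on S (\<lambda>x::'f^'n::finite^'n. a ** x)"
  unfolding matrix_matrix_mult_def
  by (intro continuous_on_vec_lambda continuous_on_field_sum continuous_on_field_mult_const
      continuous_on_entry)

lemma continuous_on_matrix_mult_right:
  "continuous_on S (\<lambda>x::'f^'n::finite^'n. x ** a)"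
proof -
  have "continuous_on S (\<lambda>x::'f^'n^'n. \<chi> i j. \<Sum>k\<in>UNIV. a $ k $ j * x $ i $ k)"
    by (intro continuous_on_vec_lambda continuous_on_field_sum continuous_on_field_mult_const
        continuous_on_entry)
  then show ?thesis unfolding matrix_matrix_mult_def by (simp add: mult.commute)
qed

text \<open>The classes of \<open>0\<close> and \<open>1\<close> differ, so the residue field has at least two elements and the given
  generator \<open>\<bar>u\<bar>\<close> of the value group is less than \<open>1\<close>.  A power of \<open>\<bar>u\<bar>\<close> below \<open>1\<close> has a
  positive exponent.\<close>

lemma uniformiser:
  obtains u :: 'f where "u \<noteq> 0" "fabs u < 1" "\<And>x::'f. fabs x < 1 \<Longrightarrow> fabs x \<le> fabs u"
proof -
  let ?C = "residue_classes :: 'f set set"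
  have fin: "finite ?C" and "\<exists>u::'f. fabs u = 1 / real (card ?C) \<and>
        (\<forall>x::'f. x \<noteq> 0 \<longrightarrow> (\<exists>k::int. fabs x = fabs u powi k))"
    using local_field unfolding nonarch_local_field_def by blast+
  then obtain u :: 'f where u: "fabs u = 1 / real (card ?C)"
    and val: "\<And>x::'f. x \<noteq> 0 \<Longrightarrow> \<exists>k::int. fabs x = fabs u powi k" by blast
  let ?c = "\<lambda>x::'f. {y. fabs (x - y) < 1}"
  have "?c 0 \<noteq> ?c 1"
  proof
    assume eq: "?c 0 = ?c 1"
    have "1 \<in> ?c 1" using fabs_0_iff[of 0] by simp
    then have "1 \<in> ?c 0" using eq by simp
    then show False by (simp add: fabs_minus fabs_1)
  qed
  moreover have "?c 0 \<in> ?C" "?c 1 \<in> ?C"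
    unfolding residue_classes_def using fabs_1 fabs_0_iff[of 0]
    by (auto simp del: diff_0 intro!: imageI)
  ultimately have "card ?C \<ge> 2"
    using card_mono[OF fin, of "{?c 0, ?c 1}"] by auto
  then have u01: "0 < fabs u" "fabs u < 1" using u by auto
  have "fabs x \<le> fabs u" if x: "fabs x < 1" for x :: 'f
  proof (cases "x = 0")
    case True
    then show ?thesis using u01 fabs_0_iff[of 0] by simp
  next
    case False
    then obtain k where k: "fabs x = fabs u powi k" using val by blast
    have "k > 0"
    proof (rule ccontr)
      assume "\<not> k > 0"
      then have "k = - int (nat (- k))" by simp
      then have "fabs x = inverse (fabs u ^ nat (- k))"
        using k by (metis power_int_minus power_int_of_nat)
      moreover have "fabs u ^ nat (- k) \<le> 1" "fabs u ^ nat (- k) > 0"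
        using u01 by (auto intro: power_le_one)
      ultimately show False using x by (simp add: one_le_inverse leD)
    qed
    then obtain m where "k = int (Suc m)" using gr0_implies_Suc[of "nat k"] by (metis int_nat_eq less_imp_le zero_less_nat_eq)
    then have "fabs x = fabs u * fabs u ^ m" using k by (simp only: power_int_of_nat power_Suc)
    also have "\<dots> \<le> fabs u" using u01 by (simp add: mult_left_le power_le_one)
    finally show ?thesis .
  qed
  then show ?thesis using that[of u] u01 fabs_0_iff[of u] by auto
qed

text \<open>Elements of absolute value at most \<open>1\<close> are approximated digit by digit; a power of the
  uniformiser moves any element into this range.\<close>

lemma dense_local_field:
  "\<exists>D::'f set. countable D \<and> (\<forall>x e. 0 < e \<longrightarrow> (\<exists>d\<in>D. dist x d < e))"
proof -
  obtain u :: 'f where u: "u \<noteq> 0" "fabs u < 1" "\<And>x::'f. fabs x < 1 \<Longrightarrow> fabs x \<le> fabs u"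
    using uniformiser by blast
  have u0: "fabs u > 0" using u(1) fabs_0_iff[of u] fabs_nonneg[of u] by simp
  let ?c = "\<lambda>x::'f. {y. fabs (x - y) < 1}"
  let ?R = "(\<lambda>C. SOME r. fabs r \<le> 1 \<and> ?c r = C) ` (residue_classes :: 'f set set)"
  have R: "\<exists>r\<in>?R. fabs (x - r) \<le> fabs u" if x: "fabs x \<le> 1" for x
  proof -
    define r where "r = (SOME r. fabs r \<le> 1 \<and> ?c r = ?c x)"
    have "fabs r \<le> 1 \<and> ?c r = ?c x"
      unfolding r_def by (rule someI[of _ x]) (simp add: x)
    moreover have "r \<in> ?c r" using fabs_0_iff[of 0] by simp
    ultimately have "r \<in> ?c x" by simp
    moreover have "?c x \<in> residue_classes" using x by (auto simp: residue_classes_def)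
    then have "r \<in> ?R" unfolding r_def by (rule imageI)
    ultimately show ?thesis using u(3)[of "x - r"] by blast
  qed
  have "finite (residue_classes :: 'f set set)"
    using local_field unfolding nonarch_local_field_def by blast
  then have fin: "finite ?R" by (rule finite_imageI)
  have approx: "\<exists>d\<in>expansions ?R u n. fabs (x - d) \<le> fabs u ^ n" if "fabs x \<le> 1" for n x
    using that
  proof (induction n arbitrary: x)
    case (Suc n)
    obtain r where r: "r \<in> ?R" "fabs (x - r) \<le> fabs u" using R[OF Suc.prems] by blast
    have "fabs u * fabs ((x - r) / u) = fabs (x - r)"
      using u(1) by (simp flip: fabs_mult)
    then have "fabs u * fabs ((x - r) / u) \<le> fabs u * 1" using r(2) by simp
    then have "fabs ((x - r) / u) \<le> 1" using u0 by (simp only: mult_le_cancel_left_pos)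
    then obtain d where d: "d \<in> expansions ?R u n" "fabs ((x - r) / u - d) \<le> fabs u ^ n"
      using Suc.IH by blast
    have "x - (r + u * d) = u * ((x - r) / u - d)" using u(1) by (simp add: field_simps)
    then have "fabs (x - (r + u * d)) = fabs u * fabs ((x - r) / u - d)" by (simp only: fabs_mult)
    also have "\<dots> \<le> fabs u ^ Suc n" using d(2) u0 by simp
    finally have "fabs (x - (r + u * d)) \<le> fabs u ^ Suc n" .
    moreover have "r + u * d \<in> expansions ?R u (Suc n)"
      unfolding expansions.simps by (rule image_eqI[of _ _ "(r, d)"]) (use r(1) d(1) in auto)
    ultimately show ?case by blast
  qed simp
  let ?D = "(\<lambda>(n, m, d). d / u ^ m) ` (SIGMA n:UNIV. UNIV \<times> expansions ?R u n)"
  have "countable ?D"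
    using finite_expansions[OF fin] by (intro countable_image countable_SIGMA) (auto intro: countable_finite)
  moreover have "\<exists>d\<in>?D. dist x d < e" if e: "0 < e" for x e
  proof -
    have "\<exists>m. fabs (u ^ m * x) \<le> 1"
    proof (cases "fabs x = 0")
      case True
      then show ?thesis by (simp add: fabs_mult)
    next
      case False
      then have x0: "fabs x > 0" using fabs_nonneg[of x] by simp
      then obtain m where "fabs u ^ m < 1 / fabs x"
        using real_arch_pow_inv[of "1 / fabs x" "fabs u"] u(2) by auto
      then show ?thesis
        using x0 by (intro exI[of _ m]) (simp add: fabs_mult fabs_power field_simps)
    qed
    then obtain m where m: "fabs (u ^ m * x) \<le> 1" by blast
    obtain n where n: "fabs u ^ n < e * fabs u ^ m"
      using real_arch_pow_inv[of "e * fabs u ^ m" "fabs u"] u(2) u0 e by auto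
    obtain d where d: "d \<in> expansions ?R u n" "fabs (u ^ m * x - d) \<le> fabs u ^ n"
      using approx[OF m] by blast
    have "u ^ m * x - d = u ^ m * (x - d / u ^ m)" using u(1) by (simp add: field_simps)
    then have "fabs u ^ m * dist x (d / u ^ m) = fabs (u ^ m * x - d)"
      by (simp add: dist_fabs fabs_mult fabs_power)
    also have "\<dots> < fabs u ^ m * e" using d(2) n by (simp add: mult.commute)
    finally have "dist x (d / u ^ m) < e" using u0 by simp
    moreover have "d / u ^ m \<in> ?D"
      by (rule image_eqI[of _ _ "(n, m, d)"]) (use d(1) in auto)
    ultimately show ?thesis by blast
  qed
  ultimately have "countable ?D \<and> (\<forall>x e. 0 < e \<longrightarrow> (\<exists>d\<in>?D. dist x d < e))" by simp
  then show ?thesis by (rule exI)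
qed

lemma second_countable_matrices: "second_countable (euclidean :: ('f^'n::finite^'m::finite) topology)"
proof -
  obtain D :: "('f^'n^'m) set"
    where D: "countable D \<and> (\<forall>x e. 0 < e \<longrightarrow> (\<exists>d\<in>D. dist x d < e))"
    using dense_vec[OF dense_vec[OF dense_local_field]] by (rule exE)
  show ?thesis
    by (rule second_countable_if_dense[of D]) (use D in simp_all)
qed

lemma second_countable_group_rational_points:
  fixes GG :: "('f alg_closure^'n^'n::finite) set"
  assumes "group (rational_points GG)"
  shows "second_countable_group (rational_points GG)"
proof -
  interpret group "rational_points GG" by (rule assms)
  have mult: "x \<otimes>\<^bsub>rational_points GG\<^esub> y = x ** y" for x y :: "'f^'n^'n"
    by (simp add: rational_points_def GL_def)
  show ?thesis
  proof
    show "continuous_on (carrier (rational_points GG)) (\<lambda>x. a \<otimes>\<^bsub>rational_points GG\<^esub> x)" for a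
      unfolding mult by (rule continuous_on_matrix_mult_left)
    show "continuous_on (carrier (rational_points GG)) (\<lambda>x. x \<otimes>\<^bsub>rational_points GG\<^esub> a)" for a
      unfolding mult by (rule continuous_on_matrix_mult_right)
    show "second_countable (top_of_set (carrier (rational_points GG)))"
      by (rule second_countable_subtopology) (rule second_countable_matrices)
  qed
qed

end

section \<open>Compact induction from an open subgroup\<close>

locale hecke_pair = second_countable_group G
  for G :: "('g::topological_space, 'm) monoid_scheme" (structure) +
  fixes J :: "'g set" and s :: "complex \<Rightarrow> 'v::ab_group_add \<Rightarrow> 'v" and \<rho> :: "'g \<Rightarrow> 'v \<Rightarrow> 'v"
  assumes J: "subgroup J G" and J_open: "openin (top_of_set (carrier G)) J"
    and \<rho>: "irreducible_rep G J s \<rho>"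
begin

lemma smooth: "smooth_rep G J s \<rho>"
  using \<rho> by (simp add: irreducible_rep_def)

sublocale vs: vector_space s
  using smooth by (simp add: smooth_rep_def)

lemma J_carrier: "j \<in> J \<Longrightarrow> j \<in> carrier G"
  using subgroup.subset[OF J] by blast

lemma J_one: "\<one> \<in> J" and J_mult: "j \<in> J \<Longrightarrow> k \<in> J \<Longrightarrow> j \<otimes> k \<in> J"
  and J_inv: "j \<in> J \<Longrightarrow> inv j \<in> J"
  using J by (simp_all add: subgroup.one_closed subgroup.m_closed subgroup.m_inv_closed)

lemma \<rho>_linear: "j \<in> J \<Longrightarrow> Vector_Spaces.linear s s (\<rho> j)"
  using smooth by (simp add: smooth_rep_def)

lemma \<rho>_mult: "j \<in> J \<Longrightarrow> k \<in> J \<Longrightarrow> \<rho> (j \<otimes> k) v = \<rho> j (\<rho> k v)"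
  using smooth by (simp add: smooth_rep_def)

lemma \<rho>_one: "\<rho> \<one> v = v"
  using smooth by (simp add: smooth_rep_def)

lemma \<rho>_inv: "j \<in> J \<Longrightarrow> \<rho> (inv j) (\<rho> j v) = v" "j \<in> J \<Longrightarrow> \<rho> j (\<rho> (inv j) v) = v"
  using \<rho>_mult[of "inv j" j v] \<rho>_mult[of j "inv j" v] by (simp_all add: J_inv J_carrier \<rho>_one)

lemma \<rho>_add: "j \<in> J \<Longrightarrow> \<rho> j (v + w) = \<rho> j v + \<rho> j w"
  and \<rho>_scale: "j \<in> J \<Longrightarrow> \<rho> j (s c v) = s c (\<rho> j v)"
  and \<rho>_zero: "j \<in> J \<Longrightarrow> \<rho> j 0 = 0"
proof -
  assume "j \<in> J"
  then interpret j: Vector_Spaces.linear s s "\<rho> j" by (rule \<rho>_linear)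
  show "\<rho> j (v + w) = \<rho> j v + \<rho> j w"
    "\<rho> j (s c v) = s c (\<rho> j v)" "\<rho> j 0 = 0"
    by (simp_all add: j.add j.scale)
qed

lemma nontrivial: "\<exists>v::'v. v \<noteq> 0"
  using \<rho> by (simp add: irreducible_rep_def)

lemma simple_\<rho>: "simple_action J s \<rho>"
  using \<rho> by (simp add: irreducible_rep_def simple_action_def)

lemma stabiliser_open: "openin (top_of_set J) {j \<in> J. \<rho> j v = v}"
proof -
  have "\<forall>v. openin (top_of_set J) {x \<in> J. \<rho> x v = v}"
    using smooth by (simp add: smooth_rep_def)
  then show ?thesis ..
qed

definition level :: "'g set \<Rightarrow> bool" where
  "level H \<longleftrightarrow> subgroup H G \<and> J \<subseteq> H"

lemma level_subgroup: "level H \<Longrightarrow> subgroup H G"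
  and level_J: "level H \<Longrightarrow> j \<in> J \<Longrightarrow> j \<in> H"
  and level_carrier: "level H \<Longrightarrow> x \<in> H \<Longrightarrow> x \<in> carrier G"
  and level_one: "level H \<Longrightarrow> \<one> \<in> H"
  and level_mult: "level H \<Longrightarrow> x \<in> H \<Longrightarrow> y \<in> H \<Longrightarrow> x \<otimes> y \<in> H"
  and level_inv: "level H \<Longrightarrow> x \<in> H \<Longrightarrow> inv x \<in> H"
  by (auto simp: level_def subgroup.one_closed subgroup.m_closed subgroup.m_inv_closed
      dest: subgroup.subset)

lemma level_mult_cancel:
  assumes "level H" "x \<in> H" "y \<in> carrier G"
  shows "x \<otimes> y \<in> H \<longleftrightarrow> y \<in> H" "y \<otimes> x \<in> H \<longleftrightarrow> y \<in> H"
proof -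
  have x: "x \<in> carrier G" using assms by (simp add: level_carrier)
  have "inv x \<otimes> (x \<otimes> y) = y" "y \<otimes> x \<otimes> inv x = y" using x assms(3) by (simp_all add: m_assoc)
  then show "x \<otimes> y \<in> H \<longleftrightarrow> y \<in> H" "y \<otimes> x \<in> H \<longleftrightarrow> y \<in> H"
    using level_mult[OF assms(1)] level_inv[OF assms(1)] assms(2) by metis+
qed

lemma J_mult_cancel:
  assumes "j \<in> J" "y \<in> carrier G"
  shows "j \<otimes> y \<in> J \<longleftrightarrow> y \<in> J" "y \<otimes> j \<in> J \<longleftrightarrow> y \<in> J"
  using level_mult_cancel[of J j y] assms J by (simp_all add: level_def)

lemma coset_mem: "x \<in> carrier G \<Longrightarrow> y \<in> J #> x \<longleftrightarrow> y \<in> carrier G \<and> y \<otimes> inv x \<in> J"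
proof
  assume x: "x \<in> carrier G" and y: "y \<in> J #> x"
  then obtain j where j: "j \<in> J" "y = j \<otimes> x" by (auto simp: r_coset_def)
  then show "y \<in> carrier G \<and> y \<otimes> inv x \<in> J"
    using x by (simp add: m_assoc J_carrier)
next
  assume x: "x \<in> carrier G" and y: "y \<in> carrier G \<and> y \<otimes> inv x \<in> J"
  then have "y = y \<otimes> inv x \<otimes> x" by (simp add: m_assoc)
  then show "y \<in> J #> x" using y by (auto simp: r_coset_def)
qed

lemma coset_eq_iff:
  assumes "x \<in> carrier G" "y \<in> carrier G"
  shows "J #> x = J #> y \<longleftrightarrow> x \<otimes> inv y \<in> J"
proof
  assume "J #> x = J #> y"
  then have "x \<in> J #> y" using coset_mem[of x x] assms J_one by simp
  then show "x \<otimes> inv y \<in> J" using coset_mem assms by simp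
next
  assume "x \<otimes> inv y \<in> J"
  then have "x \<in> J #> y" using coset_mem assms by simp
  then show "J #> x = J #> y" using repr_independence[OF _ assms(2) J] by simp
qed

lemma coset_mult_right:
  assumes "x \<in> carrier G" "y \<in> carrier G" shows "J #> (x \<otimes> y) = (J #> x) #> y"
  using assms coset_mult_assoc[of J x y] subgroup.subset[OF J] by simp

lemma openin_level: "level H \<Longrightarrow> openin (top_of_set H) J"
  using J_open by (rule openin_subset_trans) (auto simp: level_def dest: subgroup.subset)

text \<open>\<open>J\<close> is open, so each coset is open.  Compactness of a support thus means that it meets only
  finitely many cosets.\<close>

lemma coset_space_discrete:
  assumes H: "level H"
  shows "coset_space G H J = discrete_topology (rcosets\<^bsub>G\<lparr>carrier := H\<rparr>\<^esub> J)"
proof -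
  let ?R = "rcosets\<^bsub>G\<lparr>carrier := H\<rparr>\<^esub> J"
  have grp: "group (G\<lparr>carrier := H\<rparr>)"
    by (rule subgroup.subgroup_is_group[OF level_subgroup[OF H] is_group])
  have sub: "subgroup J (G\<lparr>carrier := H\<rparr>)"
    using subgroup_incl[OF J level_subgroup[OF H]] H by (simp add: level_def)
  have coset_open: "openin (top_of_set H) C" if C: "C \<in> ?R" for C
  proof -
    obtain x where x: "x \<in> H" "C = J #>\<^bsub>G\<lparr>carrier := H\<rparr>\<^esub> x" using C by (auto simp: RCOSETS_def)
    then have "C = J #> x" by (simp add: r_coset_def)
    also have "\<dots> = {y \<in> H. y \<otimes> inv x \<in> J}"
    proof (rule Set.set_eqI)
      fix y show "y \<in> J #> x \<longleftrightarrow> y \<in> {y \<in> H. y \<otimes> inv x \<in> J}"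
        using coset_mem[of x y] level_mult_cancel[OF H, of "inv x" y] level_J[OF H]
          level_carrier[OF H] level_inv[OF H x(1)] x(1) by auto
    qed
    finally show ?thesis
      using openin_right[OF level_subgroup[OF H] openin_level[OF H] level_inv[OF H x(1)]] by simp
  qed
  have "openin (coset_space G H J) U \<longleftrightarrow> U \<subseteq> ?R" for U
  proof -
    have "openin (top_of_set H) (\<Union>U)" if "U \<subseteq> ?R"
      using that coset_open by (intro openin_Union) blast
    then show ?thesis using openin_coset_space[OF grp sub, of U] by blast
  qed
  then show ?thesis by (simp add: topology_eq)
qed

lemma compact_mod_iff:
  assumes H: "level H" and S: "S \<subseteq> H"
  shows "compact_mod G H J S \<longleftrightarrow> finite ((\<lambda>x. J #> x) ` S)"
proof -
  have "(\<lambda>x. J #> x) ` S \<subseteq> rcosets\<^bsub>G\<lparr>carrier := H\<rparr>\<^esub> J"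
    using S by (auto simp: RCOSETS_def r_coset_def)
  then show ?thesis
    by (simp add: compact_mod_def coset_space_discrete[OF H] compactin_discrete_topology)
qed

lemma openin_finite_Ball:
  assumes "finite F" "\<And>x. x \<in> F \<Longrightarrow> openin (top_of_set H) {k \<in> H. P x k}"
  shows "openin (top_of_set H) {k \<in> H. \<forall>x\<in>F. P x k}"
  using assms
proof (induction F rule: finite_induct)
  case (insert x F)
  have "{k \<in> H. \<forall>y\<in>insert x F. P y k} = {k \<in> H. P x k} \<inter> {k \<in> H. \<forall>y\<in>F. P y k}" by blast
  then show ?case using insert by (simp add: openin_Int)
qed simp

abbreviation ind :: "'g set \<Rightarrow> ('g \<Rightarrow> 'v) set" where
  "ind H \<equiv> compact_ind G H J \<rho>"

definition coset_support :: "('g \<Rightarrow> 'v) \<Rightarrow> 'g set set" where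
  "coset_support f = (\<lambda>x. J #> x) ` {x. f x \<noteq> 0}"

text \<open>Choose representatives \<open>x\<close> of the finitely many cosets in the support.  The function is invariant
  under the elements \<open>k\<close> such that every \<open>x k x\<^sup>-\<^sup>1\<close> fixes \<open>f x\<close>, and these form an open subgroup
  because \<open>\<rho>\<close> is smooth.\<close>

lemma ind_smooth:
  assumes H: "level H" and zero: "\<And>x. x \<notin> H \<Longrightarrow> f x = 0"
    and equi: "\<And>j x. j \<in> J \<Longrightarrow> x \<in> H \<Longrightarrow> f (j \<otimes> x) = \<rho> j (f x)"
    and fin: "finite (coset_support f)"
  shows "\<exists>K. subgroup K (G\<lparr>carrier := H\<rparr>) \<and> openin (top_of_set H) K \<and>
            (\<forall>x\<in>H. \<forall>k\<in>K. f (x \<otimes> k) = f x)"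
proof -
  obtain F where F: "finite F" "F \<subseteq> {x. f x \<noteq> 0}" "coset_support f = (\<lambda>x. J #> x) ` F"
    using finite_subset_image[of "coset_support f" "\<lambda>x. J #> x" "{x. f x \<noteq> 0}"] fin
    by (auto simp: coset_support_def)
  have FH: "x \<in> H" if "x \<in> F" for x using F(2) that zero by blast
  have HG: "x \<in> carrier G" if "x \<in> H" for x using that by (rule level_carrier[OF H])
  let ?P = "\<lambda>x k. x \<otimes> k \<otimes> inv x \<in> {j \<in> J. \<rho> j (f x) = f x}"
  let ?K = "{k \<in> H. \<forall>x\<in>F. ?P x k}"
  have "openin (top_of_set H) ?K"
  proof (rule openin_finite_Ball[OF F(1)])
    fix x assume x: "x \<in> F"
    let ?S = "{j \<in> J. \<rho> j (f x) = f x}"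
    have "openin (top_of_set H) ?S"
      by (rule openin_trans[OF stabiliser_open openin_level[OF H]])
    from openin_left[OF level_subgroup[OF H] openin_right[OF level_subgroup[OF H] this, of "inv x"], of x]
    have "openin (top_of_set H) {k \<in> H. x \<otimes> k \<in> {y \<in> H. y \<otimes> inv x \<in> ?S}}"
      using FH[OF x] level_inv[OF H] by blast
    moreover have "{k \<in> H. x \<otimes> k \<in> {y \<in> H. y \<otimes> inv x \<in> ?S}} = {k \<in> H. ?P x k}"
      using FH[OF x] level_mult[OF H] by auto
    ultimately show "openin (top_of_set H) {k \<in> H. ?P x k}" by simp
  qed
  moreover have K: "subgroup ?K (G\<lparr>carrier := H\<rparr>)"
  proof -
    have "subgroup ?K G"
    proof (rule subgroupI)
      show "?K \<subseteq> carrier G" using HG by blast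
      have "\<one> \<in> ?K" using level_one[OF H] FH HG by (auto simp: J_one \<rho>_one)
      then show "?K \<noteq> {}" by blast
    next
      fix k assume k: "k \<in> ?K"
      show "inv k \<in> ?K"
      proof (intro CollectI conjI ballI)
        show "inv k \<in> H" using k level_inv[OF H] by blast
        fix x assume x: "x \<in> F"
        let ?j = "x \<otimes> k \<otimes> inv x"
        have j: "?j \<in> J" "\<rho> ?j (f x) = f x" using k x by auto
        have "x \<otimes> inv k \<otimes> inv x = inv ?j"
          using k x FH HG by (simp add: inv_mult_group m_assoc)
        then show "x \<otimes> inv k \<otimes> inv x \<in> J" "\<rho> (x \<otimes> inv k \<otimes> inv x) (f x) = f x"
          using J_inv[OF j(1)] \<rho>_inv(1)[OF j(1), of "f x"] j(2) by simp_all
      qed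
    next
      fix k l assume k: "k \<in> ?K" and l: "l \<in> ?K"
      show "k \<otimes> l \<in> ?K"
      proof (intro CollectI conjI ballI)
        show "k \<otimes> l \<in> H" using k l level_mult[OF H] by blast
        fix x assume x: "x \<in> F"
        have "x \<otimes> (k \<otimes> l) \<otimes> inv x = (x \<otimes> k \<otimes> inv x) \<otimes> (x \<otimes> l \<otimes> inv x)"
          using k l x FH HG by (simp add: m_assoc)
        moreover have "x \<otimes> k \<otimes> inv x \<in> J" "x \<otimes> l \<otimes> inv x \<in> J"
          "\<rho> (x \<otimes> k \<otimes> inv x) (f x) = f x" "\<rho> (x \<otimes> l \<otimes> inv x) (f x) = f x" using k l x by auto
        ultimately show "x \<otimes> (k \<otimes> l) \<otimes> inv x \<in> J" "\<rho> (x \<otimes> (k \<otimes> l) \<otimes> inv x) (f x) = f x"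
          by (simp_all add: J_mult \<rho>_mult)
      qed
    qed
    then show ?thesis using subgroup_incl[OF _ level_subgroup[OF H]] by blast
  qed
  moreover have "f (y \<otimes> k) = f y" if y: "y \<in> H" and k: "k \<in> ?K" for y k
  proof -
    have nonzero: "f (y \<otimes> k) = f y" if y: "y \<in> H" and k: "k \<in> ?K" and fy: "f y \<noteq> 0" for y k
    proof -
      have "J #> y \<in> coset_support f" using fy by (auto simp: coset_support_def)
      then obtain x where x: "x \<in> F" "J #> y = J #> x" using F(3) by auto
      then have j: "y \<otimes> inv x \<in> J" using coset_eq_iff FH HG y by simp
      have kk: "x \<otimes> k \<otimes> inv x \<in> J" "\<rho> (x \<otimes> k \<otimes> inv x) (f x) = f x" "k \<in> H" using k x by auto
      have yx: "y = (y \<otimes> inv x) \<otimes> x" using y x FH HG by (simp add: m_assoc)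
      have "f (y \<otimes> k) = f ((y \<otimes> inv x) \<otimes> ((x \<otimes> k \<otimes> inv x) \<otimes> x))"
        using y x FH HG kk(3) by (simp add: m_assoc)
      also have "\<dots> = \<rho> (y \<otimes> inv x) (\<rho> (x \<otimes> k \<otimes> inv x) (f x))"
        using j kk FH[OF x(1)] level_mult[OF H] level_J[OF H] by (simp add: equi)
      also have "\<dots> = f ((y \<otimes> inv x) \<otimes> x)" using kk(2) equi[OF j FH[OF x(1)]] by simp
      finally show ?thesis using yx by simp
    qed
    have kH: "k \<in> H" and kinv: "inv k \<in> ?K"
      using k subgroup.m_inv_closed[OF K k] m_inv_consistent[OF level_subgroup[OF H]] by auto
    show ?thesis
    proof (cases "f y = 0")
      case True
      show ?thesis
      proof (rule ccontr)
        assume "f (y \<otimes> k) \<noteq> f y"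
        then have "f (y \<otimes> k \<otimes> inv k) = f (y \<otimes> k)"
          using nonzero[OF level_mult[OF H y kH] kinv] True by simp
        then show False using \<open>f (y \<otimes> k) \<noteq> f y\<close> y kH HG by (simp add: m_assoc)
      qed
    qed (rule nonzero[OF y k])
  qed
  ultimately show ?thesis by blast
qed

text \<open>The open subgroup in the definition is provided by \<open>ind_smooth\<close>; compactness of the support
  is finiteness by \<open>compact_mod_iff\<close>.\<close>

lemma ind_iff:
  assumes H: "level H"
  shows "f \<in> ind H \<longleftrightarrow> (\<forall>x. x \<notin> H \<longrightarrow> f x = 0) \<and> (\<forall>j\<in>J. \<forall>x\<in>H. f (j \<otimes> x) = \<rho> j (f x)) \<and>
    finite (coset_support f)"
proof -
  have "finite (coset_support f) \<longleftrightarrow> compact_mod G H J {x \<in> H. f x \<noteq> 0}" if "\<forall>x. x \<notin> H \<longrightarrow> f x = 0"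
  proof -
    have "{x \<in> H. f x \<noteq> 0} = {x. f x \<noteq> 0}" using that by blast
    then show ?thesis by (subst compact_mod_iff[OF H]) (auto simp: coset_support_def)
  qed
  moreover have "f \<in> ind H \<longleftrightarrow> (\<forall>x. x \<notin> H \<longrightarrow> f x = 0) \<and> (\<forall>j\<in>J. \<forall>x\<in>H. f (j \<otimes> x) = \<rho> j (f x)) \<and>
      (\<exists>K. subgroup K (G\<lparr>carrier := H\<rparr>) \<and> openin (top_of_set H) K \<and>
            (\<forall>x\<in>H. \<forall>k\<in>K. f (x \<otimes> k) = f x)) \<and> compact_mod G H J {x \<in> H. f x \<noteq> 0}"
    by (simp only: compact_ind_def mem_Collect_eq)
  ultimately show ?thesis
    using ind_smooth[OF H, of f] by blast
qed

lemma indI: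
  assumes "level H" "\<And>x. x \<notin> H \<Longrightarrow> f x = 0"
    "\<And>j x. j \<in> J \<Longrightarrow> x \<in> H \<Longrightarrow> f (j \<otimes> x) = \<rho> j (f x)" "finite (coset_support f)"
  shows "f \<in> ind H"
  using assms by (simp add: ind_iff)

lemma ind_zero: "f \<in> ind H \<Longrightarrow> x \<notin> H \<Longrightarrow> f x = 0"
  by (simp add: compact_ind_def)

lemma ind_equi: "f \<in> ind H \<Longrightarrow> j \<in> J \<Longrightarrow> x \<in> H \<Longrightarrow> f (j \<otimes> x) = \<rho> j (f x)"
  by (simp add: compact_ind_def)

lemma ind_finite: "level H \<Longrightarrow> f \<in> ind H \<Longrightarrow> finite (coset_support f)"
  by (simp add: ind_iff)

lemma ind_0: "level H \<Longrightarrow> (\<lambda>x. 0) \<in> ind H"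
  by (intro indI) (auto simp: \<rho>_zero coset_support_def)

lemma ind_add:
  assumes H: "level H" and f: "f \<in> ind H" and g: "g \<in> ind H"
  shows "(\<lambda>x. f x + g x) \<in> ind H"
proof (rule indI[OF H])
  have "coset_support (\<lambda>x. f x + g x) \<subseteq> coset_support f \<union> coset_support g"
    by (auto simp: coset_support_def)
  then show "finite (coset_support (\<lambda>x. f x + g x))"
    using ind_finite[OF H f] ind_finite[OF H g] by (meson finite_UnI finite_subset)
qed (use f g in \<open>simp_all add: ind_zero ind_equi \<rho>_add\<close>)

lemma ind_scale:
  assumes H: "level H" and f: "f \<in> ind H"
  shows "(\<lambda>x. s c (f x)) \<in> ind H"
proof (rule indI[OF H])
  have "coset_support (\<lambda>x. s c (f x)) \<subseteq> coset_support f"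
    by (auto simp: coset_support_def)
  then show "finite (coset_support (\<lambda>x. s c (f x)))"
    using ind_finite[OF H f] by (rule finite_subset)
qed (use f in \<open>simp_all add: ind_zero ind_equi \<rho>_scale\<close>)

text \<open>Translation by \<open>x\<close> followed by restriction to \<open>H\<close>.\<close>

abbreviation rt :: "'g set \<Rightarrow> 'g \<Rightarrow> ('g \<Rightarrow> 'v) \<Rightarrow> 'g \<Rightarrow> 'v" where
  "rt \<equiv> right_translate G"

lemma ind_rt:
  assumes H: "level H" and H': "level H'" and sub: "H \<subseteq> H'" and f: "f \<in> ind H'" and x: "x \<in> H'"
  shows "rt H x f \<in> ind H"
proof (rule indI[OF H])
  have xG: "x \<in> carrier G" using level_carrier[OF H' x] .
  show "rt H x f y = 0" if "y \<notin> H" for y using that by (simp add: right_translate_def)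
  show "rt H x f (j \<otimes> y) = \<rho> j (rt H x f y)" if "j \<in> J" "y \<in> H" for j y
  proof -
    have "f (j \<otimes> (y \<otimes> x)) = \<rho> j (f (y \<otimes> x))"
      using that sub x by (intro ind_equi[OF f]) (auto intro: level_mult[OF H'])
    then show ?thesis
      using that xG level_mult[OF H] level_J[OF H] by (simp add: right_translate_def m_assoc level_carrier[OF H] J_carrier)
  qed
  have "coset_support (rt H x f) \<subseteq> (\<lambda>C. C #> inv x) ` coset_support f"
  proof
    fix C assume "C \<in> coset_support (rt H x f)"
    then obtain y where y: "C = J #> y" "rt H x f y \<noteq> 0" by (auto simp: coset_support_def)
    then have yH: "y \<in> H" "f (y \<otimes> x) \<noteq> 0" by (auto simp: right_translate_def split: if_splits)
    have yG: "y \<in> carrier G" by (rule level_carrier[OF H yH(1)])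
    have "C = (J #> (y \<otimes> x)) #> inv x"
      using yG xG by (simp add: y(1) flip: coset_mult_right) (simp add: m_assoc)
    then show "C \<in> (\<lambda>C. C #> inv x) ` coset_support f"
      using yH(2) by (auto simp: coset_support_def)
  qed
  then show "finite (coset_support (rt H x f))"
    using ind_finite[OF H' f] by (meson finite_imageI finite_subset)
qed

lemma rt_rt:
  assumes "level H" "h \<in> H" "x \<in> carrier G"
  shows "rt H h (rt H x f) = rt H (h \<otimes> x) f"
  using assms level_mult[OF assms(1)]
  by (auto simp: right_translate_def fun_eq_iff m_assoc level_carrier)

text \<open>The functions \<open>delta \<one> v\<close> form the copy of \<open>\<rho>\<close> that generates the induced representation;
  \<open>delta x v\<close> is the translate of \<open>delta \<one> v\<close> by \<open>x\<^sup>-\<^sup>1\<close>.  It is supported on \<open>J x\<close> and takes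
  the value \<open>v\<close> at \<open>x\<close>.\<close>

definition delta :: "'g \<Rightarrow> 'v \<Rightarrow> 'g \<Rightarrow> 'v" where
  "delta x v = (\<lambda>y. if y \<in> carrier G \<and> y \<otimes> inv x \<in> J then \<rho> (y \<otimes> inv x) v else 0)"

lemma delta_ind:
  assumes H: "level H" and x: "x \<in> H"
  shows "delta x v \<in> ind H"
proof (rule indI[OF H])
  have xG: "x \<in> carrier G" by (rule level_carrier[OF H x])
  show "delta x v y = 0" if "y \<notin> H" for y
    using that level_mult_cancel(2)[OF H level_inv[OF H x], of y] level_J[OF H] by (auto simp: delta_def)
  show "delta x v (j \<otimes> y) = \<rho> j (delta x v y)" if "j \<in> J" "y \<in> H" for j y
    using that xG level_carrier[OF H that(2)]
    by (auto simp: delta_def J_carrier m_assoc J_mult_cancel \<rho>_mult \<rho>_zero)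
  have "J #> y = J #> x" if "delta x v y \<noteq> 0" for y
    using that xG by (subst coset_eq_iff) (auto simp: delta_def split: if_splits)
  then have "coset_support (delta x v) \<subseteq> {J #> x}"
    by (auto simp only: coset_support_def)
  then show "finite (coset_support (delta x v))" by (rule finite_subset) simp
qed

lemma rt_delta:
  assumes H: "level H" and "x \<in> H" "h \<in> H"
  shows "rt H h (delta x v) = delta (x \<otimes> inv h) v"
proof
  fix y
  have G: "x \<in> carrier G" "h \<in> carrier G" using assms level_carrier by auto
  show "rt H h (delta x v) y = delta (x \<otimes> inv h) v y"
  proof (cases "y \<in> H")
    case True
    then show ?thesis
      using G level_carrier[OF H True] by (simp add: right_translate_def delta_def inv_mult_group m_assoc)
  next
    case False
    then show ?thesis
      using ind_zero[OF delta_ind[OF H level_mult[OF H assms(2) level_inv[OF H assms(3)]]] False]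
      by (simp add: right_translate_def)
  qed
qed

lemma delta_eq_rt: "level H \<Longrightarrow> x \<in> H \<Longrightarrow> delta x v = rt H (inv x) (delta \<one> v)"
  by (simp add: rt_delta level_one level_inv level_carrier)

lemma delta_add: "delta x (v + w) = (\<lambda>y. delta x v y + delta x w y)"
  by (auto simp: delta_def fun_eq_iff \<rho>_add)

lemma delta_scale: "delta x (s c v) = (\<lambda>y. s c (delta x v y))"
  by (auto simp: delta_def fun_eq_iff \<rho>_scale)

lemma delta_J:
  assumes "j \<in> J" "x \<in> carrier G" shows "delta (j \<otimes> x) (\<rho> j v) = delta x v"
proof
  fix y show "delta (j \<otimes> x) (\<rho> j v) y = delta x v y"
  proof (cases "y \<in> carrier G")
    case True
    have eq: "y \<otimes> inv (j \<otimes> x) = y \<otimes> inv x \<otimes> inv j"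
      using assms True by (simp add: inv_mult_group J_carrier m_assoc)
    have iff: "y \<otimes> inv x \<otimes> inv j \<in> J \<longleftrightarrow> y \<otimes> inv x \<in> J"
      using assms True by (intro J_mult_cancel) (auto intro: J_inv)
    show ?thesis
      using assms by (simp add: delta_def eq iff \<rho>_mult J_inv \<rho>_inv)
  qed (simp add: delta_def)
qed

text \<open>Subtracting \<open>delta x (f x)\<close> from \<open>f\<close> removes the coset of \<open>x\<close> from the support.\<close>

lemma ind_induct [consumes 2, case_names zero add]:
  assumes H: "level H" and f: "f \<in> ind H"
    and zero: "P (\<lambda>x. 0)"
    and add: "\<And>x v g. x \<in> H \<Longrightarrow> g \<in> ind H \<Longrightarrow> P g \<Longrightarrow> P (\<lambda>y. delta x v y + g y)"
  shows "P f"
  using f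
proof (induction "card (coset_support f)" arbitrary: f rule: less_induct)
  case less
  show ?case
  proof (cases "f = (\<lambda>x. 0)")
    case True
    then show ?thesis using zero by simp
  next
    case False
    then obtain x where fx: "f x \<noteq> 0" by auto
    then have x: "x \<in> H" using ind_zero[OF less.prems] by blast
    have xG: "x \<in> carrier G" by (rule level_carrier[OF H x])
    define g where "g = (\<lambda>y. f y + s (-1) (delta x (f x) y))"
    have g: "g \<in> ind H"
      unfolding g_def by (intro ind_add[OF H] ind_scale[OF H] less.prems delta_ind[OF H x])
    have g_x: "g y = 0" if y: "J #> y = J #> x" "y \<in> carrier G" for y
    proof -
      have j: "y \<otimes> inv x \<in> J" using y xG by (simp add: coset_eq_iff)
      have "f y = f ((y \<otimes> inv x) \<otimes> x)" using y(2) xG by (simp add: m_assoc)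
      also have "\<dots> = \<rho> (y \<otimes> inv x) (f x)" by (rule ind_equi[OF less.prems j x])
      finally show ?thesis using j y(2) by (simp add: g_def delta_def)
    qed
    have "coset_support g \<subseteq> coset_support f - {J #> x}"
    proof
      fix C assume "C \<in> coset_support g"
      then obtain y where y: "C = J #> y" "g y \<noteq> 0" by (auto simp: coset_support_def)
      then have yG: "y \<in> carrier G" using ind_zero[OF g] level_carrier[OF H] by blast
      have "C \<noteq> J #> x" using g_x[of y] y yG by blast
      moreover have "f y \<noteq> 0"
      proof
        assume "f y = 0"
        then have "delta x (f x) y \<noteq> 0" using y(2) by (auto simp: g_def)
        then have "y \<otimes> inv x \<in> J" by (auto simp: delta_def split: if_splits)
        then show False using \<open>C \<noteq> J #> x\<close> y(1) yG xG by (simp add: coset_eq_iff)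
      qed
      ultimately show "C \<in> coset_support f - {J #> x}" using y(1) by (auto simp: coset_support_def)
    qed
    moreover have "J #> x \<in> coset_support f" using fx by (auto simp: coset_support_def)
    ultimately have "coset_support g \<subset> coset_support f" by blast
    then have "card (coset_support g) < card (coset_support f)"
      by (rule psubset_card_mono[OF ind_finite[OF H less.prems]])
    then have "P g" using less.hyps g by blast
    then have "P (\<lambda>y. delta x (f x) y + g y)" by (rule add[OF x g])
    moreover have "(\<lambda>y. delta x (f x) y + g y) = f" by (simp add: g_def fun_eq_iff)
    ultimately show ?thesis by simp
  qed
qed

end

section \<open>Hecke algebras\<close>

lemma alg_iso_center:
  assumes h: "h \<in> alg_iso A B"
    and closed: "\<And>x y. x \<in> carrier A \<Longrightarrow> y \<in> carrier A \<Longrightarrow> x \<otimes>\<^bsub>A\<^esub> y \<in> carrier A"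
  shows "h \<in> alg_iso (alg_center A) (alg_center B)"
proof -
  have hom: "h \<in> ring_hom A B" and bij: "bij_betw h (carrier A) (carrier B)"
    and smult: "\<And>c x. x \<in> carrier A \<Longrightarrow> h (c \<odot>\<^bsub>A\<^esub> x) = c \<odot>\<^bsub>B\<^esub> h x"
    using h by (auto simp: alg_iso_def ring_iso_def)
  have mult: "h (x \<otimes>\<^bsub>A\<^esub> y) = h x \<otimes>\<^bsub>B\<^esub> h y" if "x \<in> carrier A" "y \<in> carrier A" for x y
    using ring_hom_mult[OF hom that] .
  have central: "h z \<in> carrier (alg_center B) \<longleftrightarrow> z \<in> carrier (alg_center A)" if z: "z \<in> carrier A" for z
  proof
    assume hz: "h z \<in> carrier (alg_center B)"
    have "z \<otimes>\<^bsub>A\<^esub> x = x \<otimes>\<^bsub>A\<^esub> z" if x: "x \<in> carrier A" for x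
    proof -
      have "h x \<in> carrier B" using bij x by (auto simp: bij_betw_def)
      then have "h (z \<otimes>\<^bsub>A\<^esub> x) = h (x \<otimes>\<^bsub>A\<^esub> z)"
        using hz z x by (simp add: alg_center_def mult)
      then show ?thesis
        using bij closed z x by (auto simp: bij_betw_def dest: inj_onD)
    qed
    then show "z \<in> carrier (alg_center A)" using z by (simp add: alg_center_def)
  next
    assume zc: "z \<in> carrier (alg_center A)"
    have "h z \<otimes>\<^bsub>B\<^esub> y = y \<otimes>\<^bsub>B\<^esub> h z" if y: "y \<in> carrier B" for y
    proof -
      obtain x where x: "x \<in> carrier A" "y = h x" using bij y by (auto simp: bij_betw_def)
      then have "z \<otimes>\<^bsub>A\<^esub> x = x \<otimes>\<^bsub>A\<^esub> z" using zc by (simp add: alg_center_def)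
      then show ?thesis using mult z x by metis
    qed
    moreover have "h z \<in> carrier B" using bij z by (auto simp: bij_betw_def)
    ultimately show "h z \<in> carrier (alg_center B)" by (simp add: alg_center_def)
  qed
  have sub: "carrier (alg_center A) \<subseteq> carrier A" "carrier (alg_center B) \<subseteq> carrier B"
    by (auto simp: alg_center_def)
  have "bij_betw h (carrier (alg_center A)) (carrier (alg_center B))"
    unfolding bij_betw_def
  proof
    show "inj_on h (carrier (alg_center A))" using bij sub by (auto simp: bij_betw_def intro: inj_on_subset)
    show "h ` carrier (alg_center A) = carrier (alg_center B)"
    proof
      show "h ` carrier (alg_center A) \<subseteq> carrier (alg_center B)"
        by (rule image_subsetI) (use central sub(1) in \<open>simp add: subset_iff\<close>)
      show "carrier (alg_center B) \<subseteq> h ` carrier (alg_center A)"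
      proof
        fix y assume y: "y \<in> carrier (alg_center B)"
        then have "y \<in> h ` carrier A" using bij sub by (auto simp: bij_betw_def)
        then obtain x where x: "x \<in> carrier A" "y = h x" by (rule imageE)
        then have "x \<in> carrier (alg_center A)" using central[OF x(1)] y by simp
        then show "y \<in> h ` carrier (alg_center A)" using x(2) by (intro image_eqI)
      qed
    qed
  qed
  moreover have "h \<in> ring_hom (alg_center A) (alg_center B)"
  proof (rule ring_hom_memI)
    fix x y assume x: "x \<in> carrier (alg_center A)" and y: "y \<in> carrier (alg_center A)"
    then have xy: "x \<in> carrier A" "y \<in> carrier A" using sub(1) by (simp_all add: subset_iff)
    show "h x \<in> carrier (alg_center B)" using central[OF xy(1)] x by simp
    show "h (x \<otimes>\<^bsub>alg_center A\<^esub> y) = h x \<otimes>\<^bsub>alg_center B\<^esub> h y"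
      using mult[OF xy] by (simp add: alg_center_def)
    show "h (x \<oplus>\<^bsub>alg_center A\<^esub> y) = h x \<oplus>\<^bsub>alg_center B\<^esub> h y"
      using ring_hom_add[OF hom xy] by (simp add: alg_center_def)
  next
    show "h \<one>\<^bsub>alg_center A\<^esub> = \<one>\<^bsub>alg_center B\<^esub>"
      using ring_hom_one[OF hom] by (simp add: alg_center_def)
  qed
  moreover have "h (c \<odot>\<^bsub>alg_center A\<^esub> x) = c \<odot>\<^bsub>alg_center B\<^esub> h x"
    if "x \<in> carrier (alg_center A)" for c x
    using that smult[of x c] by (simp add: alg_center_def)
  ultimately show ?thesis
    by (simp add: alg_iso_def ring_iso_def)
qed

context hecke_pair
begin

lemma rt_apply: "rt H y f x = (if x \<in> H then f (x \<otimes> y) else 0)"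
  by (simp add: right_translate_def)

abbreviation HA where "HA H \<equiv> hecke_algebra G H J s \<rho>"

lemma HA_simps [simp]:
  "T \<otimes>\<^bsub>HA H\<^esub> S = compose (ind H) T S" "\<one>\<^bsub>HA H\<^esub> = (\<lambda>f\<in>ind H. f)"
  "T \<oplus>\<^bsub>HA H\<^esub> S = (\<lambda>f\<in>ind H. \<lambda>x. T f x + S f x)"
  "c \<odot>\<^bsub>HA H\<^esub> T = (\<lambda>f\<in>ind H. \<lambda>x. s c (T f x))"
  by (simp_all add: hecke_algebra_def Let_def)

lemma hecke_iff: "T \<in> carrier (HA H) \<longleftrightarrow> T \<in> ind H \<rightarrow>\<^sub>E ind H \<and>
    (\<forall>f\<in>ind H. \<forall>g\<in>ind H. T (\<lambda>x. f x + g x) = (\<lambda>x. T f x + T g x)) \<and>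
    (\<forall>c. \<forall>f\<in>ind H. T (\<lambda>x. s c (f x)) = (\<lambda>x. s c (T f x))) \<and>
    (\<forall>y\<in>H. \<forall>f\<in>ind H. T (rt H y f) = rt H y (T f))"
  by (simp add: hecke_algebra_def Let_def)

lemma heckeI:
  assumes "\<And>f. f \<in> ind H \<Longrightarrow> T f \<in> ind H" "T \<in> extensional (ind H)"
    "\<And>f g. f \<in> ind H \<Longrightarrow> g \<in> ind H \<Longrightarrow> T (\<lambda>x. f x + g x) = (\<lambda>x. T f x + T g x)"
    "\<And>c f. f \<in> ind H \<Longrightarrow> T (\<lambda>x. s c (f x)) = (\<lambda>x. s c (T f x))"
    "\<And>y f. y \<in> H \<Longrightarrow> f \<in> ind H \<Longrightarrow> T (rt H y f) = rt H y (T f)"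
  shows "T \<in> carrier (HA H)"
  using assms unfolding hecke_iff PiE_iff by blast

lemma hecke_ind: "T \<in> carrier (HA H) \<Longrightarrow> f \<in> ind H \<Longrightarrow> T f \<in> ind H"
  and hecke_ext: "T \<in> carrier (HA H) \<Longrightarrow> T \<in> extensional (ind H)"
  and hecke_add: "T \<in> carrier (HA H) \<Longrightarrow> f \<in> ind H \<Longrightarrow> g \<in> ind H \<Longrightarrow>
    T (\<lambda>x. f x + g x) = (\<lambda>x. T f x + T g x)"
  and hecke_scale: "T \<in> carrier (HA H) \<Longrightarrow> f \<in> ind H \<Longrightarrow> T (\<lambda>x. s c (f x)) = (\<lambda>x. s c (T f x))"
  and hecke_rt: "T \<in> carrier (HA H) \<Longrightarrow> y \<in> H \<Longrightarrow> f \<in> ind H \<Longrightarrow> T (rt H y f) = rt H y (T f)"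
  unfolding hecke_iff PiE_iff by blast+

lemma ind_rt_self: "level H \<Longrightarrow> f \<in> ind H \<Longrightarrow> x \<in> H \<Longrightarrow> rt H x f \<in> ind H"
  using ind_rt[of H H] by blast

lemma hecke_0:
  assumes "level H" "T \<in> carrier (HA H)" shows "T (\<lambda>x. 0) = (\<lambda>x. 0)"
  using hecke_scale[OF assms(2) ind_0[OF assms(1)], of 0] by simp

lemma hecke_compose:
  assumes H: "level H" and T: "T \<in> carrier (HA H)" and S: "S \<in> carrier (HA H)"
  shows "compose (ind H) T S \<in> carrier (HA H)"
proof (rule heckeI)
  show "compose (ind H) T S f \<in> ind H" if "f \<in> ind H" for f
    using that by (simp add: compose_def hecke_ind[OF T] hecke_ind[OF S])
qed (simp_all add: compose_def hecke_ind[OF S] hecke_add[OF T] hecke_add[OF S] hecke_scale[OF T]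
    hecke_scale[OF S] hecke_rt[OF T] hecke_rt[OF S] ind_add[OF H] ind_scale[OF H] ind_rt_self[OF H])

lemma hecke_sum:
  assumes H: "level H" and T: "T \<in> carrier (HA H)" and S: "S \<in> carrier (HA H)"
  shows "(\<lambda>f\<in>ind H. \<lambda>x. T f x + S f x) \<in> carrier (HA H)"
proof (rule heckeI)
  show "(\<lambda>f\<in>ind H. \<lambda>x. T f x + S f x) f \<in> ind H" if "f \<in> ind H" for f
    using that by (simp add: ind_add[OF H] hecke_ind[OF T] hecke_ind[OF S])
qed (auto simp: hecke_add[OF T] hecke_add[OF S] hecke_scale[OF T] add_ac vs.scale_right_distrib
    hecke_scale[OF S] hecke_rt[OF T] hecke_rt[OF S] ind_add[OF H] ind_scale[OF H] ind_rt_self[OF H]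
    rt_apply fun_eq_iff)

lemma hecke_smult:
  assumes H: "level H" and T: "T \<in> carrier (HA H)"
  shows "(\<lambda>f\<in>ind H. \<lambda>x. s c (T f x)) \<in> carrier (HA H)"
proof (rule heckeI)
  show "(\<lambda>f\<in>ind H. \<lambda>x. s c (T f x)) f \<in> ind H" if "f \<in> ind H" for f
    using that by (simp add: ind_scale[OF H] hecke_ind[OF T])
qed (auto simp: hecke_add[OF T] hecke_scale[OF T] vs.scale_right_distrib mult.commute
    hecke_rt[OF T] ind_add[OF H] ind_scale[OF H] ind_rt_self[OF H] rt_apply fun_eq_iff)

text \<open>By Frobenius reciprocity \<open>T\<close> corresponds to the \<open>J\<close>-homomorphism \<open>v \<mapsto> T (delta \<one> v)\<close> from
  \<open>\<rho>\<close> to the induced representation.  All questions about \<open>T\<close> are settled on the maps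
  \<open>kern T x\<close> from \<open>\<rho>\<close> to itself.\<close>

definition kern :: "(('g \<Rightarrow> 'v) \<Rightarrow> 'g \<Rightarrow> 'v) \<Rightarrow> 'g \<Rightarrow> 'v \<Rightarrow> 'v" where
  "kern T x v = T (delta \<one> v) x"

lemma hecke_delta:
  assumes H: "level H" and T: "T \<in> carrier (HA H)" and x: "x \<in> H" and y: "y \<in> H"
  shows "T (delta x v) y = kern T (y \<otimes> inv x) v"
proof -
  have "T (delta x v) = rt H (inv x) (T (delta \<one> v))"
    using hecke_rt[OF T level_inv[OF H x] delta_ind[OF H level_one[OF H]]]
    by (simp add: delta_eq_rt[OF H x])
  then show ?thesis using y by (simp add: right_translate_def kern_def)
qed

lemma kern_zero: "level H \<Longrightarrow> T \<in> carrier (HA H) \<Longrightarrow> x \<notin> H \<Longrightarrow> kern T x v = 0"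
  unfolding kern_def by (rule ind_zero[OF hecke_ind[OF _ delta_ind]]) (auto intro: level_one)

lemma kern_linear:
  assumes H: "level H" and T: "T \<in> carrier (HA H)"
  shows "Vector_Spaces.linear s s (kern T x)"
proof -
  have d: "delta \<one> v \<in> ind H" for v by (rule delta_ind[OF H level_one[OF H]])
  show ?thesis
    by unfold_locales (simp_all add: kern_def delta_add delta_scale hecke_add[OF T d d] hecke_scale[OF T d])
qed

lemma kern_left:
  assumes "level H" "T \<in> carrier (HA H)" "j \<in> J" "x \<in> H"
  shows "kern T (j \<otimes> x) v = \<rho> j (kern T x v)"
  unfolding kern_def
  by (rule ind_equi[OF hecke_ind[OF assms(2) delta_ind[OF assms(1) level_one[OF assms(1)]]] assms(3,4)])

lemma kern_right:
  assumes H: "level H" and T: "T \<in> carrier (HA H)" and j: "j \<in> J" and x: "x \<in> H"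
  shows "kern T (x \<otimes> j) v = kern T x (\<rho> j v)"
proof -
  have "delta \<one> (\<rho> j v) = delta (inv j) v"
    using delta_J[OF j, of "inv j" v] j by (simp add: J_carrier)
  then show ?thesis
    using hecke_delta[OF H T level_inv[OF H level_J[OF H j]] x, of v] j by (simp add: kern_def J_carrier)
qed

text \<open>The translates of the functions \<open>delta \<one> v\<close> span the induced representation.\<close>

lemma hecke_eqI:
  assumes H: "level H" and T: "T \<in> carrier (HA H)" and S: "S \<in> carrier (HA H)"
    and eq: "\<And>x v. x \<in> H \<Longrightarrow> kern T x v = kern S x v"
  shows "T = S"
proof (rule extensionalityI[OF hecke_ext[OF T] hecke_ext[OF S]])
  fix f assume "f \<in> ind H"
  with H show "T f = S f"
  proof (induction rule: ind_induct)
    case zero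
    then show ?case using hecke_0[OF H T] hecke_0[OF H S] by simp
  next
    case (add x v g)
    have d: "delta x v \<in> ind H" by (rule delta_ind[OF H add(1)])
    have dd: "T (delta x v) y = S (delta x v) y" for y
    proof (cases "y \<in> H")
      case True
      then show ?thesis
        using hecke_delta[OF H T add(1) True] hecke_delta[OF H S add(1) True]
          eq[OF level_mult[OF H True level_inv[OF H add(1)]]] by simp
    next
      case False
      then show ?thesis using ind_zero[OF hecke_ind[OF T d]] ind_zero[OF hecke_ind[OF S d]] by simp
    qed
    have gg: "T g = S g" by (rule add(3))
    show ?case
      unfolding hecke_add[OF T d add(2)] hecke_add[OF S d add(2)] dd gg ..
  qed
qed

lemma kern_sum: "level H \<Longrightarrow> kern (\<lambda>f\<in>ind H. \<lambda>x. T f x + S f x) x v = kern T x v + kern S x v"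
  by (simp add: kern_def delta_ind level_one)

lemma kern_smult: "level H \<Longrightarrow> kern (\<lambda>f\<in>ind H. \<lambda>x. s c (T f x)) x v = s c (kern T x v)"
  by (simp add: kern_def delta_ind level_one)

lemma kern_one:
  "level H \<Longrightarrow> x \<in> H \<Longrightarrow> kern (\<lambda>f\<in>ind H. f) x v = (if x \<in> J then \<rho> x v else 0)"
  by (simp add: kern_def delta_ind level_one) (simp add: delta_def level_carrier)

lemma kern_support_finite:
  assumes H: "level H" and T: "T \<in> carrier (HA H)"
  shows "finite (coset_support (\<lambda>x. kern T x v))"
  unfolding kern_def by (rule ind_finite[OF H hecke_ind[OF T delta_ind[OF H level_one[OF H]]]])

subsection \<open>Change of the group\<close>

context
  fixes H H' assumes H: "level H" and H': "level H'" and sub: "H \<subseteq> H'"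
begin

abbreviation "ext \<equiv> hecke_map G H H' J \<rho>"

lemma ind_rt_sub: "f \<in> ind H' \<Longrightarrow> x \<in> H' \<Longrightarrow> rt H x f \<in> ind H"
  by (rule ind_rt[OF H H' sub])

lemma ind_mono: "f \<in> ind H \<Longrightarrow> f \<in> ind H'"
proof (rule indI[OF H'])
  assume f: "f \<in> ind H"
  show "f x = 0" if "x \<notin> H'" for x using that sub ind_zero[OF f] by blast
  show "finite (coset_support f)" by (rule ind_finite[OF H f])
  show "f (j \<otimes> x) = \<rho> j (f x)" if "j \<in> J" "x \<in> H'" for j x
  proof (cases "x \<in> H")
    case False
    then have "j \<otimes> x \<notin> H"
      using level_mult_cancel(1)[OF H level_J[OF H that(1)]] level_carrier[OF H' that(2)] by simp
    then show ?thesis using False ind_zero[OF f] that(1) by (simp add: \<rho>_zero)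
  qed (rule ind_equi[OF f that(1)])
qed

lemma ext_extensional: "ext T \<in> extensional (ind H')"
  by (simp add: hecke_map_def)

lemma ext_apply: "f \<in> ind H' \<Longrightarrow> ext T f x = (if x \<in> H' then T (rt H x f) \<one> else 0)"
  by (simp add: hecke_map_def right_translate_def)

context
  fixes T assumes T: "T \<in> carrier (HA H)"
begin

lemma ext_mult:
  assumes f: "f \<in> ind H'" and h: "h \<in> H" and x: "x \<in> H'"
  shows "ext T f (h \<otimes> x) = T (rt H x f) h"
proof -
  have "h \<otimes> x \<in> H'" using level_mult[OF H'] h x sub by blast
  then have "ext T f (h \<otimes> x) = T (rt H h (rt H x f)) \<one>"
    using h x by (simp add: ext_apply[OF f] rt_rt[OF H] level_carrier[OF H'])
  also have "\<dots> = T (rt H x f) h"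
    using h level_one[OF H] level_carrier[OF H]
    by (simp add: hecke_rt[OF T h ind_rt_sub[OF f x]] rt_apply)
  finally show ?thesis .
qed

text \<open>On each coset \<open>H x\<close> the extended operator acts as \<open>T\<close>.  The algebraic properties of the extension
  follow from those of \<open>T\<close> by this formula.\<close>

lemma rt_ext:
  assumes f: "f \<in> ind H'" and x: "x \<in> H'"
  shows "rt H x (ext T f) = T (rt H x f)"
proof
  fix y show "rt H x (ext T f) y = T (rt H x f) y"
    using ext_mult[OF f _ x] ind_zero[OF hecke_ind[OF T ind_rt_sub[OF f x]]]
    by (simp add: right_translate_def)
qed

text \<open>The support of \<open>f\<close> meets only finitely many cosets \<open>H x\<close>, and on each of them \<open>ext T f\<close> is a
  translate of a function in \<open>ind H\<close>.\<close>

lemma ext_ind: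
  assumes f: "f \<in> ind H'" shows "ext T f \<in> ind H'"
proof (rule indI[OF H'])
  show "ext T f x = 0" if "x \<notin> H'" for x using that by (simp add: ext_apply[OF f])
  show "ext T f (j \<otimes> x) = \<rho> j (ext T f x)" if j: "j \<in> J" and x: "x \<in> H'" for j x
  proof -
    have "ext T f (j \<otimes> x) = T (rt H x f) (j \<otimes> \<one>)"
      using ext_mult[OF f level_J[OF H j] x] j by (simp add: J_carrier)
    also have "\<dots> = \<rho> j (T (rt H x f) \<one>)"
      by (rule ind_equi[OF hecke_ind[OF T ind_rt_sub[OF f x]] j level_one[OF H]])
    finally show ?thesis using x by (simp add: ext_apply[OF f])
  qed
  obtain F where F: "finite F" "F \<subseteq> {x. f x \<noteq> 0}" "coset_support f = (\<lambda>x. J #> x) ` F"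
    using finite_subset_image[of "coset_support f" "\<lambda>x. J #> x" "{x. f x \<noteq> 0}"] ind_finite[OF H' f]
    by (auto simp: coset_support_def)
  have FH: "x \<in> H'" if "x \<in> F" for x using F(2) that ind_zero[OF f] by blast
  have "coset_support (ext T f) \<subseteq> (\<Union>x\<in>F. (\<lambda>C. C #> x) ` coset_support (T (rt H x f)))"
  proof
    fix C assume "C \<in> coset_support (ext T f)"
    then obtain y where y: "C = J #> y" "ext T f y \<noteq> 0" by (auto simp: coset_support_def)
    then have yH: "y \<in> H'" "T (rt H y f) \<one> \<noteq> 0" by (auto simp: ext_apply[OF f] split: if_splits)
    have yG: "y \<in> carrier G" by (rule level_carrier[OF H' yH(1)])
    have "rt H y f \<noteq> (\<lambda>x. 0)" using yH(2) hecke_0[OF H T] by auto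
    then obtain h where h: "h \<in> H" "f (h \<otimes> y) \<noteq> 0"
      by (auto simp: right_translate_def fun_eq_iff split: if_splits)
    have hG: "h \<in> carrier G" by (rule level_carrier[OF H h(1)])
    have "J #> (h \<otimes> y) \<in> coset_support f" using h(2) by (auto simp: coset_support_def)
    then obtain x where x: "x \<in> F" "J #> (h \<otimes> y) = J #> x" using F(3) by auto
    have xG: "x \<in> carrier G" by (rule level_carrier[OF H' FH[OF x(1)]])
    have j: "h \<otimes> y \<otimes> inv x \<in> J" using x(2) xG yG hG by (simp add: coset_eq_iff)
    define g where "g = inv h \<otimes> (h \<otimes> y \<otimes> inv x)"
    have g: "g \<in> H" unfolding g_def using j h(1) level_J[OF H] level_mult[OF H] level_inv[OF H] by blast
    have gx: "y = g \<otimes> x" using xG yG hG by (simp add: g_def m_assoc)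
    have "T (rt H x f) g \<noteq> 0" using y(2) ext_mult[OF f g FH[OF x(1)]] gx by simp
    then have "J #> g \<in> coset_support (T (rt H x f))" by (auto simp: coset_support_def)
    moreover have "C = (J #> g) #> x"
      using y(1) gx coset_mult_right[OF level_carrier[OF H g] xG] by simp
    ultimately show "C \<in> (\<Union>x\<in>F. (\<lambda>C. C #> x) ` coset_support (T (rt H x f)))" using x(1) by blast
  qed
  moreover have "finite (coset_support (T (rt H x f)))" if "x \<in> F" for x
    by (rule ind_finite[OF H hecke_ind[OF T ind_rt_sub[OF f FH[OF that]]]])
  ultimately show "finite (coset_support (ext T f))"
    using F(1) by (meson finite_UN_I finite_imageI finite_subset)
qed

lemma ext_hecke: "ext T \<in> carrier (HA H')"
proof (rule heckeI)
  show "ext T f \<in> ind H'" if "f \<in> ind H'" for f by (rule ext_ind[OF that])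
  show "ext T \<in> extensional (ind H')" by (simp add: hecke_map_def)
next
  fix f g assume f: "f \<in> ind H'" and g: "g \<in> ind H'"
  show "ext T (\<lambda>x. f x + g x) = (\<lambda>x. ext T f x + ext T g x)"
  proof
    fix x
    have "rt H x (\<lambda>x. f x + g x) = (\<lambda>y. rt H x f y + rt H x g y)"
      by (auto simp: right_translate_def)
    then show "ext T (\<lambda>x. f x + g x) x = ext T f x + ext T g x"
      by (simp add: ext_apply ind_add[OF H'] f g hecke_add[OF T] ind_rt_sub)
  qed
next
  fix c f assume f: "f \<in> ind H'"
  show "ext T (\<lambda>x. s c (f x)) = (\<lambda>x. s c (ext T f x))"
  proof
    fix x
    have "rt H x (\<lambda>x. s c (f x)) = (\<lambda>y. s c (rt H x f y))"
      by (auto simp: right_translate_def)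
    then show "ext T (\<lambda>x. s c (f x)) x = s c (ext T f x)"
      by (simp add: ext_apply ind_scale[OF H'] f hecke_scale[OF T] ind_rt_sub)
  qed
next
  fix y f assume y: "y \<in> H'" and f: "f \<in> ind H'"
  show "ext T (rt H' y f) = rt H' y (ext T f)"
  proof
    fix x
    show "ext T (rt H' y f) x = rt H' y (ext T f) x"
    proof (cases "x \<in> H'")
      case True
      have "rt H x (rt H' y f) = rt H (x \<otimes> y) f"
        using True y sub level_mult[OF H'] level_carrier[OF H']
        by (auto simp: right_translate_def fun_eq_iff m_assoc subset_iff)
      then show ?thesis
        using True y level_mult[OF H' True y]
        by (simp add: ext_apply f ind_rt_self[OF H'] rt_apply)
    next
      case False
      then show ?thesis using ind_rt_self[OF H' f y] by (simp add: ext_apply rt_apply)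
    qed
  qed
qed

lemma kern_ext: "kern (ext T) x v = (if x \<in> H then kern T x v else 0)"
proof (cases "x \<in> H'")
  case True
  have d: "delta \<one> v \<in> ind H'" by (rule delta_ind[OF H' level_one[OF H']])
  have *: "kern (ext T) x v = T (rt H x (delta \<one> v)) \<one>"
    using True by (simp add: kern_def ext_apply[OF d])
  show ?thesis
  proof (cases "x \<in> H")
    case xH: True
    then have "rt H x (delta \<one> v) = delta (inv x) v"
      using rt_delta[OF H level_one[OF H] xH] level_carrier[OF H xH] by simp
    then show ?thesis
      using * xH hecke_delta[OF H T level_inv[OF H xH] level_one[OF H]] level_carrier[OF H xH] by simp
  next
    case False
    have "h \<otimes> x \<notin> J" if "h \<in> H" for h
      using level_mult_cancel(1)[OF H that level_carrier[OF H' True]] False level_J[OF H] by blast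
    then have "rt H x (delta \<one> v) = (\<lambda>x. 0)"
      using level_carrier[OF H' True] level_carrier[OF H] by (auto simp: right_translate_def delta_def fun_eq_iff)
    then show ?thesis using * False hecke_0[OF H T] by simp
  qed
next
  case False
  then show ?thesis using kern_zero[OF H' ext_hecke] sub by auto
qed

end

lemma ext_compose:
  assumes T: "T \<in> carrier (HA H)" and S: "S \<in> carrier (HA H)"
  shows "ext (compose (ind H) T S) = compose (ind H') (ext T) (ext S)"
proof (rule extensionalityI[of _ "ind H'"])
  fix f assume f: "f \<in> ind H'"
  show "ext (compose (ind H) T S) f = compose (ind H') (ext T) (ext S) f"
  proof
    fix x show "ext (compose (ind H) T S) f x = compose (ind H') (ext T) (ext S) f x"
      using f rt_ext[OF S f] ind_rt_sub[OF f]
      by (simp add: compose_def ext_apply[OF f] ext_apply[OF ext_ind[OF S f]])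
  qed
qed (simp_all add: hecke_map_def)

text \<open>An operator whose kernel is supported on \<open>H\<close> maps \<open>ind H\<close>, a subspace of \<open>ind H'\<close>, to itself;
  its restriction is the preimage.\<close>

lemma ext_surj:
  assumes S: "S \<in> carrier (HA H')" and zero: "\<And>x v. x \<notin> H \<Longrightarrow> kern S x v = 0"
  shows "\<exists>T\<in>carrier (HA H). ext T = S"
proof -
  have S_zero: "S f x = 0" if f: "f \<in> ind H" and x: "x \<notin> H" for f x
    using H f
  proof (induction rule: ind_induct)
    case zero
    then show ?case using hecke_0[OF H' S] by simp
  next
    case (add z v g)
    have zH: "z \<in> H'" using add(1) sub by blast
    have "S (delta z v) x = 0"
    proof (cases "x \<in> H'")
      case True
      have "x \<otimes> inv z \<notin> H"
        using x level_mult_cancel(2)[OF H level_inv[OF H add(1)] level_carrier[OF H' True]] by simp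
      then show ?thesis using hecke_delta[OF H' S zH True] assms(2) by simp
    next
      case False
      then show ?thesis using ind_zero[OF hecke_ind[OF S delta_ind[OF H' zH]]] by simp
    qed
    then show ?case
      using add hecke_add[OF S delta_ind[OF H' zH] ind_mono[OF add(2)]] by simp
  qed
  define T where "T = restrict S (ind H)"
  have rt_eq: "rt H y f = rt H' y f" if f: "f \<in> ind H'" and y: "y \<in> H" and f0: "\<And>x. x \<notin> H \<Longrightarrow> f x = 0" for f y
  proof
    fix x show "rt H y f x = rt H' y f x"
      using level_mult_cancel(2)[OF H y] level_carrier[OF H'] f0[of "x \<otimes> y"] sub
      by (auto simp: right_translate_def)
  qed
  have T: "T \<in> carrier (HA H)"
  proof (rule heckeI)
    fix f assume f: "f \<in> ind H"
    show "T f \<in> ind H"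
    proof (rule indI[OF H])
      show "T f (j \<otimes> x) = \<rho> j (T f x)" if "j \<in> J" "x \<in> H" for j x
        using f that sub ind_equi[OF hecke_ind[OF S ind_mono[OF f]]] by (auto simp: T_def)
    qed (use f S_zero ind_finite[OF H' hecke_ind[OF S ind_mono[OF f]]] in \<open>simp_all add: T_def\<close>)
  next
    show "T \<in> extensional (ind H)" by (simp add: T_def)
  next
    fix y f assume y: "y \<in> H" and f: "f \<in> ind H"
    have "T (rt H y f) = S (rt H' y f)"
      using ind_rt_self[OF H f y] rt_eq[OF ind_mono[OF f] y] ind_zero[OF f] by (simp add: T_def)
    also have "\<dots> = rt H' y (S f)" using hecke_rt[OF S _ ind_mono[OF f]] y sub by blast
    also have "\<dots> = rt H y (T f)"
      using rt_eq[OF hecke_ind[OF S ind_mono[OF f]] y] S_zero[OF f] f by (simp add: T_def)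
    finally show "T (rt H y f) = rt H y (T f)" .
  qed (simp_all add: T_def ind_add[OF H] ind_scale[OF H] hecke_add[OF S] hecke_scale[OF S] ind_mono)
  have "ext T = S"
  proof (rule hecke_eqI[OF H' ext_hecke[OF T] S])
    fix x v
    show "kern (ext T) x v = kern S x v"
      using zero by (simp add: kern_ext[OF T]) (simp add: kern_def T_def delta_ind[OF H level_one[OF H]])
  qed
  then show ?thesis using T by blast
qed

text \<open>The subalgebras of a Hecke algebra that come from smaller groups are cut out by a condition on
  supports, which can be checked on kernels.\<close>

lemma ext_alg_iso:
  "ext \<in> alg_iso (HA H) ((HA H')\<lparr>carrier := {T \<in> carrier (HA H'). \<forall>x v. x \<notin> H \<longrightarrow> kern T x v = 0}\<rparr>)"
    (is "_ \<in> alg_iso _ ?B")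
proof -
  have "inj_on ext (carrier (HA H))"
  proof (rule inj_onI)
    fix T S assume T: "T \<in> carrier (HA H)" and S: "S \<in> carrier (HA H)" and eq: "ext T = ext S"
    show "T = S"
    proof (rule hecke_eqI[OF H T S])
      fix x v assume "x \<in> H"
      then show "kern T x v = kern S x v" using kern_ext[OF T, of x v] kern_ext[OF S, of x v] eq by simp
    qed
  qed
  moreover have "ext ` carrier (HA H) = carrier ?B"
  proof
    show "ext ` carrier (HA H) \<subseteq> carrier ?B" by (auto simp: ext_hecke kern_ext)
    show "carrier ?B \<subseteq> ext ` carrier (HA H)" using ext_surj by fastforce
  qed
  moreover have "ext \<in> ring_hom (HA H) ?B"
  proof (rule ring_hom_memI)
    fix T S assume T: "T \<in> carrier (HA H)" and S: "S \<in> carrier (HA H)"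
    show "ext (T \<otimes>\<^bsub>HA H\<^esub> S) = ext T \<otimes>\<^bsub>?B\<^esub> ext S" by (simp add: ext_compose[OF T S])
    show "ext (T \<oplus>\<^bsub>HA H\<^esub> S) = ext T \<oplus>\<^bsub>?B\<^esub> ext S"
      by (rule extensionalityI[of _ "ind H'"]) (simp_all add: ext_extensional ext_apply ind_rt_sub fun_eq_iff)
  next
    show "ext \<one>\<^bsub>HA H\<^esub> = \<one>\<^bsub>?B\<^esub>"
    proof (rule extensionalityI[of _ "ind H'"])
      fix f assume f: "f \<in> ind H'"
      show "ext \<one>\<^bsub>HA H\<^esub> f = \<one>\<^bsub>?B\<^esub> f"
      proof
        fix x show "ext \<one>\<^bsub>HA H\<^esub> f x = \<one>\<^bsub>?B\<^esub> f x"
          using f ind_zero[OF f, of x] level_one[OF H] level_carrier[OF H']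
          by (simp add: ext_apply[OF f] ind_rt_sub) (simp add: right_translate_def)
      qed
    qed (simp_all add: hecke_map_def)
  next
    fix T assume T: "T \<in> carrier (HA H)"
    then show "ext T \<in> carrier ?B" by (simp add: ext_hecke kern_ext)
  qed
  moreover have "ext (c \<odot>\<^bsub>HA H\<^esub> T) = c \<odot>\<^bsub>?B\<^esub> ext T" if "T \<in> carrier (HA H)" for c T
    by (rule extensionalityI[of _ "ind H'"]) (simp_all add: ext_extensional ext_apply ind_rt_sub fun_eq_iff)
  ultimately show ?thesis by (auto simp: alg_iso_def ring_iso_def bij_betw_def)
qed

end

end

section \<open>Intertwining operators and the commutator pairing\<close>

locale clifford_pair = hecke_pair G J s \<rho>
  for G :: "('g::topological_space, 'm) monoid_scheme" (structure)
    and J and s :: "complex \<Rightarrow> 'v::ab_group_add \<Rightarrow> 'v" and \<rho> +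
  fixes Jt :: "'g set"
  assumes Jt: "level Jt"
    and commutators: "\<And>x y. x \<in> Jt \<Longrightarrow> y \<in> Jt \<Longrightarrow> x \<otimes> y \<otimes> inv x \<otimes> inv y \<in> J"
begin

lemma Jt_carrier: "x \<in> Jt \<Longrightarrow> x \<in> carrier G"
  and Jt_one: "\<one> \<in> Jt"
  and Jt_mult: "x \<in> Jt \<Longrightarrow> y \<in> Jt \<Longrightarrow> x \<otimes> y \<in> Jt"
  and Jt_inv: "x \<in> Jt \<Longrightarrow> inv x \<in> Jt"
  and Jt_J: "x \<in> J \<Longrightarrow> x \<in> Jt"
  using level_carrier[OF Jt] level_one[OF Jt] level_mult[OF Jt] level_inv[OF Jt] level_J[OF Jt] by blast+

lemma J_conj:
  assumes g: "g \<in> Jt" and j: "j \<in> J" shows "g \<otimes> j \<otimes> inv g \<in> J"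
proof -
  have "g \<otimes> j \<otimes> inv g = (g \<otimes> j \<otimes> inv g \<otimes> inv j) \<otimes> j"
    using g j by (simp add: m_assoc Jt_carrier J_carrier)
  then show ?thesis using J_mult[OF commutators[OF g Jt_J[OF j]] j] by simp
qed

lemma J_conj_inv: "g \<in> Jt \<Longrightarrow> j \<in> J \<Longrightarrow> inv g \<otimes> j \<otimes> g \<in> J"
  using J_conj[OF Jt_inv, of g j] by (simp add: Jt_carrier)

text \<open>Equivalently, \<open>U\<close> is a homomorphism of representations of \<open>J\<close> from \<open>\<rho>\<close> to its conjugate by
  \<open>g\<^sup>-\<^sup>1\<close>.\<close>

definition twist :: "'g \<Rightarrow> ('v \<Rightarrow> 'v) \<Rightarrow> bool" where
  "twist g U \<longleftrightarrow> Vector_Spaces.linear s s U \<and> (\<forall>j\<in>J. \<forall>v. U (\<rho> j v) = \<rho> (g \<otimes> j \<otimes> inv g) (U v))"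

definition intertw :: "'g \<Rightarrow> ('v \<Rightarrow> 'v) \<Rightarrow> bool" where
  "intertw g U \<longleftrightarrow> twist g U \<and> bij U"

lemma endo_scale: "Vector_Spaces.linear s s U \<Longrightarrow> U (s c v) = s c (U v)"
  and endo_add: "Vector_Spaces.linear s s U \<Longrightarrow> U (v + w) = U v + U w"
proof -
  assume "Vector_Spaces.linear s s U"
  then interpret U: Vector_Spaces.linear s s U .
  show "U (s c v) = s c (U v)" "U (v + w) = U v + U w" by (simp_all add: U.scale U.add)
qed

lemma endo_zero: "Vector_Spaces.linear s s U \<Longrightarrow> U 0 = 0"
  using endo_scale[of U 0 0] by simp

lemma intertw_scale_apply: "intertw g U \<Longrightarrow> U (s c v) = s c (U v)"
  by (simp add: intertw_def twist_def endo_scale)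

lemma intertw_zero_iff: "intertw g U \<Longrightarrow> U v = 0 \<longleftrightarrow> v = 0"
  using endo_zero[of U] by (auto simp: intertw_def twist_def bij_def dest: injD[of U v 0])

lemma intertw_J_apply: "intertw g U \<Longrightarrow> j \<in> J \<Longrightarrow> U (\<rho> j v) = \<rho> (g \<otimes> j \<otimes> inv g) (U v)"
  by (simp add: intertw_def twist_def)

lemma twist_intertw:
  assumes g: "g \<in> Jt" and U: "twist g U" and v: "U v \<noteq> 0"
  shows "intertw g U"
proof -
  let ?\<tau> = "\<lambda>j. \<rho> (g \<otimes> j \<otimes> inv g)"
  have hom: "U \<in> rep_homs J s \<rho> s ?\<tau>" using U by (simp add: rep_homs_def twist_def)
  have "simple_action J s ?\<tau>"
    unfolding simple_action_def
  proof (intro allI impI; elim conjE)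
    fix W assume W: "vs.subspace W" and stable: "\<forall>j\<in>J. \<forall>w\<in>W. ?\<tau> j w \<in> W"
    show "W = {0} \<or> W = UNIV"
    proof (rule simple_actionD[OF simple_\<rho> W])
      fix j w assume j: "j \<in> J" and w: "w \<in> W"
      have "?\<tau> (inv g \<otimes> j \<otimes> g) w \<in> W" using stable J_conj_inv[OF g j] w by blast
      moreover have "g \<otimes> (inv g \<otimes> j \<otimes> g) \<otimes> inv g = j"
        using g j by (simp add: m_assoc Jt_carrier J_carrier)
      ultimately show "\<rho> j w \<in> W" by simp
    qed
  qed
  then have "surj U" by (rule simple_hom_surj[OF _ hom v])
  moreover have "inj U"
    by (rule simple_hom_inj[OF simple_\<rho> hom v]) (simp add: \<rho>_zero J_conj[OF g])
  ultimately show ?thesis using U by (simp add: intertw_def bij_def)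
qed

lemma twist_compose:
  assumes g: "g \<in> Jt" and h: "h \<in> Jt" and U: "twist g U" and V: "twist h V"
  shows "twist (g \<otimes> h) (\<lambda>v. U (V v))"
  unfolding twist_def
proof (intro conjI ballI allI)
  show "Vector_Spaces.linear s s (\<lambda>v. U (V v))"
    using Vector_Spaces.linear_compose[of s s V s U] U V by (simp add: twist_def comp_def)
  fix j v assume j: "j \<in> J"
  have "(g \<otimes> h) \<otimes> j \<otimes> inv (g \<otimes> h) = g \<otimes> (h \<otimes> j \<otimes> inv h) \<otimes> inv g"
    using g h j by (simp add: m_assoc inv_mult_group Jt_carrier J_carrier)
  then show "U (V (\<rho> j v)) = \<rho> ((g \<otimes> h) \<otimes> j \<otimes> inv (g \<otimes> h)) (U (V v))"
    using U V j J_conj[OF h j] by (simp add: twist_def)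
qed

lemma intertw_compose:
  assumes "g \<in> Jt" "h \<in> Jt" "intertw g U" "intertw h V"
  shows "intertw (g \<otimes> h) (\<lambda>v. U (V v))"
  using twist_compose[of g h U V] assms bij_comp[of V U] by (simp add: intertw_def comp_def)

lemma intertw_inv:
  assumes g: "g \<in> Jt" and U: "intertw g U"
  shows "intertw (inv g) (inv_into UNIV U)"
proof -
  let ?V = "inv_into UNIV U"
  have bij: "bij U" using U by (simp add: intertw_def)
  have UV: "U (?V v) = v" "?V (U v) = v" for v
    using bij by (simp_all add: bij_def surj_f_inv_f inv_f_f)
  have add: "U (v + w) = U v + U w" and scale: "U (s c v) = s c (U v)" for v w c
    using U by (simp_all add: intertw_def twist_def endo_add endo_scale)
  have "Vector_Spaces.linear s s ?V"
  proof unfold_locales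
    show "?V (v + w) = ?V v + ?V w" for v w
      using add[of "?V v" "?V w"] UV by metis
    show "?V (s c v) = s c (?V v)" for c v
      using scale[of c "?V v"] UV by metis
  qed
  moreover have "?V (\<rho> j v) = \<rho> (inv g \<otimes> j \<otimes> inv (inv g)) (?V v)" if j: "j \<in> J" for j v
  proof -
    have "g \<otimes> (inv g \<otimes> j \<otimes> g) \<otimes> inv g = j"
      using g j by (simp add: m_assoc Jt_carrier J_carrier)
    then have "U (\<rho> (inv g \<otimes> j \<otimes> g) (?V v)) = \<rho> j v"
      using intertw_J_apply[OF U J_conj_inv[OF g j]] UV by simp
    then show ?thesis using g UV(2) by (metis inv_inv Jt_carrier)
  qed
  ultimately show ?thesis using bij by (simp add: intertw_def twist_def bij_imp_bij_inv)
qed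

lemma intertw_J: "j \<in> J \<Longrightarrow> intertw j (\<rho> j)"
proof -
  assume j: "j \<in> J"
  have "\<rho> j (\<rho> k v) = \<rho> (j \<otimes> k \<otimes> inv j) (\<rho> j v)" if "k \<in> J" for k v
    using j that by (simp add: J_mult J_inv J_carrier m_assoc flip: \<rho>_mult)
  moreover have "bij (\<rho> j)"
    by (rule bij_betw_byWitness[where f' = "\<rho> (inv j)"]) (auto simp: \<rho>_inv[OF j])
  ultimately show ?thesis using \<rho>_linear[OF j] by (simp add: intertw_def twist_def)
qed

lemma twist_unique:
  assumes g: "g \<in> Jt" and U: "intertw g U" and V: "twist g V"
  shows "\<exists>c. \<forall>v. V v = s c (U v)"
proof -
  let ?W = "inv_into UNIV U"
  have W: "twist (inv g) ?W" using intertw_inv[OF g U] by (simp add: intertw_def)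
  have "twist (inv g \<otimes> g) (\<lambda>v. ?W (V v))" by (rule twist_compose[OF Jt_inv[OF g] g W V])
  then have "(\<lambda>v. ?W (V v)) \<in> rep_homs J s \<rho> s \<rho>"
    using g by (simp add: rep_homs_def twist_def Jt_carrier J_carrier)
  then obtain c where c: "\<forall>v. ?W (V v) = s c v" using schur[OF J \<rho>] by blast
  have "V v = s c (U v)" for v
  proof -
    have "V v = U (?W (V v))" using U by (simp add: intertw_def bij_def surj_f_inv_f)
    then show ?thesis using c intertw_scale_apply[OF U] by simp
  qed
  then show ?thesis by blast
qed

lemma intertw_scale: "c \<noteq> 0 \<Longrightarrow> intertw g U \<Longrightarrow> g \<in> Jt \<Longrightarrow> intertw g (\<lambda>v. s c (U v))"
proof -
  assume c: "c \<noteq> 0" and U: "intertw g U" and g: "g \<in> Jt"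
  interpret U: Vector_Spaces.linear s s U using U by (simp add: intertw_def twist_def)
  have "twist g (\<lambda>v. s c (U v))"
    unfolding twist_def
  proof (intro conjI ballI allI)
    show "Vector_Spaces.linear s s (\<lambda>v. s c (U v))"
      by unfold_locales (simp_all add: U.add U.scale vs.scale_right_distrib mult.commute)
    show "s c (U (\<rho> j v)) = \<rho> (g \<otimes> j \<otimes> inv g) (s c (U v))" if "j \<in> J" for j v
      using that by (simp add: intertw_J_apply[OF U] \<rho>_scale J_conj[OF g])
  qed
  moreover obtain v :: 'v where "v \<noteq> 0" using nontrivial by blast
  ultimately show ?thesis
    using twist_intertw[OF g, of "\<lambda>v. s c (U v)" v] c intertw_zero_iff[OF U, of v] by simp
qed

text \<open>The inertia group of \<open>\<rho>\<close> in \<open>Jt\<close>.\<close>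

definition stab :: "'g set" where
  "stab = {g \<in> Jt. \<exists>U. intertw g U}"

lemma stab_Jt: "g \<in> stab \<Longrightarrow> g \<in> Jt"
  by (simp add: stab_def)

lemma stab_carrier: "g \<in> stab \<Longrightarrow> g \<in> carrier G"
  by (simp add: stab_Jt Jt_carrier)

lemma stab_intertw: "g \<in> stab \<Longrightarrow> \<exists>U. intertw g U"
  by (simp add: stab_def)

lemma level_stab: "level stab"
  unfolding level_def
proof
  show "J \<subseteq> stab" using intertw_J Jt_J by (auto simp: stab_def)
  show "subgroup stab G"
  proof (rule subgroupI)
    show "stab \<subseteq> carrier G" using stab_carrier by blast
    show "stab \<noteq> {}" using \<open>J \<subseteq> stab\<close> J_one by blast
    show "inv g \<in> stab" if "g \<in> stab" for g
      using that intertw_inv[of g] Jt_inv by (auto simp: stab_def)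
    show "g \<otimes> h \<in> stab" if "g \<in> stab" "h \<in> stab" for g h
      using that intertw_compose[of g h] Jt_mult by (auto simp: stab_def)
  qed
qed

lemmas stab_one = level_one[OF level_stab]
  and stab_mult = level_mult[OF level_stab]
  and stab_inv = level_inv[OF level_stab]
  and stab_J = level_J[OF level_stab]

text \<open>An element \<open>g\<close> of \<open>Jt\<close> normalizes \<open>J\<close>, so it intertwines \<open>\<rho>\<close> exactly if there is a nonzero
  homomorphism between the irreducible representations \<open>\<rho>\<close> and \<open>\<rho>\<^sup>g\<close> of \<open>J\<close>.\<close>

lemma intertwining_eq_stab:
  assumes "intertwining G J s \<rho> \<subseteq> Jt"
  shows "intertwining G J s \<rho> = stab"
proof -
  have iff: "g \<in> intertwining G J s \<rho> \<longleftrightarrow> g \<in> stab" if g: "g \<in> Jt" for g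
  proof -
    have conj: "conj_set G J g = J"
    proof
      show "conj_set G J g \<subseteq> J" using J_conj[OF g] by (auto simp: conj_set_def)
      show "J \<subseteq> conj_set G J g"
      proof
        fix j assume j: "j \<in> J"
        have "j = g \<otimes> (inv g \<otimes> j \<otimes> g) \<otimes> inv g"
          using g j by (simp add: m_assoc Jt_carrier J_carrier)
        then show "j \<in> conj_set G J g" using J_conj_inv[OF g j] by (auto simp: conj_set_def)
      qed
    qed
    have homs: "\<phi> \<in> rep_homs (J \<inter> conj_set G J g) s \<rho> s (conj_rep G \<rho> g) \<longleftrightarrow> twist (inv g) \<phi>" for \<phi>
      using g by (simp add: conj rep_homs_def conj_rep_def twist_def Jt_carrier)
    have "(\<exists>\<phi>. twist (inv g) \<phi> \<and> \<phi> \<noteq> (\<lambda>v. 0)) \<longleftrightarrow> inv g \<in> stab"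
    proof
      assume "\<exists>\<phi>. twist (inv g) \<phi> \<and> \<phi> \<noteq> (\<lambda>v. 0)"
      then obtain \<phi> v where "twist (inv g) \<phi>" "\<phi> v \<noteq> 0" by blast
      then show "inv g \<in> stab" using twist_intertw[OF Jt_inv[OF g]] Jt_inv[OF g] by (auto simp: stab_def)
    next
      assume "inv g \<in> stab"
      then obtain U where U: "intertw (inv g) U" using stab_intertw by blast
      obtain v :: 'v where "v \<noteq> 0" using nontrivial by blast
      then have "U v \<noteq> 0" using intertw_zero_iff[OF U] by simp
      then show "\<exists>\<phi>. twist (inv g) \<phi> \<and> \<phi> \<noteq> (\<lambda>v. 0)" using U by (auto simp: intertw_def)
    qed
    moreover have "inv g \<in> stab \<longleftrightarrow> g \<in> stab" using stab_inv[of g] stab_inv[of "inv g"] Jt_carrier[OF g] by auto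
    ultimately show ?thesis using g homs by (simp add: intertwining_def Jt_carrier) blast
  qed
  show ?thesis
  proof
    show "intertwining G J s \<rho> \<subseteq> stab" using iff assms by blast
    show "stab \<subseteq> intertwining G J s \<rho>" using iff stab_Jt by blast
  qed
qed

subsection \<open>The commutator pairing\<close>

text \<open>The pairs \<open>(g, U)\<close> with \<open>U\<close> intertwining, modulo the pairs \<open>(j, \<rho> j)\<close>, form a central extension
  of \<open>stab/J\<close> by the nonzero scalars.  As \<open>stab/J\<close> is abelian, commutators in this extension are
  scalars, and \<open>\<beta> g h\<close> is the commutator of any lifts of \<open>g\<close> and \<open>h\<close>.\<close>

definition comm_rel :: "'g \<Rightarrow> 'g \<Rightarrow> complex \<Rightarrow> ('v \<Rightarrow> 'v) \<Rightarrow> ('v \<Rightarrow> 'v) \<Rightarrow> bool" where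
  "comm_rel g h c U V \<longleftrightarrow> (\<forall>v. U (V v) = s c (\<rho> (g \<otimes> h \<otimes> inv g \<otimes> inv h) (V (U v))))"

definition \<beta> :: "'g \<Rightarrow> 'g \<Rightarrow> complex" where
  "\<beta> g h = (SOME c. \<forall>U V. intertw g U \<longrightarrow> intertw h V \<longrightarrow> comm_rel g h c U V)"

text \<open>Both sides of the relation intertwine along \<open>g h\<close>, so Schur's lemma provides the scalar.  It is the
  same for all choices because \<open>U\<close> and \<open>V\<close> are themselves unique up to scalars.\<close>

lemma comm_rel_\<beta>:
  assumes g: "g \<in> stab" and h: "h \<in> stab" and U: "intertw g U" and V: "intertw h V"
  shows "comm_rel g h (\<beta> g h) U V"
proof -
  let ?k = "g \<otimes> h \<otimes> inv g \<otimes> inv h"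
  have Jt: "g \<in> Jt" "h \<in> Jt" using g h stab_Jt by auto
  have k: "?k \<in> J" by (rule commutators[OF Jt])
  have gh: "?k \<otimes> (h \<otimes> g) = g \<otimes> h" using Jt by (simp add: m_assoc Jt_carrier)
  have "intertw (?k \<otimes> (h \<otimes> g)) (\<lambda>v. \<rho> ?k (V (U v)))"
    by (rule intertw_compose[OF Jt_J[OF k] Jt_mult[OF Jt(2,1)] intertw_J[OF k]
          intertw_compose[OF Jt(2,1) V U]])
  then have W: "intertw (g \<otimes> h) (\<lambda>v. \<rho> ?k (V (U v)))" by (simp only: gh)
  have "twist (g \<otimes> h) (\<lambda>v. U (V v))"
    using intertw_compose[OF Jt U V] by (simp add: intertw_def)
  from twist_unique[OF Jt_mult[OF Jt] W this]
  obtain c where c: "comm_rel g h c U V" by (auto simp: comm_rel_def)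
  have "comm_rel g h c U' V'" if U': "intertw g U'" and V': "intertw h V'" for U' V'
  proof -
    obtain a where a: "\<forall>v. U' v = s a (U v)"
      using twist_unique[OF Jt(1) U] U' by (auto simp: intertw_def)
    obtain b where b: "\<forall>v. V' v = s b (V v)"
      using twist_unique[OF Jt(2) V] V' by (auto simp: intertw_def)
    show ?thesis
      using c by (simp add: comm_rel_def a b intertw_scale_apply[OF U] intertw_scale_apply[OF V]
          \<rho>_scale[OF k] mult_ac)
  qed
  then have "\<exists>c. \<forall>U V. intertw g U \<longrightarrow> intertw h V \<longrightarrow> comm_rel g h c U V" by blast
  then have "\<forall>U V. intertw g U \<longrightarrow> intertw h V \<longrightarrow> comm_rel g h (\<beta> g h) U V"
    unfolding \<beta>_def by (rule someI_ex)
  then show ?thesis using U V by blast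
qed

lemma \<beta>_unique:
  assumes g: "g \<in> stab" and h: "h \<in> stab" and U: "intertw g U" and V: "intertw h V"
    and c: "comm_rel g h c U V"
  shows "\<beta> g h = c"
proof -
  obtain v :: 'v where v: "v \<noteq> 0" using nontrivial by blast
  let ?k = "g \<otimes> h \<otimes> inv g \<otimes> inv h"
  have k: "?k \<in> J" by (rule commutators) (use g h stab_Jt in auto)
  have "V (U v) \<noteq> 0" using v intertw_zero_iff[OF U] intertw_zero_iff[OF V] by simp
  then have "\<rho> ?k (V (U v)) \<noteq> 0" using intertw_zero_iff[OF intertw_J[OF k]] by simp
  moreover have "U (V v) = s c (\<rho> ?k (V (U v)))"
    using c unfolding comm_rel_def by (rule spec)
  moreover have "U (V v) = s (\<beta> g h) (\<rho> ?k (V (U v)))"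
    using comm_rel_\<beta>[OF g h U V] unfolding comm_rel_def by (rule spec)
  ultimately show ?thesis by (simp only: vs.scale_cancel_right) simp
qed

lemma \<beta>_mult_left:
  assumes g: "g \<in> stab" and g': "g' \<in> stab" and h: "h \<in> stab"
  shows "\<beta> (g \<otimes> g') h = \<beta> g h * \<beta> g' h"
proof -
  obtain U where U: "intertw g U" using stab_intertw[OF g] by (rule exE)
  obtain U' where U': "intertw g' U'" using stab_intertw[OF g'] by (rule exE)
  obtain V where V: "intertw h V" using stab_intertw[OF h] by (rule exE)
  have Jt: "g \<in> Jt" "g' \<in> Jt" "h \<in> Jt" using g g' h stab_Jt by auto
  have G: "g \<in> carrier G" "g' \<in> carrier G" "h \<in> carrier G" using Jt Jt_carrier by auto
  let ?k = "g \<otimes> h \<otimes> inv g \<otimes> inv h" and ?k' = "g' \<otimes> h \<otimes> inv g' \<otimes> inv h"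
  have k: "?k \<in> J" "?k' \<in> J" using commutators Jt by auto
  have K: "(g \<otimes> g') \<otimes> h \<otimes> inv (g \<otimes> g') \<otimes> inv h = (g \<otimes> ?k' \<otimes> inv g) \<otimes> ?k"
    using G by (simp add: m_assoc inv_mult_group)
  have "comm_rel (g \<otimes> g') h (\<beta> g h * \<beta> g' h) (\<lambda>v. U (U' v)) V"
    unfolding comm_rel_def K
  proof
    fix v
    have "U (U' (V v)) = U (s (\<beta> g' h) (\<rho> ?k' (V (U' v))))"
      using comm_rel_\<beta>[OF g' h U' V] by (simp add: comm_rel_def)
    also have "\<dots> = s (\<beta> g' h) (\<rho> (g \<otimes> ?k' \<otimes> inv g) (U (V (U' v))))"
      by (simp only: intertw_scale_apply[OF U] intertw_J_apply[OF U k(2)])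
    also have "U (V (U' v)) = s (\<beta> g h) (\<rho> ?k (V (U (U' v))))"
      using comm_rel_\<beta>[OF g h U V] by (simp add: comm_rel_def)
    finally show "U (U' (V v)) = s (\<beta> g h * \<beta> g' h) (\<rho> (g \<otimes> ?k' \<otimes> inv g \<otimes> ?k) (V (U (U' v))))"
      by (simp add: \<rho>_scale \<rho>_mult J_conj[OF Jt(1) k(2)] k mult.commute)
  qed
  then show ?thesis
    by (rule \<beta>_unique[OF stab_mult[OF g g'] h intertw_compose[OF Jt(1,2) U U'] V])
qed

lemma \<beta>_J:
  assumes j: "j \<in> J" and h: "h \<in> stab" shows "\<beta> j h = 1"
proof -
  obtain V where V: "intertw h V" using h stab_intertw by blast
  have hJ: "h \<in> Jt" by (rule stab_Jt[OF h])
  have "comm_rel j h 1 (\<rho> j) V"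
    unfolding comm_rel_def
  proof
    fix v
    have k: "j \<otimes> h \<otimes> inv j \<otimes> inv h \<in> J" by (rule commutators[OF Jt_J[OF j] hJ])
    have "(j \<otimes> h \<otimes> inv j \<otimes> inv h) \<otimes> (h \<otimes> j \<otimes> inv h) = j"
      using j hJ by (simp add: m_assoc J_carrier Jt_carrier)
    then have "\<rho> j (V v) = \<rho> (j \<otimes> h \<otimes> inv j \<otimes> inv h) (\<rho> (h \<otimes> j \<otimes> inv h) (V v))"
      using \<rho>_mult[OF k J_conj[OF hJ j], of "V v"] by simp
    then show "\<rho> j (V v) = s 1 (\<rho> (j \<otimes> h \<otimes> inv j \<otimes> inv h) (V (\<rho> j v)))"
      by (simp add: intertw_J_apply[OF V j])
  qed
  then show ?thesis by (rule \<beta>_unique[OF stab_J[OF j] h intertw_J[OF j] V])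
qed

lemma \<beta>_one: "h \<in> stab \<Longrightarrow> \<beta> \<one> h = 1"
  by (rule \<beta>_J[OF J_one])

lemma \<beta>_nonzero: "g \<in> stab \<Longrightarrow> h \<in> stab \<Longrightarrow> \<beta> g h \<noteq> 0"
  using \<beta>_mult_left[of g "inv g" h] \<beta>_one[of h] stab_inv[of g] stab_carrier[of g] by auto

lemma \<beta>_sym:
  assumes g: "g \<in> stab" and h: "h \<in> stab" shows "\<beta> h g * \<beta> g h = 1"
proof -
  obtain U where U: "intertw g U" using stab_intertw[OF g] by (rule exE)
  obtain V where V: "intertw h V" using stab_intertw[OF h] by (rule exE)
  have Jt: "g \<in> Jt" "h \<in> Jt" using g h stab_Jt by auto
  let ?k = "g \<otimes> h \<otimes> inv g \<otimes> inv h"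
  have k: "?k \<in> J" by (rule commutators[OF Jt])
  have k': "h \<otimes> g \<otimes> inv h \<otimes> inv g = inv ?k"
    using Jt by (simp add: m_assoc inv_mult_group Jt_carrier)
  have nz: "\<beta> g h \<noteq> 0" by (rule \<beta>_nonzero[OF g h])
  have "comm_rel h g (inverse (\<beta> g h)) V U"
    unfolding comm_rel_def k'
  proof
    fix v
    have "U (V v) = s (\<beta> g h) (\<rho> ?k (V (U v)))"
      using comm_rel_\<beta>[OF g h U V] by (simp add: comm_rel_def)
    then show "V (U v) = s (inverse (\<beta> g h)) (\<rho> (inv ?k) (U (V v)))"
      using nz by (simp add: \<rho>_scale J_inv[OF k] \<rho>_inv[OF k])
  qed
  then have "\<beta> h g = inverse (\<beta> g h)" by (rule \<beta>_unique[OF h g V U])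
  then show ?thesis using nz by simp
qed

text \<open>The radical of the pairing \<open>\<beta>\<close>.\<close>

definition rad :: "'g set" where
  "rad = {g \<in> stab. \<forall>h\<in>stab. \<beta> g h = 1}"

lemma rad_stab: "g \<in> rad \<Longrightarrow> g \<in> stab"
  by (simp add: rad_def)

lemma level_rad: "level rad"
  unfolding level_def
proof
  show "J \<subseteq> rad" using stab_J \<beta>_J by (auto simp: rad_def)
  show "subgroup rad G"
  proof (rule subgroupI)
    show "rad \<subseteq> carrier G" using rad_stab stab_carrier by blast
    show "rad \<noteq> {}" using \<open>J \<subseteq> rad\<close> J_one by blast
    show "g \<otimes> h \<in> rad" if "g \<in> rad" "h \<in> rad" for g h
      using that by (simp add: rad_def stab_mult \<beta>_mult_left)
    show "inv g \<in> rad" if g: "g \<in> rad" for g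
    proof -
      have "\<beta> (inv g) h = 1" if h: "h \<in> stab" for h
        using \<beta>_mult_left[OF rad_stab[OF g] stab_inv[OF rad_stab[OF g]] h] h g \<beta>_one[OF h]
          stab_carrier[OF rad_stab[OF g]] by (simp add: rad_def)
      then show ?thesis using g by (simp add: rad_def stab_inv)
    qed
  qed
qed

section \<open>The center of the Hecke algebra\<close>

subsection \<open>Operators supported on one coset\<close>

text \<open>These operators generate the Hecke algebra linearly.  Left translation by \<open>g\<close> alone does not
  preserve equivariance under \<open>J\<close>; composition with \<open>U\<close> corrects this.\<close>

definition coset_op :: "'g set \<Rightarrow> 'g \<Rightarrow> ('v \<Rightarrow> 'v) \<Rightarrow> ('g \<Rightarrow> 'v) \<Rightarrow> 'g \<Rightarrow> 'v" where
  "coset_op H g U = (\<lambda>f\<in>ind H. \<lambda>x. if x \<in> H then U (f (inv g \<otimes> x)) else 0)"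

lemma coset_op_hecke:
  assumes H: "level H" and gH: "g \<in> H" and g: "g \<in> Jt" and U: "intertw g U"
  shows "coset_op H g U \<in> carrier (HA H)"
proof (rule heckeI)
  have gG: "g \<in> carrier G" by (rule Jt_carrier[OF g])
  note HG = level_carrier[OF H]
  interpret U: Vector_Spaces.linear s s U using U by (simp add: intertw_def twist_def)
  have giH: "inv g \<otimes> x \<in> H" if "x \<in> H" for x using level_mult[OF H level_inv[OF H gH] that] .
  {
    fix f assume f: "f \<in> ind H"
    let ?F = "\<lambda>x. if x \<in> H then U (f (inv g \<otimes> x)) else 0"
    have "?F \<in> ind H"
    proof (rule indI[OF H])
      fix j x assume j: "j \<in> J" and x: "x \<in> H"
      have "inv g \<otimes> (j \<otimes> x) = (inv g \<otimes> j \<otimes> g) \<otimes> (inv g \<otimes> x)"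
        using j HG[OF x] gG by (simp add: m_assoc J_carrier)
      then have "U (f (inv g \<otimes> (j \<otimes> x))) = U (\<rho> (inv g \<otimes> j \<otimes> g) (f (inv g \<otimes> x)))"
        using ind_equi[OF f J_conj_inv[OF g j] giH[OF x]] by simp
      also have "\<dots> = \<rho> (g \<otimes> (inv g \<otimes> j \<otimes> g) \<otimes> inv g) (U (f (inv g \<otimes> x)))"
        by (rule intertw_J_apply[OF U J_conj_inv[OF g j]])
      also have "g \<otimes> (inv g \<otimes> j \<otimes> g) \<otimes> inv g = j" using j gG by (simp add: m_assoc J_carrier)
      finally show "?F (j \<otimes> x) = \<rho> j (?F x)"
        using x level_mult[OF H level_J[OF H j] x] by simp
    next
      have "coset_support ?F \<subseteq> (\<lambda>C. (\<lambda>z. g \<otimes> z) ` C) ` coset_support f"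
      proof
        fix C assume "C \<in> coset_support ?F"
        then obtain x where x: "C = J #> x" "?F x \<noteq> 0" by (auto simp: coset_support_def)
        then have xH: "x \<in> H" by (auto split: if_splits)
        then have fx: "f (inv g \<otimes> x) \<noteq> 0" using x(2) by auto
        have xG: "x \<in> carrier G" by (rule HG[OF xH])
        have "C = (\<lambda>z. g \<otimes> z) ` (J #> (inv g \<otimes> x))"
        proof
          show "C \<subseteq> (\<lambda>z. g \<otimes> z) ` (J #> (inv g \<otimes> x))"
          proof
            fix y assume "y \<in> C"
            then obtain j where j: "j \<in> J" "y = j \<otimes> x" using x(1) by (auto simp: r_coset_def)
            then have "y = g \<otimes> ((inv g \<otimes> j \<otimes> g) \<otimes> (inv g \<otimes> x))"
              using xG gG by (simp add: m_assoc J_carrier)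
            moreover have "(inv g \<otimes> j \<otimes> g) \<otimes> (inv g \<otimes> x) \<in> J #> (inv g \<otimes> x)"
              using J_conj_inv[OF g j(1)] by (auto simp: r_coset_def)
            ultimately show "y \<in> (\<lambda>z. g \<otimes> z) ` (J #> (inv g \<otimes> x))" by blast
          qed
          show "(\<lambda>z. g \<otimes> z) ` (J #> (inv g \<otimes> x)) \<subseteq> C"
          proof clarify
            fix z assume "z \<in> J #> (inv g \<otimes> x)"
            then obtain j where j: "j \<in> J" "z = j \<otimes> (inv g \<otimes> x)" by (auto simp: r_coset_def)
            then have "g \<otimes> z = (g \<otimes> j \<otimes> inv g) \<otimes> x" using xG gG by (simp add: m_assoc J_carrier)
            then show "g \<otimes> z \<in> C" using J_conj[OF g j(1)] x(1) by (auto simp: r_coset_def)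
          qed
        qed
        moreover have "J #> (inv g \<otimes> x) \<in> coset_support f" using fx by (auto simp: coset_support_def)
        ultimately show "C \<in> (\<lambda>C. (\<lambda>z. g \<otimes> z) ` C) ` coset_support f" by blast
      qed
      then show "finite (coset_support ?F)"
        using ind_finite[OF H f] by (meson finite_imageI finite_subset)
    qed simp
    then show "coset_op H g U f \<in> ind H" using f by (simp add: coset_op_def)
  }
  show "coset_op H g U \<in> extensional (ind H)" by (simp add: coset_op_def)
  show "coset_op H g U (\<lambda>x. f x + f' x) = (\<lambda>x. coset_op H g U f x + coset_op H g U f' x)"
    if "f \<in> ind H" "f' \<in> ind H" for f f'
    using that by (simp add: coset_op_def ind_add[OF H] fun_eq_iff U.add)
  show "coset_op H g U (\<lambda>x. s c (f x)) = (\<lambda>x. s c (coset_op H g U f x))" if "f \<in> ind H" for c f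
    using that by (simp add: coset_op_def ind_scale[OF H] fun_eq_iff U.scale)
  show "coset_op H g U (rt H y f) = rt H y (coset_op H g U f)" if "y \<in> H" "f \<in> ind H" for y f
    using that by (simp add: coset_op_def ind_rt_self[OF H] fun_eq_iff rt_apply giH level_mult[OF H]
        m_assoc HG gG)
qed

lemma coset_op_delta:
  assumes H: "level H" and gH: "g \<in> H" and g: "g \<in> Jt" and U: "intertw g U"
  shows "coset_op H g U (delta \<one> v) = delta g (U v)"
proof
  fix x
  have gG: "g \<in> carrier G" by (rule Jt_carrier[OF g])
  show "coset_op H g U (delta \<one> v) x = delta g (U v) x"
  proof (cases "x \<in> H")
    case True
    have xG: "x \<in> carrier G" by (rule level_carrier[OF H True])
    have conj: "x \<otimes> inv g = g \<otimes> (inv g \<otimes> x) \<otimes> inv g" "inv g \<otimes> x = inv g \<otimes> (x \<otimes> inv g) \<otimes> g"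
      using xG gG by (simp_all add: m_assoc)
    then have iff: "inv g \<otimes> x \<in> J \<longleftrightarrow> x \<otimes> inv g \<in> J"
      using J_conj[OF g] J_conj_inv[OF g] by metis
    have "coset_op H g U (delta \<one> v) x = U (delta \<one> v (inv g \<otimes> x))"
      using True by (simp add: coset_op_def delta_ind[OF H level_one[OF H]])
    also have "\<dots> = delta g (U v) x"
    proof (cases "inv g \<otimes> x \<in> J")
      case True
      then have "U (\<rho> (inv g \<otimes> x) v) = \<rho> (x \<otimes> inv g) (U v)"
        using intertw_J_apply[OF U True] conj(1) by simp
      then show ?thesis using True iff xG gG by (simp add: delta_def)
    next
      case False
      then show ?thesis using iff xG gG intertw_zero_iff[OF U, of 0] by (simp add: delta_def)
    qed
    finally show ?thesis .
  next
    case False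
    then show ?thesis
      using ind_zero[OF delta_ind[OF H gH] False] by (simp add: coset_op_def delta_ind[OF H level_one[OF H]])
  qed
qed

lemma kern_coset_op:
  assumes "level H" "g \<in> H" "g \<in> Jt" "intertw g U"
  shows "kern (coset_op H g U) x v = delta g (U v) x"
  unfolding kern_def by (simp only: coset_op_delta[OF assms])

lemma kern_twist:
  assumes H: "level H" and T: "T \<in> carrier (HA H)" and x: "x \<in> H" "x \<in> Jt"
  shows "twist x (kern T x)"
  unfolding twist_def
proof (intro conjI ballI allI)
  show "Vector_Spaces.linear s s (kern T x)" by (rule kern_linear[OF H T])
  fix j v assume j: "j \<in> J"
  have "x \<otimes> j = (x \<otimes> j \<otimes> inv x) \<otimes> x" using x j by (simp add: m_assoc Jt_carrier J_carrier)
  then show "kern T x (\<rho> j v) = \<rho> (x \<otimes> j \<otimes> inv x) (kern T x v)"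
    using kern_right[OF H T j x(1), of v] kern_left[OF H T J_conj[OF x(2) j] x(1), of v] by simp
qed

lemma kern_intertw:
  assumes "level H" "T \<in> carrier (HA H)" "x \<in> H" "x \<in> Jt" "kern T x v \<noteq> 0"
  shows "intertw x (kern T x)" "x \<in> stab"
proof -
  show "intertw x (kern T x)" by (rule twist_intertw[OF assms(4) kern_twist[OF assms(1-4)] assms(5)])
  then show "x \<in> stab" using assms(4) by (auto simp: stab_def)
qed

text \<open>By equivariance under \<open>J\<close> on both sides, \<open>kern T x\<close> intertwines \<open>\<rho>\<close> and its conjugate by
  \<open>x\<^sup>-\<^sup>1\<close> on the intersection of their groups.\<close>

lemma kern_support:
  assumes I: "intertwining G J s \<rho> \<subseteq> Jt" and T: "T \<in> carrier (HA (carrier G))" and x: "x \<notin> stab"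
  shows "kern T x v = 0"
proof (rule ccontr)
  assume nz: "kern T x v \<noteq> 0"
  have GL: "level (carrier G)" using J by (simp add: level_def subgroup_self subgroup.subset)
  have xG: "x \<in> carrier G" using kern_zero[OF GL T] nz by blast
  have "kern T x \<in> rep_homs (J \<inter> conj_set G J (inv x)) s \<rho> s (conj_rep G \<rho> (inv x))"
    unfolding rep_homs_def
  proof (intro CollectI conjI ballI allI)
    show "Vector_Spaces.linear s s (kern T x)" by (rule kern_linear[OF GL T])
    fix y v assume y: "y \<in> J \<inter> conj_set G J (inv x)"
    then obtain j where j: "j \<in> J" "y = inv x \<otimes> j \<otimes> x" using xG by (auto simp: conj_set_def)
    then have xy: "x \<otimes> y = j \<otimes> x" "x \<otimes> y \<otimes> inv x = j" using xG by (simp_all add: m_assoc J_carrier)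
    have "kern T x (\<rho> y v) = kern T (x \<otimes> y) v" using kern_right[OF GL T _ xG, of y v] y by simp
    also have "\<dots> = \<rho> j (kern T x v)" using kern_left[OF GL T j(1) xG] xy by simp
    finally show "kern T x (\<rho> y v) = conj_rep G \<rho> (inv x) y (kern T x v)"
      using xG xy by (simp add: conj_rep_def)
  qed
  moreover have "kern T x \<noteq> (\<lambda>v. 0)" using nz by auto
  ultimately have "inv x \<in> intertwining G J s \<rho>" using xG by (auto simp: intertwining_def)
  then have "inv x \<in> stab" using intertwining_eq_stab[OF I] by simp
  then show False using stab_inv[of "inv x"] x xG by simp
qed

text \<open>A nonzero value \<open>kern S g\<close> is itself an intertwining operator, and subtracting
  \<open>coset_op H g (kern S g)\<close> removes its coset from the support.  Such values are bijective, so the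
  support of \<open>S\<close> can be read off from one fixed nonzero vector \<open>w\<close>.\<close>

lemma hecke_induct [consumes 3, case_names zero add]:
  assumes H: "level H" and HJ: "H \<subseteq> Jt" and S: "S \<in> carrier (HA H)"
    and zero: "P (\<lambda>f\<in>ind H. \<lambda>x. 0)"
    and add: "\<And>g U S. g \<in> H \<Longrightarrow> g \<in> stab \<Longrightarrow> intertw g U \<Longrightarrow> S \<in> carrier (HA H) \<Longrightarrow> P S \<Longrightarrow>
      P (\<lambda>f\<in>ind H. \<lambda>x. coset_op H g U f x + S f x)"
  shows "P S"
proof -
  obtain w :: 'v where w: "w \<noteq> 0" using nontrivial by blast
  let ?supp = "\<lambda>S. coset_support (\<lambda>x. kern S x w)"
  show ?thesis
    using S
  proof (induction "card (?supp S)" arbitrary: S rule: less_induct)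
    case less
    note S = less.prems
    note fin = kern_support_finite[OF H S, of w]
    show ?case
    proof (cases "\<forall>x\<in>H. kern S x w = 0")
      case True
      \<comment> \<open>The zero operator is written as a multiple of \<open>S\<close>, which makes it an element of the algebra.\<close>
      have "S = (\<lambda>f\<in>ind H. \<lambda>x. s 0 (S f x))"
      proof (rule hecke_eqI[OF H S hecke_smult[OF H S]])
        fix x v assume x: "x \<in> H"
        have "kern S x v = 0"
        proof (rule ccontr)
          assume "kern S x v \<noteq> 0"
          then have "intertw x (kern S x)" using kern_intertw[OF H S x] HJ x by blast
          then show False using intertw_zero_iff w True x by blast
        qed
        then show "kern S x v = kern (\<lambda>f\<in>ind H. \<lambda>x. s 0 (S f x)) x v"
          by (simp only: kern_smult[OF H]) simp
      qed
      then show ?thesis using zero by simp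
    next
      case False
      then obtain g where g: "g \<in> H" "kern S g w \<noteq> 0" by blast
      let ?U = "kern S g"
      have gJ: "g \<in> Jt" using g HJ by blast
      have gG: "g \<in> carrier G" by (rule Jt_carrier[OF gJ])
      have U: "intertw g ?U" "g \<in> stab" using kern_intertw[OF H S g(1) gJ g(2)] by auto
      let ?E = "coset_op H g ?U"
      have E: "?E \<in> carrier (HA H)" by (rule coset_op_hecke[OF H g(1) gJ U(1)])
      define R where "R = (\<lambda>f\<in>ind H. \<lambda>x. S f x + (\<lambda>f\<in>ind H. \<lambda>x. s (-1) (?E f x)) f x)"
      have R: "R \<in> carrier (HA H)" unfolding R_def by (rule hecke_sum[OF H S hecke_smult[OF H E]])
      have kern_R: "kern R x v = kern S x v - delta g (kern S g v) x" for x v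
        by (simp only: R_def kern_sum[OF H] kern_smult[OF H] kern_coset_op[OF H g(1) gJ U(1)]) simp
      have R_coset: "kern R x w = 0" if x: "x \<in> carrier G" "J #> x = J #> g" for x
      proof -
        have j: "x \<otimes> inv g \<in> J" using x gG by (simp add: coset_eq_iff)
        have "x = (x \<otimes> inv g) \<otimes> g" using x gG by (simp add: m_assoc)
        then have "kern S x w = \<rho> (x \<otimes> inv g) (kern S g w)" using kern_left[OF H S j g(1), of w] by simp
        then show ?thesis using j x(1) by (simp add: kern_R delta_def)
      qed
      have "?supp R \<subseteq> ?supp S - {J #> g}"
      proof
        fix C assume "C \<in> ?supp R"
        then obtain x where x: "C = J #> x" "kern R x w \<noteq> 0" by (auto simp: coset_support_def)
        have xG: "x \<in> carrier G" using kern_zero[OF H R] x(2) level_carrier[OF H] by blast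
        have ne: "C \<noteq> J #> g" using R_coset[OF xG] x by blast
        then have "delta g (kern S g w) x = 0" using x(1) xG gG by (auto simp: delta_def coset_eq_iff)
        then have "kern S x w \<noteq> 0" using x(2) by (simp add: kern_R)
        then show "C \<in> ?supp S - {J #> g}" using ne x(1) by (auto simp: coset_support_def)
      qed
      moreover have "J #> g \<in> ?supp S" using g(2) by (auto simp: coset_support_def)
      ultimately have "?supp R \<subset> ?supp S" by blast
      then have "card (?supp R) < card (?supp S)" by (rule psubset_card_mono[OF fin])
      then have "P R" using less.hyps R by blast
      then have "P (\<lambda>f\<in>ind H. \<lambda>x. ?E f x + R f x)" by (rule add[OF g(1) U(2,1) R])
      moreover have "(\<lambda>f\<in>ind H. \<lambda>x. ?E f x + R f x) = S"
        by (rule extensionalityI[OF _ hecke_ext[OF S]]) (simp_all add: R_def fun_eq_iff)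
      ultimately show ?thesis by simp
    qed
  qed
qed

text \<open>The condition compares the kernels of the two products at \<open>x \<otimes> h\<close>; where \<open>kern T x\<close> is not zero
  it says that \<open>\<beta> x h = 1\<close>.\<close>

lemma coset_op_commute_iff:
  assumes T: "T \<in> carrier (HA stab)" and h: "h \<in> stab" and U: "intertw h U"
  shows "compose (ind stab) T (coset_op stab h U) = compose (ind stab) (coset_op stab h U) T \<longleftrightarrow>
    (\<forall>x\<in>stab. \<forall>v. kern T x (U v) = \<rho> (x \<otimes> h \<otimes> inv x \<otimes> inv h) (U (kern T x v)))"
proof -
  let ?E = "coset_op stab h U"
  note H = level_stab
  have hJ: "h \<in> Jt" and hG: "h \<in> carrier G" using h stab_Jt stab_carrier by auto
  have E: "?E \<in> carrier (HA stab)" by (rule coset_op_hecke[OF H h hJ U])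
  have d: "delta \<one> v \<in> ind stab" for v by (rule delta_ind[OF H stab_one])
  have TE: "kern (compose (ind stab) T ?E) (x \<otimes> h) v = kern T x (U v)" if x: "x \<in> stab" for x v
  proof -
    have "kern (compose (ind stab) T ?E) (x \<otimes> h) v = T (delta h (U v)) (x \<otimes> h)"
      using coset_op_delta[OF H h hJ U, of v] d by (simp add: kern_def compose_def)
    also have "\<dots> = kern T ((x \<otimes> h) \<otimes> inv h) (U v)"
      by (rule hecke_delta[OF H T h stab_mult[OF x h]])
    finally show ?thesis using hG stab_carrier[OF x] by (simp add: m_assoc)
  qed
  have ET: "kern (compose (ind stab) ?E T) (x \<otimes> h) v = \<rho> (x \<otimes> h \<otimes> inv x \<otimes> inv h) (U (kern T x v))"
    if x: "x \<in> stab" for x v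
  proof -
    have xG: "x \<in> carrier G" by (rule stab_carrier[OF x])
    let ?k = "inv h \<otimes> x \<otimes> h \<otimes> inv x"
    have k: "?k \<in> J" using commutators[OF Jt_inv[OF hJ] stab_Jt[OF x]] hG by simp
    have "kern (compose (ind stab) ?E T) (x \<otimes> h) v = U (kern T (inv h \<otimes> (x \<otimes> h)) v)"
      using stab_mult[OF x h] d hecke_ind[OF T d] by (simp add: kern_def compose_def coset_op_def)
    also have "inv h \<otimes> (x \<otimes> h) = ?k \<otimes> x" using xG hG by (simp add: m_assoc)
    also have "kern T (?k \<otimes> x) v = \<rho> ?k (kern T x v)" by (rule kern_left[OF H T k x])
    also have "U (\<rho> ?k (kern T x v)) = \<rho> (h \<otimes> ?k \<otimes> inv h) (U (kern T x v))"
      by (rule intertw_J_apply[OF U k])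
    also have "h \<otimes> ?k \<otimes> inv h = x \<otimes> h \<otimes> inv x \<otimes> inv h" using xG hG by (simp add: m_assoc)
    finally show ?thesis .
  qed
  show ?thesis
  proof
    assume eq: "compose (ind stab) T ?E = compose (ind stab) ?E T"
    show "\<forall>x\<in>stab. \<forall>v. kern T x (U v) = \<rho> (x \<otimes> h \<otimes> inv x \<otimes> inv h) (U (kern T x v))"
    proof (intro ballI allI)
      fix x v assume x: "x \<in> stab"
      show "kern T x (U v) = \<rho> (x \<otimes> h \<otimes> inv x \<otimes> inv h) (U (kern T x v))"
        using TE[OF x, of v] ET[OF x, of v] unfolding eq by simp
    qed
  next
    assume eq: "\<forall>x\<in>stab. \<forall>v. kern T x (U v) = \<rho> (x \<otimes> h \<otimes> inv x \<otimes> inv h) (U (kern T x v))"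
    show "compose (ind stab) T ?E = compose (ind stab) ?E T"
    proof (rule hecke_eqI[OF H hecke_compose[OF H T E] hecke_compose[OF H E T]])
      fix y v assume y: "y \<in> stab"
      have x: "y \<otimes> inv h \<in> stab" by (rule stab_mult[OF y stab_inv[OF h]])
      have yh: "(y \<otimes> inv h) \<otimes> h = y" using hG stab_carrier[OF y] by (simp add: m_assoc)
      have "kern T (y \<otimes> inv h) (U v) =
          \<rho> ((y \<otimes> inv h) \<otimes> h \<otimes> inv (y \<otimes> inv h) \<otimes> inv h) (U (kern T (y \<otimes> inv h) v))"
        using bspec[OF eq x] by (rule spec)
      then show "kern (compose (ind stab) T ?E) y v = kern (compose (ind stab) ?E T) y v"
        using TE[OF x, of v] ET[OF x, of v] unfolding yh by simp
    qed
  qed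
qed

text \<open>A central operator commutes with every \<open>coset_op stab h U\<close>, so \<open>\<beta> x h = 1\<close> for every \<open>x\<close> in its
  support and every \<open>h\<close>.  Conversely, commuting with these operators suffices, since they span.\<close>

lemma center_iff:
  assumes T: "T \<in> carrier (HA stab)"
  shows "T \<in> carrier (alg_center (HA stab)) \<longleftrightarrow> (\<forall>x v. x \<notin> rad \<longrightarrow> kern T x v = 0)"
proof
  assume central: "T \<in> carrier (alg_center (HA stab))"
  show "\<forall>x v. x \<notin> rad \<longrightarrow> kern T x v = 0"
  proof (intro allI impI, rule ccontr)
    fix x v assume x: "x \<notin> rad" and nz: "kern T x v \<noteq> 0"
    have xs: "x \<in> stab" using kern_zero[OF level_stab T] nz by blast
    have K: "intertw x (kern T x)" using kern_intertw[OF level_stab T xs stab_Jt[OF xs] nz] by simp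
    have "\<beta> x h = 1" if h: "h \<in> stab" for h
    proof -
      obtain U where U: "intertw h U" using stab_intertw[OF h] by blast
      have "coset_op stab h U \<in> carrier (HA stab)" by (rule coset_op_hecke[OF level_stab h stab_Jt[OF h] U])
      then have "compose (ind stab) T (coset_op stab h U) = compose (ind stab) (coset_op stab h U) T"
        using central by (simp add: alg_center_def)
      then have "comm_rel x h 1 (kern T x) U"
        using coset_op_commute_iff[OF T h U] xs by (simp add: comm_rel_def)
      then show ?thesis by (rule \<beta>_unique[OF xs h K U])
    qed
    then show False using x xs by (simp add: rad_def)
  qed
next
  assume supp: "\<forall>x v. x \<notin> rad \<longrightarrow> kern T x v = 0"
  have commute: "compose (ind stab) T (coset_op stab h U) = compose (ind stab) (coset_op stab h U) T"
    if h: "h \<in> stab" and U: "intertw h U" for h U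
    unfolding coset_op_commute_iff[OF T h U]
  proof (intro ballI allI)
    fix x v assume xs: "x \<in> stab"
    have k: "x \<otimes> h \<otimes> inv x \<otimes> inv h \<in> J" by (rule commutators[OF stab_Jt[OF xs] stab_Jt[OF h]])
    show "kern T x (U v) = \<rho> (x \<otimes> h \<otimes> inv x \<otimes> inv h) (U (kern T x v))"
    proof (cases "\<forall>v. kern T x v = 0")
      case True
      then show ?thesis using intertw_zero_iff[OF U, of 0] k by (simp add: \<rho>_zero)
    next
      case False
      then obtain w where w: "kern T x w \<noteq> 0" by blast
      then have K: "intertw x (kern T x)" using kern_intertw[OF level_stab T xs stab_Jt[OF xs] w] by simp
      have "x \<in> rad" using supp w by blast
      then have "\<beta> x h = 1" using h by (simp add: rad_def)
      then show ?thesis using comm_rel_\<beta>[OF xs h K U] by (simp add: comm_rel_def)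
    qed
  qed
  have "compose (ind stab) T S = compose (ind stab) S T" if S: "S \<in> carrier (HA stab)" for S
  proof -
    have "stab \<subseteq> Jt" using stab_Jt by blast
    from level_stab this S show ?thesis
    proof (induction rule: hecke_induct)
      case zero
      show ?case
        by (rule extensionalityI[of _ "ind stab"])
          (simp_all add: compose_eq compose_extensional hecke_0[OF level_stab T] ind_0[OF level_stab]
            hecke_ind[OF T])
    next
      case (add g U S)
      let ?E = "coset_op stab g U"
      have E: "?E \<in> carrier (HA stab)" by (rule coset_op_hecke[OF level_stab add(1) stab_Jt[OF add(2)] add(3)])
      show ?case
      proof (rule extensionalityI[of _ "ind stab"])
        fix f assume f: "f \<in> ind stab"
        have "T (?E f) = ?E (T f)"
          using fun_cong[OF commute[OF add(2,3)], of f] f by (simp add: compose_eq)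
        moreover have "T (S f) = S (T f)"
          using fun_cong[OF add(5), of f] f by (simp add: compose_eq)
        ultimately show "compose (ind stab) T (\<lambda>f\<in>ind stab. \<lambda>x. ?E f x + S f x) f =
            compose (ind stab) (\<lambda>f\<in>ind stab. \<lambda>x. ?E f x + S f x) T f"
          using f by (simp add: compose_eq hecke_add[OF T] hecke_ind[OF E] hecke_ind[OF add(4)] hecke_ind[OF T])
      qed (simp_all add: compose_extensional)
    qed
  qed
  then show "T \<in> carrier (alg_center (HA stab))" using T by (simp add: alg_center_def)
qed

lemma hecke_map_center_iso:
  assumes I: "intertwining G J s \<rho> \<subseteq> Jt"
  shows "hecke_map G stab (carrier G) J \<rho> \<in> alg_iso (alg_center (HA stab)) (alg_center (HA (carrier G)))"
proof (rule alg_iso_center)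
  have GL: "level (carrier G)" using J by (simp add: level_def subgroup_self subgroup.subset)
  have sub: "stab \<subseteq> carrier G" using stab_carrier by blast
  have "{T \<in> carrier (HA (carrier G)). \<forall>x v. x \<notin> stab \<longrightarrow> kern T x v = 0} = carrier (HA (carrier G))"
    using kern_support[OF I] by blast
  then show "hecke_map G stab (carrier G) J \<rho> \<in> alg_iso (HA stab) (HA (carrier G))"
    using ext_alg_iso[OF level_stab GL sub] by simp
  show "T \<otimes>\<^bsub>HA stab\<^esub> S \<in> carrier (HA stab)" if "T \<in> carrier (HA stab)" "S \<in> carrier (HA stab)" for T S
    using hecke_compose[OF level_stab that] by simp
qed

lemma hecke_map_rad_iso:
  "hecke_map G rad stab J \<rho> \<in> alg_iso (HA rad) (alg_center (HA stab))"
proof -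
  have sub: "rad \<subseteq> stab" using rad_stab by blast
  have "carrier (alg_center (HA stab)) = {T \<in> carrier (HA stab). \<forall>x v. x \<notin> rad \<longrightarrow> kern T x v = 0}"
    using center_iff by (auto simp: alg_center_def)
  then have "alg_center (HA stab) = (HA stab)\<lparr>carrier := {T \<in> carrier (HA stab). \<forall>x v. x \<notin> rad \<longrightarrow> kern T x v = 0}\<rparr>"
    by (simp add: alg_center_def)
  then show ?thesis using ext_alg_iso[OF level_rad level_stab sub] by simp
qed

end

section \<open>Group algebras\<close>

text \<open>A sum over pairs becomes a sum over one factor, with an index set \<open>F\<close> that can be chosen large
  enough for several \<open>b\<close> at once; additivity in \<open>b\<close> is then evident.\<close>

lemma (in group) group_algebra_mult:
  assumes a: "\<And>y. a y \<noteq> 0 \<Longrightarrow> y \<in> carrier G" and b: "\<And>z. b z \<noteq> 0 \<Longrightarrow> z \<in> F"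
    and F: "finite F" "F \<subseteq> carrier G"
  shows "(a \<otimes>\<^bsub>group_algebra G\<^esub> b) x = (if x \<in> carrier G then \<Sum>z\<in>F. a (x \<otimes> inv z) * b z else 0)"
proof (cases "x \<in> carrier G")
  case True
  let ?P = "{(y, z). a y \<noteq> 0 \<and> b z \<noteq> 0 \<and> y \<otimes> z = x}"
  have "(a \<otimes>\<^bsub>group_algebra G\<^esub> b) x = (\<Sum>(y, z)\<in>?P. a y * b z)"
    by (simp add: group_algebra_def)
  also have "\<dots> = (\<Sum>z\<in>{z\<in>F. a (x \<otimes> inv z) * b z \<noteq> 0}. a (x \<otimes> inv z) * b z)"
  proof (rule sum.reindex_bij_witness[of _ "\<lambda>z. (x \<otimes> inv z, z)" snd])
    fix p assume "p \<in> ?P"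
    then obtain y z where p: "p = (y, z)" "a y \<noteq> 0" "b z \<noteq> 0" "y \<otimes> z = x" by auto
    then have G: "y \<in> carrier G" "z \<in> carrier G" "z \<in> F" using a b F by auto
    have "x \<otimes> inv z = y" using G p(4) by (simp add: m_assoc flip: p(4))
    then show "(x \<otimes> inv (snd p), snd p) = p" "snd p \<in> {z\<in>F. a (x \<otimes> inv z) * b z \<noteq> 0}"
      "a (x \<otimes> inv (snd p)) * b (snd p) = (case p of (y, z) \<Rightarrow> a y * b z)"
      using p G by simp_all
  next
    fix z assume z: "z \<in> {z\<in>F. a (x \<otimes> inv z) * b z \<noteq> 0}"
    then have "z \<in> carrier G" using F by blast
    then show "(x \<otimes> inv z, z) \<in> ?P" "snd (x \<otimes> inv z, z) = z"
      using z True by (auto simp: m_assoc)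
  qed
  also have "\<dots> = (\<Sum>z\<in>F. a (x \<otimes> inv z) * b z)"
    using F(1) by (intro sum.mono_neutral_left) auto
  finally show ?thesis using True by simp
next
  case False
  have "{(y, z). a y \<noteq> 0 \<and> b z \<noteq> 0 \<and> y \<otimes> z = x} = {}"
  proof (rule equals0I)
    fix p assume "p \<in> {(y, z). a y \<noteq> 0 \<and> b z \<noteq> 0 \<and> y \<otimes> z = x}"
    then obtain y z where "a y \<noteq> 0" "b z \<noteq> 0" "y \<otimes> z = x" by auto
    then show False using a[of y] b[of z] F(2) False by auto
  qed
  moreover have "(a \<otimes>\<^bsub>group_algebra G\<^esub> b) x =
      (\<Sum>(y, z)\<in>{(y, z). a y \<noteq> 0 \<and> b z \<noteq> 0 \<and> y \<otimes> z = x}. a y * b z)"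
    by (simp add: group_algebra_def)
  ultimately show ?thesis using False by (simp only: sum.empty if_False)
qed

context clifford_pair
begin

context
  fixes H and R :: "'g \<Rightarrow> 'v \<Rightarrow> 'v"
  assumes H: "level H" and H_stab: "H \<subseteq> stab"
    and R: "\<And>g. g \<in> H \<Longrightarrow> intertw g (R g)"
    and R_mult: "\<And>g h v. g \<in> H \<Longrightarrow> h \<in> H \<Longrightarrow> R (g \<otimes> h) v = R g (R h v)"
    and R_J: "\<And>j v. j \<in> J \<Longrightarrow> R j v = \<rho> j v"
begin

lemma H_Jt: "x \<in> H \<Longrightarrow> x \<in> Jt"
  using H_stab stab_Jt by blast

lemma H_carrier: "x \<in> H \<Longrightarrow> x \<in> carrier G"
  using H_Jt Jt_carrier by blast

text \<open>The operators \<open>R g\<close> extend \<open>\<rho>\<close> to a representation of \<open>H\<close>.  Each \<open>kern T x\<close> is a multiple of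
  \<open>R x\<close>, and because \<open>R\<close> is multiplicative the multiples compose without a cocycle.\<close>

definition coeff_at :: "(('g \<Rightarrow> 'v) \<Rightarrow> 'g \<Rightarrow> 'v) \<Rightarrow> 'g \<Rightarrow> complex" where
  "coeff_at T x = (SOME c. \<forall>v. kern T x v = s c (R x v))"

lemma coeff_at:
  assumes T: "T \<in> carrier (HA H)" and x: "x \<in> H"
  shows "kern T x v = s (coeff_at T x) (R x v)"
proof -
  have "\<exists>c. \<forall>v. kern T x v = s c (R x v)"
    by (rule twist_unique[OF H_Jt[OF x] R[OF x] kern_twist[OF H T x H_Jt[OF x]]])
  then have "\<forall>v. kern T x v = s (coeff_at T x) (R x v)"
    unfolding coeff_at_def by (rule someI_ex)
  then show ?thesis ..
qed

lemma coeff_at_unique: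
  assumes T: "T \<in> carrier (HA H)" and x: "x \<in> H" and c: "\<And>v. kern T x v = s c (R x v)"
  shows "coeff_at T x = c"
proof -
  obtain v :: 'v where v: "v \<noteq> 0" using nontrivial by blast
  then have "R x v \<noteq> 0" using intertw_zero_iff[OF R[OF x]] by simp
  moreover have "s (coeff_at T x) (R x v) = s c (R x v)"
    by (rule trans[OF coeff_at[OF T x, symmetric] c])
  ultimately show ?thesis by (simp only: vs.scale_cancel_right) simp
qed

lemma coeff_at_J:
  assumes T: "T \<in> carrier (HA H)" and x: "x \<in> H" and j: "j \<in> J"
  shows "coeff_at T (j \<otimes> x) = coeff_at T x"
proof (rule coeff_at_unique[OF T level_mult[OF H level_J[OF H j] x]])
  fix v
  show "kern T (j \<otimes> x) v = s (coeff_at T x) (R (j \<otimes> x) v)"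
    using kern_left[OF H T j x, of v] coeff_at[OF T x, of v] R_mult[OF level_J[OF H j] x, of v] R_J[OF j, of "R x v"]
    by (simp add: \<rho>_scale[OF j])
qed

abbreviation "Q \<equiv> G\<lparr>carrier := H\<rparr> Mod J"

lemma normal_J: "J \<lhd> G\<lparr>carrier := H\<rparr>"
proof -
  interpret GH: group "G\<lparr>carrier := H\<rparr>" by (rule subgroup.subgroup_is_group[OF level_subgroup[OF H] is_group])
  have inv: "inv\<^bsub>G\<lparr>carrier := H\<rparr>\<^esub> x = inv x" if "x \<in> H" for x
    using m_inv_consistent[OF level_subgroup[OF H] that] .
  have "subgroup J (G\<lparr>carrier := H\<rparr>)"
    using subgroup_incl[OF J level_subgroup[OF H]] H by (simp add: level_def)
  then show ?thesis
    unfolding GH.normal_inv_iff using J_conj H_Jt by (auto simp: inv)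
qed

lemma group_Q: "group Q"
  by (rule normal.factorgroup_is_group[OF normal_J])

lemma carrier_Q: "carrier Q = (\<lambda>x. J #> x) ` H"
  by (auto simp: FactGroup_def RCOSETS_def r_coset_def)

lemma mult_Q: "x \<in> H \<Longrightarrow> y \<in> H \<Longrightarrow> (J #> x) \<otimes>\<^bsub>Q\<^esub> (J #> y) = J #> (x \<otimes> y)"
  using normal.rcos_sum[OF normal_J, of x y] by (simp add: FactGroup_def r_coset_def set_mult_def)

lemma inv_Q:
  assumes x: "x \<in> H" shows "inv\<^bsub>Q\<^esub> (J #> x) = J #> inv x"
proof -
  interpret Q: group Q by (rule group_Q)
  have xi: "inv x \<in> H" by (rule level_inv[OF H x])
  have "(J #> inv x) \<otimes>\<^bsub>Q\<^esub> (J #> x) = \<one>\<^bsub>Q\<^esub>"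
    using mult_Q[OF xi x] H_carrier[OF x] subgroup.subset[OF J] by simp
  then show ?thesis using x xi by (intro Q.inv_equality) (auto simp: carrier_Q)
qed

text \<open>The coefficients as a function on \<open>H/J\<close>.  A representative is chosen in each coset; the choice
  does not affect the value.\<close>

definition symbol :: "(('g \<Rightarrow> 'v) \<Rightarrow> 'g \<Rightarrow> 'v) \<Rightarrow> 'g set \<Rightarrow> complex" where
  "symbol T C = (if C \<in> carrier Q then coeff_at T (SOME x. x \<in> H \<and> C = J #> x) else 0)"

lemma symbol_coset:
  assumes T: "T \<in> carrier (HA H)" and x: "x \<in> H"
  shows "symbol T (J #> x) = coeff_at T x"
proof -
  define y where "y = (SOME y. y \<in> H \<and> J #> x = J #> y)"
  have "y \<in> H \<and> J #> x = J #> y" unfolding y_def by (rule someI[of _ x]) (simp add: x)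
  then have y: "y \<in> H" "J #> y = J #> x" by auto
  have j: "y \<otimes> inv x \<in> J" using y x by (simp add: coset_eq_iff H_carrier)
  have "coeff_at T ((y \<otimes> inv x) \<otimes> x) = coeff_at T x" by (rule coeff_at_J[OF T x j])
  then have "coeff_at T y = coeff_at T x" using x y H_carrier by (simp add: m_assoc)
  then show ?thesis using x by (simp add: symbol_def carrier_Q y_def)
qed

lemma symbol_eqI:
  assumes T: "T \<in> carrier (HA H)" and supp: "\<And>C. C \<notin> carrier Q \<Longrightarrow> a C = 0"
    and eq: "\<And>x v. x \<in> H \<Longrightarrow> kern T x v = s (a (J #> x)) (R x v)"
  shows "symbol T = a"
proof
  fix C show "symbol T C = a C"
  proof (cases "C \<in> carrier Q")
    case True
    then obtain x where x: "x \<in> H" "C = J #> x" by (auto simp: carrier_Q)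
    then show ?thesis using coeff_at_unique[OF T x(1) eq[OF x(1)]] symbol_coset[OF T x(1)] by simp
  qed (simp add: symbol_def supp)
qed

lemma kern_symbol:
  "T \<in> carrier (HA H) \<Longrightarrow> x \<in> H \<Longrightarrow> kern T x v = s (symbol T (J #> x)) (R x v)"
  by (simp add: symbol_coset coeff_at)

lemma symbol_supp: "symbol T C \<noteq> 0 \<Longrightarrow> C \<in> carrier Q"
  by (simp add: symbol_def split: if_splits)

lemma symbol_outside: "C \<notin> carrier Q \<Longrightarrow> symbol T C = 0"
  by (simp add: symbol_def)

lemma symbol_in:
  assumes T: "T \<in> carrier (HA H)"
  shows "symbol T \<in> carrier (group_algebra Q)"
proof -
  obtain w :: 'v where w: "w \<noteq> 0" using nontrivial by blast
  have "{C. symbol T C \<noteq> 0} \<subseteq> coset_support (\<lambda>x. kern T x w)"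
  proof
    fix C assume "C \<in> {C. symbol T C \<noteq> 0}"
    then have C: "symbol T C \<noteq> 0" by simp
    then obtain x where x: "x \<in> H" "C = J #> x" using symbol_supp by (auto simp: carrier_Q)
    have "kern T x w \<noteq> 0"
      using kern_symbol[OF T x(1), of w] C x(2) w intertw_zero_iff[OF R[OF x(1)], of w] by simp
    then show "C \<in> coset_support (\<lambda>x. kern T x w)" using x(2) by (auto simp: coset_support_def)
  qed
  then have "finite {C. symbol T C \<noteq> 0}" by (rule finite_subset[OF _ kern_support_finite[OF H T]])
  then show ?thesis using symbol_supp by (auto simp: group_algebra_def)
qed

lemma symbol_finite: "T \<in> carrier (HA H) \<Longrightarrow> finite {C. symbol T C \<noteq> 0}"
  using symbol_in[of T] by (simp add: group_algebra_def)

lemma symbol_add: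
  assumes T: "T \<in> carrier (HA H)" and S: "S \<in> carrier (HA H)"
  shows "symbol (\<lambda>f\<in>ind H. \<lambda>x. T f x + S f x) = (\<lambda>C. symbol T C + symbol S C)"
proof (rule symbol_eqI[OF hecke_sum[OF H T S]])
  show "symbol T C + symbol S C = 0" if "C \<notin> carrier Q" for C
    using symbol_outside[OF that, of T] symbol_outside[OF that, of S] by simp
  show "kern (\<lambda>f\<in>ind H. \<lambda>x. T f x + S f x) x v = s (symbol T (J #> x) + symbol S (J #> x)) (R x v)"
    if "x \<in> H" for x v
    by (simp only: kern_sum[OF H] kern_symbol[OF T that] kern_symbol[OF S that] vs.scale_left_distrib)
qed

lemma symbol_smult:
  assumes T: "T \<in> carrier (HA H)"
  shows "symbol (\<lambda>f\<in>ind H. \<lambda>x. s c (T f x)) = (\<lambda>C. c * symbol T C)"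
proof (rule symbol_eqI[OF hecke_smult[OF H T]])
  show "c * symbol T C = 0" if "C \<notin> carrier Q" for C
    using symbol_outside[OF that, of T] by simp
  show "kern (\<lambda>f\<in>ind H. \<lambda>x. s c (T f x)) x v = s (c * symbol T (J #> x)) (R x v)"
    if "x \<in> H" for x v
    by (simp only: kern_smult[OF H] kern_symbol[OF T that] vs.scale_scale)
qed

lemma symbol_0: "symbol (\<lambda>f\<in>ind H. \<lambda>x. 0) = (\<lambda>C. 0)"
  and zero_hecke: "(\<lambda>f\<in>ind H. \<lambda>x. 0) \<in> carrier (HA H)"
proof -
  show *: "(\<lambda>f\<in>ind H. \<lambda>x. 0) \<in> carrier (HA H)"
    by (rule heckeI) (auto simp: ind_0[OF H] ind_add[OF H] ind_scale[OF H] ind_rt_self[OF H] rt_apply fun_eq_iff)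
  show "symbol (\<lambda>f\<in>ind H. \<lambda>x. 0) = (\<lambda>C. 0)"
    by (rule symbol_eqI[OF *]) (simp_all add: kern_def delta_ind[OF H level_one[OF H]])
qed

lemma symbol_coset_op:
  assumes g: "g \<in> H" and U: "intertw g U" and c: "\<And>v. U v = s c (R g v)"
  shows "symbol (coset_op H g U) = (\<lambda>C. if C = J #> g then c else 0)"
proof (rule symbol_eqI[OF coset_op_hecke[OF H g H_Jt[OF g] U]])
  show "(if C = J #> g then c else 0) = 0" if "C \<notin> carrier Q" for C
    using that g by (auto simp: carrier_Q)
  fix x v assume x: "x \<in> H"
  show "kern (coset_op H g U) x v = s (if J #> x = J #> g then c else 0) (R x v)"
  proof (cases "x \<otimes> inv g \<in> J")
    case True
    have "R ((x \<otimes> inv g) \<otimes> g) v = \<rho> (x \<otimes> inv g) (R g v)"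
      using R_mult[OF level_J[OF H True] g] R_J[OF True] by simp
    then have "R x v = \<rho> (x \<otimes> inv g) (R g v)" using x g H_carrier by (simp add: m_assoc)
    then show ?thesis
      using True x g by (simp add: kern_coset_op[OF H g H_Jt[OF g] U] delta_def H_carrier coset_eq_iff c \<rho>_scale)
  next
    case False
    then show ?thesis
      using x g by (simp add: kern_coset_op[OF H g H_Jt[OF g] U] delta_def H_carrier coset_eq_iff)
  qed
qed

text \<open>Both sides are additive in \<open>S\<close>, so it suffices to treat an operator supported on one coset.\<close>

lemma symbol_mult:
  assumes T: "T \<in> carrier (HA H)" and S: "S \<in> carrier (HA H)"
  shows "symbol (compose (ind H) T S) = symbol T \<otimes>\<^bsub>group_algebra Q\<^esub> symbol S"
proof -
  interpret Q: group Q by (rule group_Q)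
  have "H \<subseteq> Jt" using H_Jt by blast
  with H show ?thesis using S
  proof (induction S rule: hecke_induct)
    case zero
    have eq: "compose (ind H) T (\<lambda>f\<in>ind H. \<lambda>x. 0) = (\<lambda>f\<in>ind H. \<lambda>x. 0)"
      by (rule extensionalityI[of _ "ind H"]) (simp_all add: compose_eq compose_extensional hecke_0[OF H T])
    show ?case unfolding eq symbol_0 by (simp add: group_algebra_def)
  next
    case (add g U S)
    let ?E = "coset_op H g U"
    have gJ: "g \<in> Jt" by (rule H_Jt[OF add(1)])
    have E: "?E \<in> carrier (HA H)" by (rule coset_op_hecke[OF H add(1) gJ add(3)])
    have "compose (ind H) T (\<lambda>f\<in>ind H. \<lambda>x. ?E f x + S f x) =
        (\<lambda>f\<in>ind H. \<lambda>x. compose (ind H) T ?E f x + compose (ind H) T S f x)"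
      by (rule extensionalityI[of _ "ind H"])
        (simp_all add: compose_eq compose_extensional hecke_add[OF T] hecke_ind[OF E] hecke_ind[OF add(4)])
    then have 1: "symbol (compose (ind H) T (\<lambda>f\<in>ind H. \<lambda>x. ?E f x + S f x)) =
        (\<lambda>C. symbol (compose (ind H) T ?E) C + symbol (compose (ind H) T S) C)"
      using symbol_add[OF hecke_compose[OF H T E] hecke_compose[OF H T add(4)]] by simp
    obtain c where c: "\<forall>v. U v = s c (R g v)"
      using twist_unique[OF gJ R[OF add(1)], of U] add(3) by (auto simp: intertw_def)
    have E_sym: "symbol ?E = (\<lambda>C. if C = J #> g then c else 0)"
      using c by (intro symbol_coset_op[OF add(1,3)]) simp
    have gQ: "J #> g \<in> carrier Q" using add(1) by (auto simp: carrier_Q)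
    have TE: "symbol (compose (ind H) T ?E) = symbol T \<otimes>\<^bsub>group_algebra Q\<^esub> symbol ?E"
    proof (rule symbol_eqI[OF hecke_compose[OF H T E]])
      have mult: "(symbol T \<otimes>\<^bsub>group_algebra Q\<^esub> symbol ?E) C =
          (if C \<in> carrier Q then \<Sum>z\<in>{J #> g}. symbol T (C \<otimes>\<^bsub>Q\<^esub> inv\<^bsub>Q\<^esub> z) * symbol ?E z else 0)" for C
        by (rule Q.group_algebra_mult) (use symbol_supp gQ in \<open>auto simp: E_sym split: if_splits\<close>)
      show "(symbol T \<otimes>\<^bsub>group_algebra Q\<^esub> symbol ?E) C = 0" if "C \<notin> carrier Q" for C
        using mult that by simp
      fix x v assume x: "x \<in> H"
      have gi: "inv g \<in> H" by (rule level_inv[OF H add(1)])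
      have xg: "x \<otimes> inv g \<in> H" by (rule level_mult[OF H x gi])
      have xQ: "J #> x \<in> carrier Q" using x by (auto simp: carrier_Q)
      have "kern (compose (ind H) T ?E) x v = T (delta g (U v)) x"
        by (simp add: kern_def compose_eq delta_ind[OF H level_one[OF H]] coset_op_delta[OF H add(1) gJ add(3)])
      also have "\<dots> = kern T (x \<otimes> inv g) (U v)" by (rule hecke_delta[OF H T add(1) x])
      also have "\<dots> = s (symbol T (J #> (x \<otimes> inv g))) (R (x \<otimes> inv g) (s c (R g v)))"
        using c by (simp add: kern_symbol[OF T xg])
      also have "\<dots> = s (symbol T (J #> (x \<otimes> inv g)) * c) (R ((x \<otimes> inv g) \<otimes> g) v)"
        using R_mult[OF xg add(1)] by (simp add: intertw_scale_apply[OF R[OF xg]])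
      also have "(x \<otimes> inv g) \<otimes> g = x" using x add(1) H_carrier by (simp add: m_assoc)
      also have "symbol T (J #> (x \<otimes> inv g)) * c = (symbol T \<otimes>\<^bsub>group_algebra Q\<^esub> symbol ?E) (J #> x)"
        using mult[of "J #> x"] xQ mult_Q[OF x gi] inv_Q[OF add(1)] by (simp add: E_sym)
      finally show "kern (compose (ind H) T ?E) x v =
          s ((symbol T \<otimes>\<^bsub>group_algebra Q\<^esub> symbol ?E) (J #> x)) (R x v)" .
    qed
    let ?F = "{C. symbol ?E C \<noteq> 0} \<union> {C. symbol S C \<noteq> 0}"
    have F: "finite ?F" "?F \<subseteq> carrier Q"
      using symbol_finite[OF E] symbol_finite[OF add(4)] symbol_supp by auto
    have mult: "(symbol T \<otimes>\<^bsub>group_algebra Q\<^esub> b) C =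
        (if C \<in> carrier Q then \<Sum>z\<in>?F. symbol T (C \<otimes>\<^bsub>Q\<^esub> inv\<^bsub>Q\<^esub> z) * b z else 0)"
      if "{z. b z \<noteq> 0} \<subseteq> ?F" for b C
    proof (rule Q.group_algebra_mult[OF _ _ F])
      show "y \<in> carrier Q" if "symbol T y \<noteq> 0" for y by (rule symbol_supp[OF that])
      show "z \<in> ?F" if "b z \<noteq> 0" for z using that \<open>{z. b z \<noteq> 0} \<subseteq> ?F\<close> by blast
    qed
    have "symbol T \<otimes>\<^bsub>group_algebra Q\<^esub> (\<lambda>C. symbol ?E C + symbol S C) =
        (\<lambda>C. (symbol T \<otimes>\<^bsub>group_algebra Q\<^esub> symbol ?E) C + (symbol T \<otimes>\<^bsub>group_algebra Q\<^esub> symbol S) C)"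
    proof
      fix C
      have nz: "{z. symbol ?E z + symbol S z \<noteq> 0} \<subseteq> ?F" by auto
      have nzE: "{z. symbol ?E z \<noteq> 0} \<subseteq> ?F" by simp
      have nzS: "{z. symbol S z \<noteq> 0} \<subseteq> ?F" by simp
      show "(symbol T \<otimes>\<^bsub>group_algebra Q\<^esub> (\<lambda>C. symbol ?E C + symbol S C)) C =
        (symbol T \<otimes>\<^bsub>group_algebra Q\<^esub> symbol ?E) C + (symbol T \<otimes>\<^bsub>group_algebra Q\<^esub> symbol S) C"
        using mult[of "\<lambda>C. symbol ?E C + symbol S C" C, OF nz] mult[of "symbol ?E" C, OF nzE]
          mult[of "symbol S" C, OF nzS]
        by (cases "C \<in> carrier Q") (simp_all only: if_True if_False ring_distribs sum.distrib add_0_left)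
    qed
    then show ?case
      unfolding 1 symbol_add[OF E add(4)] TE add(5) by simp
  qed
qed

lemma symbol_surj:
  assumes "a \<in> carrier (group_algebra Q)"
  shows "\<exists>T\<in>carrier (HA H). symbol T = a"
proof -
  have "\<exists>T\<in>carrier (HA H). symbol T = a" if "finite F" "F \<subseteq> carrier Q" "{C. a C \<noteq> 0} \<subseteq> F" for F a
    using that
  proof (induction F arbitrary: a rule: finite_induct)
    case empty
    then have "a = (\<lambda>C. 0)" by auto
    then show ?case using zero_hecke symbol_0 by blast
  next
    case (insert D F)
    obtain g where g: "g \<in> H" "D = J #> g" using insert.prems(1) by (auto simp: carrier_Q)
    have "{C. (a(D := 0)) C \<noteq> 0} \<subseteq> F" using insert.prems(2) by auto
    then have "\<exists>S\<in>carrier (HA H). symbol S = a(D := 0)"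
      using insert.prems(1) by (intro insert.IH) simp_all
    then obtain S where S: "S \<in> carrier (HA H)" "symbol S = a(D := 0)" by blast
    show ?case
    proof (cases "a D = 0")
      case True
      then have "a(D := 0) = a" by (simp add: fun_eq_iff)
      then show ?thesis using S by auto
    next
      case False
      have U: "intertw g (\<lambda>v. s (a D) (R g v))" by (rule intertw_scale[OF False R[OF g(1)] H_Jt[OF g(1)]])
      let ?E = "coset_op H g (\<lambda>v. s (a D) (R g v))"
      have E: "?E \<in> carrier (HA H)" by (rule coset_op_hecke[OF H g(1) H_Jt[OF g(1)] U])
      have "symbol ?E = (\<lambda>C. if C = J #> g then a D else 0)"
        by (rule symbol_coset_op[OF g(1) U]) simp
      then have "symbol (\<lambda>f\<in>ind H. \<lambda>x. ?E f x + S f x) = a"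
        using symbol_add[OF E S(1)] S(2) g(2) by (auto simp: fun_eq_iff)
      then show ?thesis using hecke_sum[OF H E S(1)] by blast
    qed
  qed
  from this[of "{C. a C \<noteq> 0}" a] show ?thesis using assms by (simp add: group_algebra_def)
qed

lemma symbol_alg_iso: "symbol \<in> alg_iso (HA H) (group_algebra Q)"
proof -
  have "inj_on symbol (carrier (HA H))"
  proof (rule inj_onI)
    fix T S assume T: "T \<in> carrier (HA H)" and S: "S \<in> carrier (HA H)" and eq: "symbol T = symbol S"
    show "T = S"
      by (rule hecke_eqI[OF H T S]) (simp add: kern_symbol T S eq)
  qed
  moreover have "symbol ` carrier (HA H) = carrier (group_algebra Q)"
    using symbol_in symbol_surj by blast
  moreover have "symbol \<in> ring_hom (HA H) (group_algebra Q)"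
  proof (rule ring_hom_memI)
    fix T S assume T: "T \<in> carrier (HA H)" and S: "S \<in> carrier (HA H)"
    show "symbol (T \<otimes>\<^bsub>HA H\<^esub> S) = symbol T \<otimes>\<^bsub>group_algebra Q\<^esub> symbol S" using symbol_mult[OF T S] by simp
    show "symbol (T \<oplus>\<^bsub>HA H\<^esub> S) = symbol T \<oplus>\<^bsub>group_algebra Q\<^esub> symbol S"
      using symbol_add[OF T S] by (simp add: group_algebra_def)
  next
    have one: "(\<lambda>f\<in>ind H. f) \<in> carrier (HA H)"
      by (rule heckeI) (auto simp: ind_add[OF H] ind_scale[OF H] ind_rt_self[OF H])
    have J1: "J = J #> \<one>" using subgroup.subset[OF J] by simp
    have "symbol (\<lambda>f\<in>ind H. f) = (\<lambda>C. if C = J then 1 else 0)"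
    proof (rule symbol_eqI[OF one])
      show "(if C = J then 1 else 0) = (0::complex)" if "C \<notin> carrier Q" for C
        using that J1 level_one[OF H] by (auto simp: carrier_Q)
      fix x v assume x: "x \<in> H"
      have "J #> x = J \<longleftrightarrow> x \<in> J"
        using coset_eq_iff[OF H_carrier[OF x] one_closed] J1 H_carrier[OF x] by simp
      then show "kern (\<lambda>f\<in>ind H. f) x v = s (if J #> x = J then 1 else 0) (R x v)"
        using x by (simp add: kern_one[OF H] R_J)
    qed
    then show "symbol \<one>\<^bsub>HA H\<^esub> = \<one>\<^bsub>group_algebra Q\<^esub>" by (simp add: group_algebra_def)
  next
    fix T assume "T \<in> carrier (HA H)"
    then show "symbol T \<in> carrier (group_algebra Q)" by (rule symbol_in)
  qed
  moreover have "symbol (c \<odot>\<^bsub>HA H\<^esub> T) = c \<odot>\<^bsub>group_algebra Q\<^esub> symbol T" if "T \<in> carrier (HA H)" for c T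
    using symbol_smult[OF that] by (simp add: group_algebra_def)
  ultimately show ?thesis by (simp add: alg_iso_def ring_iso_def bij_betw_def)
qed

end

end

section \<open>Relations between embeddings of irreducible representations\<close>

text \<open>The maps \<open>\<sigma> i\<close> send irreducible \<open>J\<close>-modules to one space, and the claim is that every relation
  between their images also holds for the \<open>\<theta> i\<close>.  Consider relations whose support is minimal.  By
  minimality such a relation is determined by its component at one index \<open>i0\<close> of the support, and by
  irreducibility this component is arbitrary; the other components are therefore \<open>A i x\<close> with
  homomorphisms \<open>A i\<close> of \<open>J\<close>-modules and \<open>x\<close> the component at \<open>i0\<close>.  For these families the
  claim is the assumption \<open>transfer\<close>, and subtracting one of them from a given relation removes
  \<open>i0\<close> from its support.\<close>

lemma relation_transfer:
  fixes s :: "complex \<Rightarrow> 'v::ab_group_add \<Rightarrow> 'v" and t :: "complex \<Rightarrow> 'w::ab_group_add \<Rightarrow> 'w"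
    and \<sigma> \<theta> :: "'i \<Rightarrow> 'v \<Rightarrow> 'w" and \<alpha> :: "'i \<Rightarrow> 'g \<Rightarrow> 'v \<Rightarrow> 'v"
  assumes Y: "finite Y" and s: "vector_space s"
    and simple: "\<And>i. i \<in> Y \<Longrightarrow> simple_action J s (\<alpha> i)"
    and \<alpha>: "\<And>i j. i \<in> Y \<Longrightarrow> j \<in> J \<Longrightarrow> Vector_Spaces.linear s s (\<alpha> i j)"
    and \<sigma>: "\<And>i. i \<in> Y \<Longrightarrow> \<sigma> i \<in> rep_homs J s (\<alpha> i) t B"
    and B: "\<And>j. j \<in> J \<Longrightarrow> Vector_Spaces.linear t t (B j)"
    and \<theta>: "\<And>i. i \<in> Y \<Longrightarrow> Vector_Spaces.linear s t (\<theta> i)"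
    and transfer: "\<And>i0 A x. i0 \<in> Y \<Longrightarrow> (\<And>i. i \<in> Y \<Longrightarrow> A i \<in> rep_homs J s (\<alpha> i0) s (\<alpha> i)) \<Longrightarrow>
      (\<And>x. (\<Sum>i\<in>Y. \<sigma> i (A i x)) = 0) \<Longrightarrow> (\<Sum>i\<in>Y. \<theta> i (A i x)) = 0"
    and "(\<Sum>i\<in>Y. \<sigma> i (v i)) = 0"
  shows "(\<Sum>i\<in>Y. \<theta> i (v i)) = 0"
proof -
  interpret vector_space s by (rule s)
  have \<sigma>_add: "\<sigma> i (x + y) = \<sigma> i x + \<sigma> i y" and \<sigma>_diff: "\<sigma> i (x - y) = \<sigma> i x - \<sigma> i y"
    and \<sigma>_scale: "\<sigma> i (s c x) = t c (\<sigma> i x)" and \<sigma>_0: "\<sigma> i 0 = 0" if "i \<in> Y" for i x y c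
  proof -
    interpret f: Vector_Spaces.linear s t "\<sigma> i" using \<sigma>[OF that] by (simp add: rep_homs_def)
    show "\<sigma> i (x + y) = \<sigma> i x + \<sigma> i y" "\<sigma> i (x - y) = \<sigma> i x - \<sigma> i y"
      "\<sigma> i (s c x) = t c (\<sigma> i x)" "\<sigma> i 0 = 0"
      by (simp_all add: f.add f.diff f.scale)
  qed
  have \<theta>_diff: "\<theta> i (x - y) = \<theta> i x - \<theta> i y" and \<theta>_0: "\<theta> i 0 = 0" if "i \<in> Y" for i x y
  proof -
    interpret f: Vector_Spaces.linear s t "\<theta> i" by (rule \<theta>[OF that])
    show "\<theta> i (x - y) = \<theta> i x - \<theta> i y" "\<theta> i 0 = 0" by (simp_all add: f.diff)
  qed
  have \<alpha>_0: "\<alpha> i j 0 = 0" if "i \<in> Y" "j \<in> J" for i j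
  proof -
    interpret f: Vector_Spaces.linear s s "\<alpha> i j" by (rule \<alpha>[OF that])
    show ?thesis by simp
  qed
  have \<sigma>_\<alpha>: "\<sigma> i (\<alpha> i j x) = B j (\<sigma> i x)" if "i \<in> Y" "j \<in> J" for i j x
    using \<sigma>[OF that(1)] that(2) by (simp add: rep_homs_def)
  define rel where "rel u \<longleftrightarrow> (\<Sum>i\<in>Y. \<sigma> i (u i)) = 0" for u
  define supp where "supp u = {i \<in> Y. u i \<noteq> 0}" for u :: "'i \<Rightarrow> 'v"
  have rel_add: "rel (\<lambda>i. u i + u' i)" and rel_diff: "rel (\<lambda>i. u i - u' i)" if "rel u" "rel u'" for u u'
    using that by (simp_all add: rel_def \<sigma>_add \<sigma>_diff sum.distrib sum_subtractf)
  have rel_scale: "rel (\<lambda>i. s c (u i))" if "rel u" for u c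
  proof (cases "Y = {}")
    case False
    then obtain i where "i \<in> Y" by blast
    then interpret f: Vector_Spaces.linear s t "\<sigma> i" using \<sigma>[OF \<open>i \<in> Y\<close>] by (simp add: rep_homs_def)
    have "(\<Sum>i\<in>Y. \<sigma> i (s c (u i))) = t c (\<Sum>i\<in>Y. \<sigma> i (u i))"
      by (simp add: \<sigma>_scale f.vs2.scale_sum_right)
    then show ?thesis using that by (simp add: rel_def)
  qed (simp add: rel_def)
  have rel_act: "rel (\<lambda>i. \<alpha> i j (u i))" if "rel u" "j \<in> J" for u j
  proof -
    interpret f: Vector_Spaces.linear t t "B j" by (rule B[OF that(2)])
    have "(\<Sum>i\<in>Y. \<sigma> i (\<alpha> i j (u i))) = B j (\<Sum>i\<in>Y. \<sigma> i (u i))"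
      using that(2) by (simp add: \<sigma>_\<alpha> f.sum)
    then show ?thesis using that(1) by (simp add: rel_def)
  qed
  have supp_add: "supp (\<lambda>i. u i + u' i) \<subseteq> supp u \<union> supp u'"
    and supp_diff: "supp (\<lambda>i. u i - u' i) \<subseteq> supp u \<union> supp u'"
    and supp_scale: "supp (\<lambda>i. s c (u i)) \<subseteq> supp u" for u u' c
    by (auto simp: supp_def)
  have supp_act: "supp (\<lambda>i. \<alpha> i j (u i)) \<subseteq> supp u" if "j \<in> J" for j u
    using \<alpha>_0 that by (auto simp: supp_def)
  have "rel v" using assms(9) by (simp add: rel_def)
  then show ?thesis
  proof (induction "card (supp v)" arbitrary: v rule: less_induct)
    case less
    have fin: "finite (supp u)" for u using Y by (simp add: supp_def)
    show ?case
    proof (cases "supp v = {}")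
      case True
      then have "v i = 0" if "i \<in> Y" for i using that by (auto simp: supp_def)
      then show ?thesis by (simp add: \<theta>_0)
    next
      case False
      let ?P = "\<lambda>u. rel u \<and> supp u \<noteq> {} \<and> supp u \<subseteq> supp v"
      have "?P v" using less.prems False by simp
      from ex_has_least_nat[of ?P, OF this, of "\<lambda>u. card (supp u)"]
      obtain u where u: "rel u" "supp u \<noteq> {}" "supp u \<subseteq> supp v"
        and least: "\<And>u'. ?P u' \<Longrightarrow> card (supp u) \<le> card (supp u')" by blast
      obtain i0 where i0: "i0 \<in> supp u" using u(2) by blast
      then have i0Y: "i0 \<in> Y" by (simp add: supp_def)
      have uniq: "u' i = 0" if u': "rel u'" "supp u' \<subseteq> supp u" "u' i0 = 0" and i: "i \<in> Y" for u' i
      proof (rule ccontr)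
        assume "u' i \<noteq> 0"
        then have "supp u' \<noteq> {}" using i by (auto simp: supp_def)
        then have "card (supp u) \<le> card (supp u')" using least[of u'] u' u(3) by blast
        moreover have "supp u' \<subset> supp u" using u'(2,3) i0 by (auto simp: supp_def)
        then have "card (supp u') < card (supp u)" by (rule psubset_card_mono[OF fin])
        ultimately show False by simp
      qed
      let ?L = "{x. \<exists>u'. rel u' \<and> supp u' \<subseteq> supp u \<and> u' i0 = x}"
      have "?L = {0} \<or> ?L = UNIV"
      proof (rule simple_actionD[OF simple[OF i0Y]])
        show "subspace ?L"
        proof (rule subspaceI)
          have "rel (\<lambda>i. 0)" by (simp add: rel_def \<sigma>_0)
          then show "0 \<in> ?L" by (auto simp: supp_def intro!: exI[of _ "\<lambda>i. 0"])
        next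
          fix x y assume "x \<in> ?L" "y \<in> ?L"
          then obtain u1 u2 where "rel u1" "supp u1 \<subseteq> supp u" "u1 i0 = x" "rel u2" "supp u2 \<subseteq> supp u" "u2 i0 = y"
            by blast
          then show "x + y \<in> ?L"
            using rel_add[of u1 u2] supp_add[of u1 u2]
            by (intro CollectI exI[of _ "\<lambda>i. u1 i + u2 i"]) auto
        next
          fix c x assume "x \<in> ?L"
          then obtain u1 where "rel u1" "supp u1 \<subseteq> supp u" "u1 i0 = x" by blast
          then show "s c x \<in> ?L"
            using rel_scale[of u1 c] supp_scale[of c u1]
            by (intro CollectI exI[of _ "\<lambda>i. s c (u1 i)"]) auto
        qed
        fix j x assume j: "j \<in> J" and "x \<in> ?L"
        then obtain u1 where u1: "rel u1" "supp u1 \<subseteq> supp u" "u1 i0 = x" by blast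
        show "\<alpha> i0 j x \<in> ?L"
          using rel_act[OF u1(1) j] u1 supp_act[OF j, of u1] by (intro CollectI exI[of _ "\<lambda>i. \<alpha> i j (u1 i)"]) auto
      qed
      moreover have "u i0 \<in> ?L" using u(1) by blast
      moreover have "u i0 \<noteq> 0" using i0 by (simp add: supp_def)
      ultimately have "?L = UNIV" by blast
      then have "\<exists>u'. rel u' \<and> supp u' \<subseteq> supp u \<and> u' i0 = x" for x by blast
      then obtain r where r: "\<And>x. rel (r x)" "\<And>x. supp (r x) \<subseteq> supp u" "\<And>x. r x i0 = x"
        by (metis (no_types, lifting))
      define A where "A i x = r x i" for i x
      have supp_diff': "supp (\<lambda>i. u1 i - u2 i) \<subseteq> supp u" if "supp u1 \<subseteq> supp u" "supp u2 \<subseteq> supp u" for u1 u2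
        using that supp_diff[of u1 u2] by blast
      have A: "A i \<in> rep_homs J s (\<alpha> i0) s (\<alpha> i)" if i: "i \<in> Y" for i
        unfolding rep_homs_def
      proof (intro CollectI conjI ballI allI)
        show "Vector_Spaces.linear s s (A i)"
        proof unfold_locales
          fix x y
          have "r (x + y) i - (r x i + r y i) = 0"
          proof (rule uniq[of "\<lambda>i. r (x + y) i - (r x i + r y i)", OF _ _ _ i])
            show "rel (\<lambda>i. r (x + y) i - (r x i + r y i))" by (intro rel_diff rel_add r)
            have "supp (\<lambda>i. r x i + r y i) \<subseteq> supp u" using r(2)[of x] r(2)[of y] supp_add[of "r x" "r y"] by blast
            then show "supp (\<lambda>i. r (x + y) i - (r x i + r y i)) \<subseteq> supp u" by (rule supp_diff'[OF r(2)])
          qed (simp add: r)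
          then show "A i (x + y) = A i x + A i y" by (simp add: A_def)
        next
          fix c x
          have "r (s c x) i - s c (r x i) = 0"
          proof (rule uniq[of "\<lambda>i. r (s c x) i - s c (r x i)", OF _ _ _ i])
            show "rel (\<lambda>i. r (s c x) i - s c (r x i))" by (intro rel_diff rel_scale r)
            have "supp (\<lambda>i. s c (r x i)) \<subseteq> supp u" using r(2)[of x] supp_scale[of c "r x"] by blast
            then show "supp (\<lambda>i. r (s c x) i - s c (r x i)) \<subseteq> supp u" by (rule supp_diff'[OF r(2)])
          qed (simp add: r)
          then show "A i (s c x) = s c (A i x)" by (simp add: A_def)
        qed
        fix j x assume j: "j \<in> J"
        have "r (\<alpha> i0 j x) i - \<alpha> i j (r x i) = 0"
        proof (rule uniq[of "\<lambda>i. r (\<alpha> i0 j x) i - \<alpha> i j (r x i)", OF _ _ _ i])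
          show "rel (\<lambda>i. r (\<alpha> i0 j x) i - \<alpha> i j (r x i))" by (intro rel_diff rel_act r j)
          have "supp (\<lambda>i. \<alpha> i j (r x i)) \<subseteq> supp u" using r(2)[of x] supp_act[OF j, of "r x"] by blast
          then show "supp (\<lambda>i. r (\<alpha> i0 j x) i - \<alpha> i j (r x i)) \<subseteq> supp u" by (rule supp_diff'[OF r(2)])
        qed (simp add: r)
        then show "A i (\<alpha> i0 j x) = \<alpha> i j (A i x)" by (simp add: A_def)
      qed
      have A_rel: "(\<Sum>i\<in>Y. \<sigma> i (A i x)) = 0" for x using r(1)[of x] by (simp add: A_def rel_def)
      have "(\<Sum>i\<in>Y. \<theta> i (A i (v i0))) = 0" by (rule transfer[OF i0Y A A_rel])
      moreover have "(\<Sum>i\<in>Y. \<theta> i (v i - A i (v i0))) = 0"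
      proof (rule less.hyps)
        show "rel (\<lambda>i. v i - A i (v i0))" unfolding A_def by (intro rel_diff less.prems r)
        have "supp (\<lambda>i. v i - A i (v i0)) \<subseteq> supp v"
          using r(2)[of "v i0"] u(3) supp_diff[of v "r (v i0)"] unfolding A_def by blast
        moreover have "i0 \<notin> supp (\<lambda>i. v i - A i (v i0))"
          by (simp add: supp_def A_def r(3))
        ultimately have "supp (\<lambda>i. v i - A i (v i0)) \<subset> supp v" using i0 u(3) by blast
        then show "card (supp (\<lambda>i. v i - A i (v i0))) < card (supp v)" by (rule psubset_card_mono[OF fin])
      qed
      ultimately show ?thesis by (simp add: \<theta>_diff sum_subtractf)
    qed
  qed
qed

section \<open>Twists of the big representation\<close>

locale clifford_cover = clifford_pair G J s \<rho> Jt
  for G :: "('g::topological_space, 'm) monoid_scheme" (structure)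
    and J and s :: "complex \<Rightarrow> 'v::ab_group_add \<Rightarrow> 'v" and \<rho> and Jt +
  fixes st :: "complex \<Rightarrow> 'w::ab_group_add \<Rightarrow> 'w" and \<rho>t :: "'g \<Rightarrow> 'w \<Rightarrow> 'w" and \<phi> :: "'v \<Rightarrow> 'w"
  assumes \<rho>t: "irreducible_rep G Jt st \<rho>t"
    and \<phi>: "\<phi> \<in> rep_homs J s \<rho> st \<rho>t" and \<phi>_inj: "inj \<phi>"
begin

lemma smooth_\<rho>t: "smooth_rep G Jt st \<rho>t"
  using \<rho>t by (simp add: irreducible_rep_def)

sublocale wt: vector_space st
  using smooth_\<rho>t by (simp add: smooth_rep_def)

lemma \<rho>t_linear: "x \<in> Jt \<Longrightarrow> Vector_Spaces.linear st st (\<rho>t x)"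
  and \<rho>t_mult: "x \<in> Jt \<Longrightarrow> y \<in> Jt \<Longrightarrow> \<rho>t (x \<otimes> y) w = \<rho>t x (\<rho>t y w)"
  and \<rho>t_one: "\<rho>t \<one> w = w"
  using smooth_\<rho>t by (simp_all add: smooth_rep_def)

lemma \<rho>t_add: "x \<in> Jt \<Longrightarrow> \<rho>t x (w + w') = \<rho>t x w + \<rho>t x w'"
  and \<rho>t_scale: "x \<in> Jt \<Longrightarrow> \<rho>t x (st c w) = st c (\<rho>t x w)"
  and \<rho>t_zero: "x \<in> Jt \<Longrightarrow> \<rho>t x 0 = 0"
  and \<rho>t_sum: "x \<in> Jt \<Longrightarrow> \<rho>t x (\<Sum>i\<in>Y. F i) = (\<Sum>i\<in>Y. \<rho>t x (F i))"
proof -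
  assume "x \<in> Jt"
  then interpret x: Vector_Spaces.linear st st "\<rho>t x" by (rule \<rho>t_linear)
  show "\<rho>t x (w + w') = \<rho>t x w + \<rho>t x w'" "\<rho>t x (st c w) = st c (\<rho>t x w)" "\<rho>t x 0 = 0"
    "\<rho>t x (\<Sum>i\<in>Y. F i) = (\<Sum>i\<in>Y. \<rho>t x (F i))"
    by (simp_all add: x.add x.scale x.sum)
qed

lemma \<rho>t_inv: "x \<in> Jt \<Longrightarrow> \<rho>t (inv x) (\<rho>t x w) = w" "x \<in> Jt \<Longrightarrow> \<rho>t x (\<rho>t (inv x) w) = w"
  using \<rho>t_mult[of "inv x" x w] \<rho>t_mult[of x "inv x" w] by (simp_all add: Jt_inv Jt_carrier \<rho>t_one)

lemma simple_\<rho>t: "simple_action Jt st \<rho>t"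
  using \<rho>t by (simp add: irreducible_rep_def simple_action_def)

text \<open>All copies of \<open>\<rho>\<close> in \<open>\<rho>t\<close> are needed, not only \<open>\<phi>\<close>: a twist of \<open>\<rho>t\<close> may move \<open>\<phi>\<close> to another
  copy.\<close>

definition homs :: "('v \<Rightarrow> 'w) set" where
  "homs = rep_homs J s \<rho> st \<rho>t"

lemma homs_linear: "f \<in> homs \<Longrightarrow> Vector_Spaces.linear s st f"
  and homs_J: "f \<in> homs \<Longrightarrow> j \<in> J \<Longrightarrow> f (\<rho> j v) = \<rho>t j (f v)"
  by (simp_all add: homs_def rep_homs_def)

lemma homs_scale: "f \<in> homs \<Longrightarrow> f (s c v) = st c (f v)"
  and homs_add: "f \<in> homs \<Longrightarrow> f (v + v') = f v + f v'"
  and homs_zero: "f \<in> homs \<Longrightarrow> f 0 = 0"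
proof -
  assume "f \<in> homs"
  then interpret f: Vector_Spaces.linear s st f by (rule homs_linear)
  show "f (s c v) = st c (f v)" "f (v + v') = f v + f v'" "f 0 = 0" by (simp_all add: f.scale f.add)
qed

context
  fixes h U and \<omega> :: "'g \<Rightarrow> complex"
  assumes h: "h \<in> stab" and U: "intertw h U"
    and \<omega>: "\<omega> \<in> quotient_characters G Jt J" and \<omega>_\<beta>: "\<And>k. k \<in> stab \<Longrightarrow> \<omega> k = \<beta> k h"
begin

lemma \<omega>_mult: "x \<in> Jt \<Longrightarrow> y \<in> Jt \<Longrightarrow> \<omega> (x \<otimes> y) = \<omega> x * \<omega> y"
  and \<omega>_nz: "x \<in> Jt \<Longrightarrow> \<omega> x \<noteq> 0"
  and \<omega>_J: "x \<in> J \<Longrightarrow> \<omega> x = 1"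
  using \<omega> by (auto simp: quotient_characters_def hom_def mult_group_def)

text \<open>The vectors \<open>src i v\<close>, for \<open>i = (y, f)\<close>, span the space of \<open>\<rho>t\<close>.  The vector \<open>dst i v\<close> is the
  image of \<open>src i v\<close> under the isomorphism from the twist of \<open>\<rho>t\<close> by \<open>\<omega>\<close> to \<open>\<rho>t\<close> that is
  under construction; equivariance forces it once the image of \<open>f v\<close> is
  \<open>\<rho>t (inv h) (f (U v))\<close>.\<close>

definition src :: "'g \<times> ('v \<Rightarrow> 'w) \<Rightarrow> 'v \<Rightarrow> 'w" where
  "src i v = \<rho>t (fst i) (snd i v)"

definition dst :: "'g \<times> ('v \<Rightarrow> 'w) \<Rightarrow> 'v \<Rightarrow> 'w" where
  "dst i v = st (inverse (\<omega> (fst i))) (\<rho>t (fst i \<otimes> inv h) (snd i (U v)))"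

text \<open>Moving \<open>U\<close> past \<open>A\<close> produces the scalar \<open>\<beta> k h\<close> with \<open>k = y\<^sup>-\<^sup>1 y1\<close>, and the values of \<open>\<omega>\<close> at
  \<open>y\<close> and \<open>y1\<close> differ by \<open>\<omega> k\<close>.  As \<open>\<omega> k = \<beta> k h\<close>, the result depends on \<open>y1\<close> only, so \<open>dst\<close> arises
  from \<open>src\<close> by an operator common to all terms of a relation.\<close>

lemma dst_src_twist:
  assumes y: "y \<in> Jt" "y1 \<in> Jt" and f: "f \<in> homs" and A: "twist (inv y \<otimes> y1) A"
  shows "dst (y, f) (A v) = st (inverse (\<omega> y1)) (\<rho>t (y1 \<otimes> inv h \<otimes> inv y1) (src (y, f) (A (U v))))"
proof -
  let ?k = "inv y \<otimes> y1"
  have hJ: "h \<in> Jt" by (rule stab_Jt[OF h])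
  have kJ: "?k \<in> Jt" by (rule Jt_mult[OF Jt_inv[OF y(1)] y(2)])
  have yh: "y \<otimes> inv h \<in> Jt" by (rule Jt_mult[OF y(1) Jt_inv[OF hJ]])
  have yc: "y1 \<otimes> inv h \<otimes> inv y1 \<in> Jt" by (intro Jt_mult Jt_inv y hJ)
  have G: "y \<in> carrier G" "y1 \<in> carrier G" "h \<in> carrier G" using y hJ Jt_carrier by auto
  show ?thesis
  proof (cases "\<forall>v. A v = 0")
    case True
    then show ?thesis
      using intertw_zero_iff[OF U, of 0] by (simp add: dst_def src_def homs_zero[OF f] \<rho>t_zero y yh yc)
  next
    case False
    then obtain v0 where "A v0 \<noteq> 0" by blast
    then have A: "intertw ?k A" by (rule twist_intertw[OF kJ A])
    then have ks: "?k \<in> stab" using kJ by (auto simp: stab_def)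
    let ?c = "?k \<otimes> h \<otimes> inv ?k \<otimes> inv h"
    have c: "?c \<in> J" by (rule commutators[OF kJ hJ])
    have nz: "\<beta> ?k h \<noteq> 0" by (rule \<beta>_nonzero[OF ks h])
    have "A (U v) = s (\<beta> ?k h) (\<rho> ?c (U (A v)))"
      using comm_rel_\<beta>[OF ks h A U] by (simp add: comm_rel_def)
    then have UA: "U (A v) = s (inverse (\<beta> ?k h)) (\<rho> (inv ?c) (A (U v)))"
      using nz by (simp add: \<rho>_scale[OF J_inv[OF c]] \<rho>_inv[OF c])
    have "y1 = y \<otimes> ?k" using G by simp
    then have "\<omega> y1 = \<omega> y * \<beta> ?k h" using \<omega>_mult[OF y(1) kJ] \<omega>_\<beta>[OF ks] by simp
    then have \<omega>y: "inverse (\<omega> y) * inverse (\<beta> ?k h) = inverse (\<omega> y1)" by simp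
    have word: "(y \<otimes> inv h) \<otimes> inv ?c = (y1 \<otimes> inv h \<otimes> inv y1) \<otimes> y"
      using G by (simp add: m_assoc inv_mult_group)
    have "\<rho>t (y \<otimes> inv h) (f (U (A v))) =
        st (inverse (\<beta> ?k h)) (\<rho>t (y \<otimes> inv h) (\<rho>t (inv ?c) (f (A (U v)))))"
      by (simp only: UA homs_scale[OF f] homs_J[OF f J_inv[OF c]] \<rho>t_scale[OF yh])
    also have "\<rho>t (y \<otimes> inv h) (\<rho>t (inv ?c) (f (A (U v)))) = \<rho>t ((y1 \<otimes> inv h \<otimes> inv y1) \<otimes> y) (f (A (U v)))"
      by (simp only: \<rho>t_mult[OF yh Jt_J[OF J_inv[OF c]], symmetric] word)
    also have "\<dots> = \<rho>t (y1 \<otimes> inv h \<otimes> inv y1) (\<rho>t y (f (A (U v))))" by (rule \<rho>t_mult[OF yc y(1)])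
    finally show ?thesis by (simp only: dst_def src_def fst_conv snd_conv wt.scale_scale \<omega>y)
  qed
qed

lemma dst_sum_zero:
  assumes Y: "finite Y" "Y \<subseteq> Jt \<times> homs" and zero: "(\<Sum>i\<in>Y. src i (v i)) = 0"
  shows "(\<Sum>i\<in>Y. dst i (v i)) = 0"
proof (rule relation_transfer[of Y s J "\<lambda>i j. \<rho> (inv (fst i) \<otimes> j \<otimes> fst i)" src st \<rho>t])
  have i: "fst i \<in> Jt" "snd i \<in> homs" if "i \<in> Y" for i using that Y(2) by auto
  have conj: "fst i \<otimes> (inv (fst i) \<otimes> j \<otimes> fst i) = j \<otimes> fst i" if "i \<in> Y" "j \<in> J" for i j
    using i[OF that(1)] that(2) by (simp add: m_assoc Jt_carrier J_carrier)
  show "simple_action J s (\<lambda>j. \<rho> (inv (fst i) \<otimes> j \<otimes> fst i))" if iY: "i \<in> Y" for i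
    unfolding simple_action_def
  proof (intro allI impI; elim conjE)
    fix L assume L: "vs.subspace L" and stable: "\<forall>j\<in>J. \<forall>w\<in>L. \<rho> (inv (fst i) \<otimes> j \<otimes> fst i) w \<in> L"
    show "L = {0} \<or> L = UNIV"
    proof (rule simple_actionD[OF simple_\<rho> L])
      fix j w assume j: "j \<in> J" and w: "w \<in> L"
      have "\<rho> (inv (fst i) \<otimes> (fst i \<otimes> j \<otimes> inv (fst i)) \<otimes> fst i) w \<in> L"
        using stable J_conj[OF i(1)[OF iY] j] w by blast
      moreover have "inv (fst i) \<otimes> (fst i \<otimes> j \<otimes> inv (fst i)) \<otimes> fst i = j"
        using i[OF iY] j by (simp add: m_assoc Jt_carrier J_carrier)
      ultimately show "\<rho> j w \<in> L" by simp
    qed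
  qed
  show "Vector_Spaces.linear s s (\<rho> (inv (fst i) \<otimes> j \<otimes> fst i))" if "i \<in> Y" "j \<in> J" for i j
    by (rule \<rho>_linear[OF J_conj_inv[OF i(1)[OF that(1)] that(2)]])
  show "src i \<in> rep_homs J s (\<lambda>j. \<rho> (inv (fst i) \<otimes> j \<otimes> fst i)) st \<rho>t" if iY: "i \<in> Y" for i
    unfolding rep_homs_def
  proof (intro CollectI conjI ballI allI)
    show "Vector_Spaces.linear s st (src i)"
      by unfold_locales (simp_all add: src_def homs_add homs_scale \<rho>t_add \<rho>t_scale i[OF iY])
    fix j v assume j: "j \<in> J"
    have k: "inv (fst i) \<otimes> j \<otimes> fst i \<in> J" by (rule J_conj_inv[OF i(1)[OF iY] j])
    show "src i (\<rho> (inv (fst i) \<otimes> j \<otimes> fst i) v) = \<rho>t j (src i v)"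
      unfolding src_def homs_J[OF i(2)[OF iY] k] \<rho>t_mult[OF i(1)[OF iY] Jt_J[OF k], symmetric]
        \<rho>t_mult[OF Jt_J[OF j] i(1)[OF iY], symmetric] conj[OF iY j] ..
  qed
  show "Vector_Spaces.linear st st (\<rho>t j)" if "j \<in> J" for j by (rule \<rho>t_linear[OF Jt_J[OF that]])
  show "Vector_Spaces.linear s st (dst i)" if iY: "i \<in> Y" for i
  proof -
    have x: "fst i \<otimes> inv h \<in> Jt" by (intro Jt_mult Jt_inv i iY stab_Jt[OF h])
    have Ua: "U (a + b) = U a + U b" for a b
      using U by (simp add: intertw_def twist_def endo_add)
    show ?thesis
      by unfold_locales (simp_all add: dst_def Ua intertw_scale_apply[OF U] homs_add homs_scale \<rho>t_add
        \<rho>t_scale i[OF iY] x wt.scale_right_distrib mult.commute)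
  qed
  fix i0 A x
  assume i0: "i0 \<in> Y"
    and A: "\<And>i. i \<in> Y \<Longrightarrow> A i \<in> rep_homs J s (\<lambda>j. \<rho> (inv (fst i0) \<otimes> j \<otimes> fst i0)) s
        (\<lambda>j. \<rho> (inv (fst i) \<otimes> j \<otimes> fst i))"
    and A0: "\<And>x. (\<Sum>i\<in>Y. src i (A i x)) = 0"
  let ?y1 = "fst i0"
  let ?D = "\<lambda>w. st (inverse (\<omega> ?y1)) (\<rho>t (?y1 \<otimes> inv h \<otimes> inv ?y1) w)"
  have y1: "?y1 \<in> Jt" by (rule i(1)[OF i0])
  have c: "?y1 \<otimes> inv h \<otimes> inv ?y1 \<in> Jt" by (intro Jt_mult Jt_inv y1 stab_Jt[OF h])
  have "dst i (A i x) = ?D (src i (A i (U x)))" if iY: "i \<in> Y" for i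
  proof -
    have G: "fst i \<in> carrier G" "?y1 \<in> carrier G" using i(1)[OF iY] y1 Jt_carrier by auto
    have "twist (inv (fst i) \<otimes> ?y1) (A i)"
      unfolding twist_def
    proof (intro conjI ballI allI)
      show "Vector_Spaces.linear s s (A i)" using A[OF iY] by (simp add: rep_homs_def)
      fix j v assume j: "j \<in> J"
      have jG: "j \<in> carrier G" by (rule J_carrier[OF j])
      have "A i (\<rho> (inv ?y1 \<otimes> (?y1 \<otimes> j \<otimes> inv ?y1) \<otimes> ?y1) v) =
          \<rho> (inv (fst i) \<otimes> (?y1 \<otimes> j \<otimes> inv ?y1) \<otimes> fst i) (A i v)"
        using A[OF iY] J_conj[OF y1 j] by (simp add: rep_homs_def)
      moreover have "inv ?y1 \<otimes> (?y1 \<otimes> j \<otimes> inv ?y1) \<otimes> ?y1 = j"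
        using G jG by (simp add: m_assoc)
      moreover have "inv (fst i) \<otimes> (?y1 \<otimes> j \<otimes> inv ?y1) \<otimes> fst i =
          inv (fst i) \<otimes> ?y1 \<otimes> j \<otimes> inv (inv (fst i) \<otimes> ?y1)"
        using G jG by (simp add: m_assoc inv_mult_group)
      ultimately show "A i (\<rho> j v) = \<rho> (inv (fst i) \<otimes> ?y1 \<otimes> j \<otimes> inv (inv (fst i) \<otimes> ?y1)) (A i v)"
        by simp
    qed
    from dst_src_twist[OF i(1)[OF iY] y1 i(2)[OF iY] this, of x] show ?thesis by simp
  qed
  then have "(\<Sum>i\<in>Y. dst i (A i x)) = ?D (\<Sum>i\<in>Y. src i (A i (U x)))"
    by (simp add: \<rho>t_sum[OF c] wt.scale_sum_right)
  then show "(\<Sum>i\<in>Y. dst i (A i x)) = 0" by (simp add: A0 \<rho>t_zero[OF c])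
qed (use Y zero vs.vector_space_axioms in simp_all)

text \<open>The isomorphism is obtained from its graph: \<open>dst_sum_zero\<close> says that the graph is single-valued,
  and its domain is everything because \<open>\<rho>t\<close> is irreducible.\<close>

definition graph :: "('w \<times> 'w) set" where
  "graph = {(\<Sum>i\<in>Y. src i (v i), \<Sum>i\<in>Y. dst i (v i)) | Y v. finite Y \<and> Y \<subseteq> Jt \<times> homs}"

lemma src_zero: "i \<in> Jt \<times> homs \<Longrightarrow> src i 0 = 0"
  and src_add: "i \<in> Jt \<times> homs \<Longrightarrow> src i (v + v') = src i v + src i v'"
  and src_scale: "i \<in> Jt \<times> homs \<Longrightarrow> src i (s c v) = st c (src i v)"
  by (auto simp: src_def homs_zero homs_add homs_scale \<rho>t_zero \<rho>t_add \<rho>t_scale)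

lemma dst_add: "i \<in> Jt \<times> homs \<Longrightarrow> dst i (v + v') = dst i v + dst i v'"
  and dst_scale: "i \<in> Jt \<times> homs \<Longrightarrow> dst i (s c v) = st c (dst i v)"
  and dst_zero: "i \<in> Jt \<times> homs \<Longrightarrow> dst i 0 = 0"
proof -
  assume i: "i \<in> Jt \<times> homs"
  have x: "fst i \<otimes> inv h \<in> Jt" using i by (intro Jt_mult Jt_inv stab_Jt[OF h]) auto
  have f: "snd i \<in> homs" using i by auto
  have Ua: "U (a + b) = U a + U b" for a b
    using U by (simp add: intertw_def twist_def endo_add)
  show "dst i (v + v') = dst i v + dst i v'" "dst i (s c v) = st c (dst i v)" "dst i 0 = 0"
    using intertw_zero_iff[OF U, of 0] by (simp_all add: dst_def Ua intertw_scale_apply[OF U] homs_add[OF f] homs_scale[OF f] homs_zero[OF f]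
        \<rho>t_add[OF x] \<rho>t_scale[OF x] \<rho>t_zero[OF x] wt.scale_right_distrib mult.commute)
qed

lemma graph_single: "i \<in> Jt \<times> homs \<Longrightarrow> (src i v, dst i v) \<in> graph"
  unfolding graph_def by (rule CollectI, rule exI[of _ "{i}"], rule exI[of _ "\<lambda>_. v"]) simp

lemma graph_add:
  assumes "(w, w') \<in> graph" "(x, x') \<in> graph"
  shows "(w + x, w' + x') \<in> graph"
proof -
  obtain Y v where Y: "finite Y" "Y \<subseteq> Jt \<times> homs" "w = (\<Sum>i\<in>Y. src i (v i))" "w' = (\<Sum>i\<in>Y. dst i (v i))"
    using assms(1) by (auto simp: graph_def)
  obtain Y' v' where Y': "finite Y'" "Y' \<subseteq> Jt \<times> homs" "x = (\<Sum>i\<in>Y'. src i (v' i))" "x' = (\<Sum>i\<in>Y'. dst i (v' i))"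
    using assms(2) by (auto simp: graph_def)
  define u where "u i = (if i \<in> Y then v i else 0)" for i
  define u' where "u' i = (if i \<in> Y' then v' i else 0)" for i
  let ?Z = "Y \<union> Y'"
  have Z: "finite ?Z" "?Z \<subseteq> Jt \<times> homs" using Y Y' by auto
  have zero: "src i 0 = 0" "dst i 0 = 0" if "i \<in> ?Z" for i
    using that Z(2) src_zero[of i] dst_zero[of i] by auto
  have "w = (\<Sum>i\<in>?Z. src i (u i))" "w' = (\<Sum>i\<in>?Z. dst i (u i))"
    unfolding Y(3,4) using Z(1) zero by (auto intro!: sum.mono_neutral_cong_left simp: u_def)
  moreover have "x = (\<Sum>i\<in>?Z. src i (u' i))" "x' = (\<Sum>i\<in>?Z. dst i (u' i))"
    unfolding Y'(3,4) using Z(1) zero by (auto intro!: sum.mono_neutral_cong_left simp: u'_def)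
  ultimately have "w + x = (\<Sum>i\<in>?Z. src i (u i + u' i))" "w' + x' = (\<Sum>i\<in>?Z. dst i (u i + u' i))"
    by (simp_all only: sum.distrib[symmetric] src_add[OF subsetD[OF Z(2)]] dst_add[OF subsetD[OF Z(2)]]
        cong: sum.cong)
  then show ?thesis
    unfolding graph_def using Z by (intro CollectI exI[of _ ?Z] exI[of _ "\<lambda>i. u i + u' i"]) simp
qed

lemma graph_scale:
  assumes "(w, w') \<in> graph" shows "(st c w, st c w') \<in> graph"
proof -
  obtain Y v where Y: "finite Y" "Y \<subseteq> Jt \<times> homs" "w = (\<Sum>i\<in>Y. src i (v i))" "w' = (\<Sum>i\<in>Y. dst i (v i))"
    using assms(1) by (auto simp: graph_def)
  have "st c w = (\<Sum>i\<in>Y. src i (s c (v i)))" "st c w' = (\<Sum>i\<in>Y. dst i (s c (v i)))"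
    using src_scale[OF subsetD[OF Y(2)]] dst_scale[OF subsetD[OF Y(2)]]
    by (simp_all add: Y(3,4) wt.scale_sum_right cong: sum.cong)
  then show ?thesis
    unfolding graph_def using Y by (intro CollectI exI[of _ Y] exI[of _ "\<lambda>i. s c (v i)"]) simp
qed

lemma graph_0: "(0, 0) \<in> graph"
  unfolding graph_def by (rule CollectI, rule exI[of _ "{}"]) simp

lemma graph_sum:
  assumes "\<And>i. i \<in> Y \<Longrightarrow> (a i, b i) \<in> graph"
  shows "(\<Sum>i\<in>Y. a i, \<Sum>i\<in>Y. b i) \<in> graph"
  using assms by (induction Y rule: infinite_finite_induct) (simp_all add: graph_0 graph_add)

lemma graph_act:
  assumes x: "x \<in> Jt" and "(w, w') \<in> graph"
  shows "(\<rho>t x w, st (inverse (\<omega> x)) (\<rho>t x w')) \<in> graph"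
proof -
  obtain Y v where Y: "finite Y" "Y \<subseteq> Jt \<times> homs" "w = (\<Sum>i\<in>Y. src i (v i))" "w' = (\<Sum>i\<in>Y. dst i (v i))"
    using assms(2) by (auto simp: graph_def)
  have "(\<rho>t x (src i (v i)), st (inverse (\<omega> x)) (\<rho>t x (dst i (v i)))) \<in> graph" if iY: "i \<in> Y" for i
  proof -
    obtain y f where i: "i = (y, f)" "y \<in> Jt" "f \<in> homs" using iY Y(2) by auto
    have yh: "y \<otimes> inv h \<in> Jt" by (intro Jt_mult Jt_inv i stab_Jt[OF h])
    have assoc: "x \<otimes> y \<otimes> inv h = x \<otimes> (y \<otimes> inv h)"
      using x i(2) stab_carrier[OF h] Jt_carrier by (simp add: m_assoc)
    have "src (x \<otimes> y, f) (v i) = \<rho>t x (src i (v i))"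
      using x i by (simp add: src_def \<rho>t_mult)
    moreover have "dst (x \<otimes> y, f) (v i) = st (inverse (\<omega> x)) (\<rho>t x (dst i (v i)))"
      unfolding dst_def i(1) fst_conv snd_conv assoc \<rho>t_mult[OF x yh] \<rho>t_scale[OF x] \<omega>_mult[OF x i(2)]
      by (simp add: mult.commute)
    ultimately show ?thesis
      using graph_single[of "(x \<otimes> y, f)" "v i"] i x by (simp add: Jt_mult)
  qed
  then have "(\<Sum>i\<in>Y. \<rho>t x (src i (v i)), \<Sum>i\<in>Y. st (inverse (\<omega> x)) (\<rho>t x (dst i (v i)))) \<in> graph"
    by (rule graph_sum)
  then show ?thesis by (simp add: Y(3,4) \<rho>t_sum[OF x] wt.scale_sum_right)
qed

lemma graph_functional:
  assumes "(w, a) \<in> graph" "(w, b) \<in> graph" shows "a = b"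
proof -
  have "(w + st (-1) w, a + st (-1) b) \<in> graph"
    by (intro graph_add graph_scale assms)
  then have "(0, a - b) \<in> graph" by simp
  then obtain Y v where Y: "finite Y" "Y \<subseteq> Jt \<times> homs" "0 = (\<Sum>i\<in>Y. src i (v i))" "a - b = (\<Sum>i\<in>Y. dst i (v i))"
    by (auto simp: graph_def)
  have "(\<Sum>i\<in>Y. dst i (v i)) = 0" by (rule dst_sum_zero[OF Y(1,2) Y(3)[symmetric]])
  then show ?thesis using Y(4) by simp
qed

lemma graph_total: "\<exists>w'. (w, w') \<in> graph"
proof -
  let ?D = "{w. \<exists>w'. (w, w') \<in> graph}"
  have "?D = {0} \<or> ?D = UNIV"
  proof (rule simple_actionD[OF simple_\<rho>t])
    show "wt.subspace ?D"
      by (rule wt.subspaceI) (use graph_0 graph_add graph_scale in blast)+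
    show "\<rho>t x w \<in> ?D" if "x \<in> Jt" "w \<in> ?D" for x w using that graph_act by blast
  qed
  moreover obtain v :: 'v where v: "v \<noteq> 0" using nontrivial by blast
  have \<phi>h: "\<phi> \<in> homs" using \<phi> by (simp add: homs_def)
  have "src (\<one>, \<phi>) v \<in> ?D" using graph_single[of "(\<one>, \<phi>)" v] \<phi>h Jt_one by auto
  moreover have "src (\<one>, \<phi>) v \<noteq> 0"
    using injD[OF \<phi>_inj, of v 0] v homs_zero[OF \<phi>h] by (auto simp: src_def \<rho>t_one)
  ultimately show ?thesis by blast
qed

text \<open>The twist of \<open>\<rho>t\<close> by any extension \<open>\<omega>\<close> of the character \<open>\<lambda>k. \<beta> k h\<close> is isomorphic to \<open>\<rho>t\<close>.  The
  formula on the copies of \<open>\<rho>\<close> determines the isomorphism.\<close>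

lemma twist_iso:
  "\<exists>\<Psi>\<in>rep_homs Jt st (\<lambda>y w. st (\<omega> y) (\<rho>t y w)) st \<rho>t. bij \<Psi> \<and>
    (\<forall>f\<in>homs. \<forall>v. \<Psi> (f v) = \<rho>t (inv h) (f (U v)))"
proof -
  define \<Psi> where "\<Psi> w = (THE w'. (w, w') \<in> graph)" for w
  have \<Psi>: "\<Psi> w = w'" if "(w, w') \<in> graph" for w w'
    unfolding \<Psi>_def using that graph_functional by blast
  have in_graph: "(w, \<Psi> w) \<in> graph" for w using graph_total[of w] \<Psi> by blast
  have lin: "Vector_Spaces.linear st st \<Psi>"
    by unfold_locales (intro \<Psi> graph_add graph_scale in_graph)+
  have act: "\<Psi> (st (\<omega> y) (\<rho>t y w)) = \<rho>t y (\<Psi> w)" if y: "y \<in> Jt" for y w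
  proof -
    have "(st (\<omega> y) (\<rho>t y w), st (\<omega> y) (st (inverse (\<omega> y)) (\<rho>t y (\<Psi> w)))) \<in> graph"
      by (intro graph_scale graph_act y in_graph)
    then show ?thesis using \<Psi> \<omega>_nz[OF y] by simp
  qed
  have hom: "\<Psi> \<in> rep_homs Jt st (\<lambda>y w. st (\<omega> y) (\<rho>t y w)) st \<rho>t"
    using lin act by (simp add: rep_homs_def)
  have on_homs: "\<Psi> (f v) = \<rho>t (inv h) (f (U v))" if f: "f \<in> homs" for f v
  proof -
    have "\<omega> \<one> = 1" by (rule \<omega>_J[OF J_one])
    then have "src (\<one>, f) v = f v" "dst (\<one>, f) v = \<rho>t (inv h) (f (U v))"
      using stab_carrier[OF h] by (simp_all add: src_def dst_def \<rho>t_one)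
    then show ?thesis using \<Psi>[OF graph_single[of "(\<one>, f)" v]] f Jt_one by simp
  qed
  obtain v :: 'v where v: "v \<noteq> 0" using nontrivial by blast
  have \<phi>h: "\<phi> \<in> homs" using \<phi> by (simp add: homs_def)
  have nz: "\<Psi> (\<phi> v) \<noteq> 0"
  proof
    assume "\<Psi> (\<phi> v) = 0"
    then have "\<rho>t (inv h) (\<phi> (U v)) = 0" by (simp add: on_homs[OF \<phi>h])
    then have "\<rho>t h (\<rho>t (inv h) (\<phi> (U v))) = 0" by (simp add: \<rho>t_zero stab_Jt[OF h])
    then have "\<phi> (U v) = \<phi> 0" by (simp add: \<rho>t_inv stab_Jt[OF h] homs_zero[OF \<phi>h])
    then have "U v = 0" by (rule injD[OF \<phi>_inj])
    then show False using v intertw_zero_iff[OF U] by simp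
  qed
  have "simple_action Jt st (\<lambda>y w. st (\<omega> y) (\<rho>t y w))"
    unfolding simple_action_def
  proof (intro allI impI; elim conjE)
    fix L assume L: "wt.subspace L" and stable: "\<forall>y\<in>Jt. \<forall>w\<in>L. st (\<omega> y) (\<rho>t y w) \<in> L"
    show "L = {0} \<or> L = UNIV"
    proof (rule simple_actionD[OF simple_\<rho>t L])
      fix y w assume y: "y \<in> Jt" and w: "w \<in> L"
      have "st (inverse (\<omega> y)) (st (\<omega> y) (\<rho>t y w)) \<in> L"
        by (rule wt.subspace_scale[OF L]) (use stable y w in blast)
      then show "\<rho>t y w \<in> L" using \<omega>_nz[OF y] by simp
    qed
  qed
  then have "inj \<Psi>" by (rule simple_hom_inj[OF _ hom nz]) (rule \<rho>t_zero)
  moreover have "surj \<Psi>" by (rule simple_hom_surj[OF simple_\<rho>t hom nz])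
  ultimately show ?thesis using hom on_homs by (intro bexI[of _ \<Psi>]) (simp_all add: bij_def)
qed

end

lemma trivial_character: "(\<lambda>_. 1) \<in> quotient_characters G Jt J"
  by (simp add: quotient_characters_def hom_def mult_group_def)

text \<open>For \<open>g\<close> in the radical the trivial character is an admissible \<open>\<omega>\<close>, so \<open>twist_iso\<close> provides an
  endomorphism of \<open>\<rho>t\<close>, a scalar by Schur's lemma.  Hence \<open>g\<close> acts on all copies of \<open>\<rho>\<close> in \<open>\<rho>t\<close>
  through the same operator.\<close>

lemma rad_acts:
  assumes g: "g \<in> rad"
  shows "\<exists>U. intertw g U \<and> (\<forall>f\<in>homs. \<forall>v. \<rho>t g (f v) = f (U v))"
proof -
  have gs: "g \<in> stab" by (rule rad_stab[OF g])
  have gJ: "g \<in> Jt" by (rule stab_Jt[OF gs])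
  obtain U where U: "intertw g U" using stab_intertw[OF gs] by (rule exE)
  have one: "1 = \<beta> k g" if k: "k \<in> stab" for k
    using \<beta>_sym[OF gs k] g k by (simp add: rad_def)
  obtain \<Psi> where \<Psi>: "\<Psi> \<in> rep_homs Jt st (\<lambda>y w. st 1 (\<rho>t y w)) st \<rho>t" "bij \<Psi>"
    and on_homs: "\<And>f v. f \<in> homs \<Longrightarrow> \<Psi> (f v) = \<rho>t (inv g) (f (U v))"
    using twist_iso[OF gs U trivial_character one] by blast
  have "\<Psi> \<in> rep_homs Jt st \<rho>t st \<rho>t" using \<Psi>(1) by simp
  then obtain c where c: "\<And>w. \<Psi> w = st c w"
    using schur[OF level_subgroup[OF Jt] \<rho>t] by blast
  have \<phi>h: "\<phi> \<in> homs" using \<phi> by (simp add: homs_def)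
  have c0: "c \<noteq> 0"
  proof
    assume "c = 0"
    then have "\<Psi> w = 0" for w by (simp add: c)
    then have "w = w'" for w w' :: 'w using \<Psi>(2) by (auto simp: bij_def dest: injD[of _ w w'])
    then have "v = 0" for v :: 'v using injD[OF \<phi>_inj, of v 0] by blast
    then show False using nontrivial by blast
  qed
  have "\<rho>t g (f v) = f (s (inverse c) (U v))" if f: "f \<in> homs" for f v
  proof -
    have "\<rho>t g (\<rho>t (inv g) (f (U v))) = \<rho>t g (st c (f v))"
      using on_homs[OF f, of v] c[of "f v"] by simp
    then have "f (U v) = st c (\<rho>t g (f v))" by (simp add: \<rho>t_inv gJ \<rho>t_scale)
    then show ?thesis using c0 by (simp add: homs_scale[OF f])
  qed
  moreover have "intertw g (\<lambda>v. s (inverse c) (U v))"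
    using c0 by (intro intertw_scale U gJ) simp
  ultimately show ?thesis by blast
qed

lemma Jt_group: "group (G\<lparr>carrier := Jt\<rparr>)"
  by (rule subgroup.subgroup_is_group[OF level_subgroup[OF Jt] is_group])

lemma Jt_m_inv: "x \<in> Jt \<Longrightarrow> inv\<^bsub>G\<lparr>carrier := Jt\<rparr>\<^esub> x = inv x"
  by (rule m_inv_consistent[OF level_subgroup[OF Jt]])

lemma stab_subgroup_Jt: "subgroup stab (G\<lparr>carrier := Jt\<rparr>)"
  using subgroup_incl[OF level_subgroup[OF level_stab] level_subgroup[OF Jt]] stab_Jt by blast

text \<open>A character of \<open>Jt\<close> trivial on \<open>stab\<close>, or one extending \<open>\<lambda>k. \<beta> k h\<close>, does not change the class of
  \<open>\<rho>t\<close>.  The former separate \<open>stab\<close> from the rest of \<open>Jt\<close>, and the latter restrict to the whole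
  pairing.\<close>

lemma dagger_subset_rad: "dagger_group G J Jt st \<rho>t \<subseteq> rad"
proof
  fix g assume g: "g \<in> dagger_group G J Jt st \<rho>t"
  then have gJ: "g \<in> Jt" by (simp add: dagger_group_def)
  have trivial: "\<omega> g = 1"
    if h: "h \<in> stab" and \<omega>: "\<omega> \<in> quotient_characters G Jt J" and eq: "\<And>k. k \<in> stab \<Longrightarrow> \<omega> k = \<beta> k h" for h \<omega>
  proof -
    obtain U where U: "intertw h U" using stab_intertw[OF h] by (rule exE)
    have "\<exists>\<Psi>\<in>rep_homs Jt st (\<lambda>y w. st (\<omega> y) (\<rho>t y w)) st \<rho>t. bij \<Psi>"
      using twist_iso[OF h U \<omega> eq] by blast
    then show ?thesis using g \<omega> by (simp add: dagger_group_def)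
  qed
  interpret K: group "G\<lparr>carrier := Jt\<rparr>" by (rule Jt_group)
  have gs: "g \<in> stab"
  proof (rule ccontr)
    assume "g \<notin> stab"
    have "\<exists>\<omega>\<in>hom (G\<lparr>carrier := Jt\<rparr>) (mult_group :: complex monoid). (\<forall>a\<in>stab. \<omega> a = 1) \<and> \<omega> g \<noteq> 1"
    proof (rule K.separating_character[OF stab_subgroup_Jt])
      show "x \<otimes>\<^bsub>G\<lparr>carrier := Jt\<rparr>\<^esub> y \<otimes>\<^bsub>G\<lparr>carrier := Jt\<rparr>\<^esub> inv\<^bsub>G\<lparr>carrier := Jt\<rparr>\<^esub> x \<otimes>\<^bsub>G\<lparr>carrier := Jt\<rparr>\<^esub> inv\<^bsub>G\<lparr>carrier := Jt\<rparr>\<^esub> y \<in> stab"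
        if "x \<in> carrier (G\<lparr>carrier := Jt\<rparr>)" "y \<in> carrier (G\<lparr>carrier := Jt\<rparr>)" for x y
        using that commutators[of x y] stab_J by (simp add: Jt_m_inv)
    qed (use gJ \<open>g \<notin> stab\<close> in simp_all)
    then obtain \<omega> :: "'g \<Rightarrow> complex" where \<omega>: "\<omega> \<in> hom (G\<lparr>carrier := Jt\<rparr>) mult_group"
      "\<forall>a\<in>stab. \<omega> a = 1" "\<omega> g \<noteq> 1" by blast
    have "\<omega> \<in> quotient_characters G Jt J" using \<omega> stab_J by (simp add: quotient_characters_def)
    moreover have "\<omega> k = \<beta> k \<one>" if "k \<in> stab" for k
      using \<beta>_sym[OF stab_one that] \<beta>_one[OF that] that \<omega>(2) by simp
    ultimately have "\<omega> g = 1" by (rule trivial[OF stab_one])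
    then show False using \<omega>(3) by simp
  qed
  have "\<beta> g h = 1" if h: "h \<in> stab" for h
  proof -
    let ?\<omega> = "\<lambda>k. \<beta> k h"
    have "?\<omega> \<in> hom (G\<lparr>carrier := Jt\<rparr>\<lparr>carrier := stab\<rparr>) mult_group"
      using h by (auto simp: hom_def mult_group_def \<beta>_mult_left \<beta>_nonzero)
    then have "\<exists>\<omega>\<in>hom (G\<lparr>carrier := Jt\<rparr>) mult_group. \<forall>a\<in>stab. \<omega> a = \<beta> a h"
    proof (rule K.extend_character[OF stab_subgroup_Jt])
      fix x y assume "x \<in> carrier (G\<lparr>carrier := Jt\<rparr>)" "y \<in> carrier (G\<lparr>carrier := Jt\<rparr>)"
      then have "x \<otimes> y \<otimes> inv x \<otimes> inv y \<in> J" "inv\<^bsub>G\<lparr>carrier := Jt\<rparr>\<^esub> x = inv x" "inv\<^bsub>G\<lparr>carrier := Jt\<rparr>\<^esub> y = inv y"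
        using commutators Jt_m_inv by auto
      then show "x \<otimes>\<^bsub>G\<lparr>carrier := Jt\<rparr>\<^esub> y \<otimes>\<^bsub>G\<lparr>carrier := Jt\<rparr>\<^esub> inv\<^bsub>G\<lparr>carrier := Jt\<rparr>\<^esub> x \<otimes>\<^bsub>G\<lparr>carrier := Jt\<rparr>\<^esub> inv\<^bsub>G\<lparr>carrier := Jt\<rparr>\<^esub> y \<in> stab \<and>
        \<beta> (x \<otimes>\<^bsub>G\<lparr>carrier := Jt\<rparr>\<^esub> y \<otimes>\<^bsub>G\<lparr>carrier := Jt\<rparr>\<^esub> inv\<^bsub>G\<lparr>carrier := Jt\<rparr>\<^esub> x \<otimes>\<^bsub>G\<lparr>carrier := Jt\<rparr>\<^esub> inv\<^bsub>G\<lparr>carrier := Jt\<rparr>\<^esub> y) h = 1"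
        using stab_J \<beta>_J[OF _ h] by simp
    qed
    then obtain \<omega> where \<omega>: "\<omega> \<in> hom (G\<lparr>carrier := Jt\<rparr>) mult_group" "\<And>a. a \<in> stab \<Longrightarrow> \<omega> a = \<beta> a h" by blast
    have "\<omega> \<in> quotient_characters G Jt J"
      using \<omega> stab_J \<beta>_J[OF _ h] by (simp add: quotient_characters_def)
    from trivial[OF h this \<omega>(2)] show ?thesis using \<omega>(2)[OF gs] by simp
  qed
  then show "g \<in> rad" using gs by (simp add: rad_def)
qed

text \<open>Let \<open>\<theta>\<close> be an isomorphism from the twist of \<open>\<rho>t\<close> by \<open>\<omega>\<close> to \<open>\<rho>t\<close>.  Then \<open>\<theta> \<circ> \<phi>\<close> is another
  copy of \<open>\<rho>\<close>, on which \<open>g\<close> acts through the same operator as on \<open>\<phi>\<close>; comparison gives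
  \<open>\<omega> g = 1\<close>.\<close>

lemma rad_subset_dagger: "rad \<subseteq> dagger_group G J Jt st \<rho>t"
proof
  fix g assume g: "g \<in> rad"
  have gJ: "g \<in> Jt" by (rule stab_Jt[OF rad_stab[OF g]])
  obtain U where U: "intertw g U" and act: "\<And>f v. f \<in> homs \<Longrightarrow> \<rho>t g (f v) = f (U v)"
    using rad_acts[OF g] by blast
  have "\<omega> g = 1"
    if \<omega>: "\<omega> \<in> quotient_characters G Jt J"
      and \<theta>: "\<theta> \<in> rep_homs Jt st (\<lambda>y w. st (\<omega> y) (\<rho>t y w)) st \<rho>t" and bij: "bij \<theta>" for \<omega> \<theta>
  proof -
    have \<phi>h: "\<phi> \<in> homs" using \<phi> by (simp add: homs_def)
    interpret \<theta>: Vector_Spaces.linear st st \<theta> using \<theta> by (simp add: rep_homs_def)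
    have \<theta>_act: "\<theta> (st (\<omega> y) (\<rho>t y w)) = \<rho>t y (\<theta> w)" if "y \<in> Jt" for y w
      using \<theta> that by (simp add: rep_homs_def)
    have \<theta>\<phi>: "(\<lambda>v. \<theta> (\<phi> v)) \<in> homs"
      unfolding homs_def rep_homs_def
    proof (intro CollectI conjI ballI allI)
      show "Vector_Spaces.linear s st (\<lambda>v. \<theta> (\<phi> v))"
        by unfold_locales (simp_all add: homs_add[OF \<phi>h] homs_scale[OF \<phi>h] \<theta>.add \<theta>.scale)
      fix j v assume j: "j \<in> J"
      have "\<omega> j = 1" using \<omega> j by (simp add: quotient_characters_def)
      then show "\<theta> (\<phi> (\<rho> j v)) = \<rho>t j (\<theta> (\<phi> v))"
        using \<theta>_act[OF Jt_J[OF j], of "\<phi> v"] by (simp add: homs_J[OF \<phi>h j])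
    qed
    obtain v :: 'v where v: "v \<noteq> 0" using nontrivial by blast
    have "\<theta> (st (\<omega> g) (\<rho>t g (\<phi> v))) = \<theta> (\<rho>t g (\<phi> v))"
      using \<theta>_act[OF gJ, of "\<phi> v"] act[OF \<theta>\<phi>, of v] act[OF \<phi>h, of v] by simp
    then have eq: "st (\<omega> g) (\<phi> (U v)) = st 1 (\<phi> (U v))"
      using bij act[OF \<phi>h, of v] by (auto simp: bij_def dest: injD)
    have "U v \<noteq> 0" using v intertw_zero_iff[OF U] by simp
    then have "\<phi> (U v) \<noteq> 0" using injD[OF \<phi>_inj, of "U v" 0] homs_zero[OF \<phi>h] by auto
    then show ?thesis using eq by (simp only: wt.scale_cancel_right) simp
  qed
  then show "g \<in> dagger_group G J Jt st \<rho>t" using gJ by (auto simp: dagger_group_def)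
qed

lemma dagger_eq_rad: "dagger_group G J Jt st \<rho>t = rad"
  using dagger_subset_rad rad_subset_dagger by (rule equalityI)

text \<open>The action of the radical on one copy of \<open>\<rho>\<close> in \<open>\<rho>t\<close> extends \<open>\<rho>\<close> to the radical.  The
  isomorphism depends on this extension, that is, on \<open>\<rho>t\<close>.\<close>

lemma group_algebra_iso:
  "\<exists>h. h \<in> alg_iso (HA rad) (group_algebra (G\<lparr>carrier := rad\<rparr> Mod J))"
proof -
  have \<phi>h: "\<phi> \<in> homs" using \<phi> by (simp add: homs_def)
  have "\<exists>U. intertw g U \<and> (\<forall>v. \<rho>t g (\<phi> v) = \<phi> (U v))" if "g \<in> rad" for g
    using rad_acts[OF that] \<phi>h by blast
  then obtain R where R: "\<And>g. g \<in> rad \<Longrightarrow> intertw g (R g)"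
    and R_act: "\<And>g v. g \<in> rad \<Longrightarrow> \<rho>t g (\<phi> v) = \<phi> (R g v)"
    by metis
  have mult: "R (g \<otimes> h) v = R g (R h v)" if "g \<in> rad" "h \<in> rad" for g h v
  proof (rule injD[OF \<phi>_inj])
    have "\<phi> (R (g \<otimes> h) v) = \<rho>t (g \<otimes> h) (\<phi> v)" using R_act[OF level_mult[OF level_rad that]] by simp
    also have "\<dots> = \<rho>t g (\<rho>t h (\<phi> v))"
      by (rule \<rho>t_mult[OF stab_Jt[OF rad_stab[OF that(1)]] stab_Jt[OF rad_stab[OF that(2)]]])
    finally show "\<phi> (R (g \<otimes> h) v) = \<phi> (R g (R h v))" by (simp add: R_act that)
  qed
  have J_act: "R j v = \<rho> j v" if j: "j \<in> J" for j v
    by (rule injD[OF \<phi>_inj]) (simp add: homs_J[OF \<phi>h j] R_act level_J[OF level_rad j])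
  have "rad \<subseteq> stab" using rad_stab by blast
  from symbol_alg_iso[OF level_rad this R mult J_act] show ?thesis by blast
qed

end

theorem theorem3p14:
  fixes GG :: "('f::{field,metric_space} alg_closure^'n^'n::finite) set"
    and G :: "('f^'n^'n) monoid"
    and Z Gb J Jt I Jd :: "('f^'n^'n) set"
    and s :: "complex \<Rightarrow> 'v::ab_group_add \<Rightarrow> 'v" and \<rho> :: "'f^'n^'n \<Rightarrow> 'v \<Rightarrow> 'v"
    and st :: "complex \<Rightarrow> 'w::ab_group_add \<Rightarrow> 'w" and \<rho>t :: "'f^'n^'n \<Rightarrow> 'w \<Rightarrow> 'w"
  assumes "nonarch_local_field TYPE('f)"
    and "connected_reductive_group GG"
    and "G = rational_points GG"
    and "Z = center_points GG"
    and "Gb \<lhd> G"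
    and "openin (top_of_set (carrier G)) Gb"
    and "Gb \<subseteq> zero_group GG"
    and "finite (rcosets\<^bsub>G\<lparr>carrier := zero_group GG\<rparr>\<^esub> Gb)"
    and "derived G (carrier G) \<subseteq> Gb"
    and "JG_pair_wc G Z Gb J s \<rho> Jt st \<rho>t"
    and "I = intertwining G J s \<rho>"
    and "Jd = dagger_group G J Jt st \<rho>t"
  shows "hecke_map G I (carrier G) J \<rho>
           \<in> alg_iso (alg_center (hecke_algebra G I J s \<rho>))
                     (alg_center (hecke_algebra G (carrier G) J s \<rho>))
       \<and> hecke_map G Jd I J \<rho>
           \<in> alg_iso (hecke_algebra G Jd J s \<rho>) (alg_center (hecke_algebra G I J s \<rho>))
       \<and> (\<exists>h. h \<in> alg_iso (hecke_algebra G Jd J s \<rho>)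
                          (group_algebra (G\<lparr>carrier := Jd\<rparr> Mod J)))"
proof -
  have "group G" using \<open>Gb \<lhd> G\<close> by (simp add: normal_def)
  then interpret second_countable_group G
    using second_countable_group_rational_points[OF assms(1)] assms(3) by simp
  have J: "subgroup J G" "openin (top_of_set (carrier G)) J" and Jt: "subgroup Jt G"
    and J_eq: "J = Jt \<inter> Gb"
    and \<rho>: "irreducible_rep G J s \<rho>" and \<rho>t: "irreducible_rep G Jt st \<rho>t"
    and emb: "\<exists>\<phi>\<in>rep_homs J s \<rho> st \<rho>t. inj \<phi>" and wc: "intertwining G J s \<rho> \<subseteq> Jt"
    using assms(10) unfolding JG_pair_wc_def JG_pair_def open_compact_subgroup_def
      open_compact_mod_subgroup_def by blast+
  obtain \<phi> where \<phi>: "\<phi> \<in> rep_homs J s \<rho> st \<rho>t" "inj \<phi>" using emb by (rule bexE)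
  interpret hecke_pair G J s \<rho>
    by (intro hecke_pair.intro hecke_pair_axioms.intro second_countable_group_axioms J \<rho>)
  interpret clifford_cover G J s \<rho> Jt st \<rho>t \<phi>
  proof unfold_locales
    have "J \<subseteq> Jt" unfolding J_eq by (rule Int_lower1)
    then show "level Jt" using Jt by (simp add: level_def)
    show "irreducible_rep G Jt st \<rho>t" by (rule \<rho>t)
    show "\<phi> \<in> rep_homs J s \<rho> st \<rho>t" "inj \<phi>" by (rule \<phi>)+
    fix x y assume x: "x \<in> Jt" and y: "y \<in> Jt"
    then have G: "x \<in> carrier G" "y \<in> carrier G" using subgroup.subset[OF Jt] by auto
    have "x \<otimes>\<^bsub>G\<^esub> y \<otimes>\<^bsub>G\<^esub> inv\<^bsub>G\<^esub> x \<otimes>\<^bsub>G\<^esub> inv\<^bsub>G\<^esub> y \<in> derived G (carrier G)"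
      unfolding derived_def by (rule generate.incl) (use G in blast)
    moreover have "x \<otimes>\<^bsub>G\<^esub> y \<otimes>\<^bsub>G\<^esub> inv\<^bsub>G\<^esub> x \<otimes>\<^bsub>G\<^esub> inv\<^bsub>G\<^esub> y \<in> Jt"
      using x y by (intro subgroup.m_closed[OF Jt] subgroup.m_inv_closed[OF Jt])
    ultimately show "x \<otimes>\<^bsub>G\<^esub> y \<otimes>\<^bsub>G\<^esub> inv\<^bsub>G\<^esub> x \<otimes>\<^bsub>G\<^esub> inv\<^bsub>G\<^esub> y \<in> J"
      using assms(9) J_eq by blast
  qed
  have I: "I = stab" using assms(11) intertwining_eq_stab[OF wc] by simp
  have Jd: "Jd = rad" using assms(12) dagger_eq_rad by simp
  show ?thesis
    unfolding I Jd using hecke_map_center_iso[OF wc] hecke_map_rad_iso group_algebra_iso by blast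
qed

end
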